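(* Let $n\ge2$ and let $\mathcal{A}(t,x)=(A_0(t,x),\dots,A_n(t,x))$ be $C^\infty$ in $(t,x)\in\mathbb{R}\times\mathbb{R}^n$. Suppose that for $0\le j\le n$, $$|A_j(t,x)|\le C(1+|t|)^M\qquad\text{for }|t|\ge t_0,$$ with constants $C,M>0$. Suppose in addition that the functions $|A_j(t,x)|$ are locally integrable in $\mathbb{R}^{n+1}$, that $A_j(t,x)=0$ for $|x|\ge R>0$, $0\le j\le n$, and that $$\int_{-\infty}^{\infty}\Big(A_0+\sum_{j=1}^n\omega_jA_j\Big)(t+s,x+s\omega)\,ds=0\qquad\text{for all }(t,x)\in\mathbb{R}\times\mathbb{R}^n,\ \omega\in S^{n-1}.$$ Then there exists $\varphi\in C^\infty(\mathbb{R}\times\mathbb{R}^n)$ such that (i) $A_0=\partial_t\varphi$ and $A_j=\partial_{x_j}\varphi$ for $1\le j\le n$; (ii) $\operatorname{supp}\varphi\subseteq\mathbb{R}\times\{|x|\le R\}$.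
   Context: Functions are complex-valued. $S^{n-1}$ is the unit sphere of $\mathbb{R}^n$. $t_0>0$ and $R>0$ are fixed numbers. *)

theory Defs
  imports "HOL-Analysis.Analysis"
begin

text \<open>Globally defined maps of class \<open>C\<^sup>k\<close>, in the sense of real Frechet differentiability.
  On a Euclidean domain, asking all directional derivatives to be of class \<open>C\<^sup>k\<close> is the same as
  asking it of the derivative as a map into the space of bounded linear maps.\<close>

primrec C_k :: "nat \<Rightarrow> ('a::euclidean_space \<Rightarrow> 'b::real_normed_vector) \<Rightarrow> bool" where
  "C_k 0 f \<longleftrightarrow> continuous_on UNIV f"
| "C_k (Suc k) f \<longleftrightarrow>
     (\<forall>x. f differentiable (at x)) \<and> (\<forall>v. C_k k (\<lambda>x. frechet_derivative f (at x) v))"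

definition C_infinity :: "('a::euclidean_space \<Rightarrow> 'b::real_normed_vector) \<Rightarrow> bool" where
  "C_infinity f \<longleftrightarrow> (\<forall>k. C_k k f)"

definition locally_integrable :: "('a::euclidean_space \<Rightarrow> real) \<Rightarrow> bool" where
  "locally_integrable f \<longleftrightarrow> (\<forall>K. compact K \<longrightarrow> set_integrable lborel K f)"

definition supp :: "('a::topological_space \<Rightarrow> 'b::zero) \<Rightarrow> 'a set" where
  "supp f = closure {x. f x \<noteq> 0}"

end

theory Submission
  imports Defs "HOL-Complex_Analysis.Complex_Analysis" "HOL-Probability.Sinc_Integral"
begin

text \<open>
  Write \<open>\<alpha> = A0 dt + \<Sum> A j dx\<^sub>j\<close>. The theorem says that \<open>\<alpha>\<close> has a potential supported in the
  cylinder \<open>norm x \<le> R\<close>, and it is enough to show that \<open>\<alpha>\<close> is closed. Indeed the Poincare lemma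
  then provides a potential; its gradient vanishes outside the cylinder, whose complement is connected
  because there are at least two space dimensions, so the potential is constant there and the constant
  can be subtracted. The potential is smooth because its derivative is.

  The purely spatial part of \<open>d\<alpha> = 0\<close> is the hard one. If \<open>\<alpha>\<close> were integrable in time one could
  argue with its space-time Fourier transform. The wave \<open>exp (\<i> (\<tau> t - \<xi> \<bullet> x))\<close> is constant
  along the light rays of direction \<open>\<omega>\<close> exactly when \<open>\<omega> \<bullet> \<xi> = \<tau>\<close>, so the hypothesis says that the
  transform of \<open>A0 + \<omega> \<bullet> A\<close> vanishes at such \<open>(\<tau>, \<xi>)\<close>. Let \<open>\<xi> = \<rho> e1\<close> with
  \<open>\<rho> > \<bar>\<tau>\<bar>\<close> and let \<open>e2\<close> be orthogonal to \<open>e1\<close>. Two unit vectors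
  \<open>\<omega>\<close> in the plane of \<open>e1\<close> and \<open>e2\<close> qualify, and they differ only in the sign of their \<open>e2\<close>
  component; subtracting the two relations shows that the \<open>e2\<close> component of \<open>A\<close> has vanishing transform.
  Since \<open>\<alpha>\<close> has compact support in \<open>x\<close>, the transform is analytic in \<open>\<xi>\<close>, and this
  persists for every \<open>\<rho>\<close>. So the transform of the spatial part is parallel to \<open>\<xi>\<close>, which is to say
  that its curl is zero.

  As \<open>\<alpha>\<close> may grow polynomially in time, its transform in time is only a distribution, and the choice of
  \<open>\<omega>\<close> above depends on \<open>\<tau>\<close>. Following Carleman, the real frequency axis is therefore replaced by a circle
  \<open>norm \<tau> = L\<close> in the complex plane, on which one uses the half-line transform \<open>\<integral>\<^sub>0\<^sup>\<infinity>\<close> in the upper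
  half-plane and \<open>- \<integral> \<close> over the negative half-line in the lower one, with the weight
  \<open>(1 - (\<tau>/L)\<^sup>2)\<^sup>N\<close>, whose zeros at the two real points of the circle compensate the growth. All integrals
  converge absolutely, and the ray hypothesis makes the two half-line transforms fit together to one entire
  function, so that Cauchy's theorem applies (lemma \<open>ray_orthogonality\<close>). A direction depending on
  \<open>\<tau>\<close> may be inserted through its power series (lemma \<open>analytic_substitution\<close>); this gives
  \<open>band_orthogonality\<close>, the argument of the previous paragraph for frequencies up to \<open>L\<close>. As
  \<open>L\<close> tends to infinity the kernel in time concentrates at one instant, and the statement for the
  Fourier transform in \<open>x\<close> at a fixed time results (lemma \<open>plane_fourier_vanishes\<close>).

  Once the spatial part is closed, the mixed components \<open>B = \<partial>\<^sub>t A j - \<partial>\<^sub>j A0\<close> of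
  \<open>d\<alpha>\<close> have vanishing integrals over all light rays, and a scalar function with this property is zero
  (lemma \<open>scalar_ray_transform_injective\<close>): rotating the direction of the ray shows inductively that all
  moments of \<open>B\<close> along every ray vanish.
\<close>

section \<open>Functions with vanishing line integrals\<close>

lemma lborel_translate:
  fixes f :: "'a::euclidean_space \<Rightarrow> 'b::{banach, second_countable_topology}"
  assumes [measurable]: "f \<in> borel_measurable borel"
  shows "(LINT p|lborel. f (p + c)) = (LINT p|lborel. f p)"
proof -
  have "(LINT p|lborel. f p) = (LINT p|distr lborel borel ((+) c). f p)"
    by (simp add: lborel_distr_plus)
  also have "\<dots> = (LINT p|lborel. f (c + p))"
    by (subst integral_distr) auto
  finally show ?thesis by (simp add: add.commute)
qed

lemma lborel_translate_integrable:
  fixes f :: "'a::euclidean_space \<Rightarrow> 'b::{banach, second_countable_topology}"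
  assumes "integrable lborel f"
  shows "integrable lborel (\<lambda>p. f (p + c))"
proof -
  have [measurable]: "f \<in> borel_measurable borel" using assms by auto
  have "integrable (distr lborel borel ((+) c)) f"
    using assms by (simp add: lborel_distr_plus)
  then have "integrable lborel (\<lambda>p. f (c + p))"
    by (subst (asm) integrable_distr_eq) auto
  then show ?thesis by (simp add: add.commute)
qed

text \<open>
  A disintegration of Lebesgue measure along the direction \<open>d\<close> without choosing coordinates: the integral of
  \<open>g\<close> is averaged over the translates of the slab \<open>0 \<le> l \<bullet> p \<le> 1\<close>, each line
  parallel to \<open>d\<close> meeting the slab in a segment of parameter length one.
\<close>

lemma integral_eq_0_if_line_integrals_eq_0:
  fixes g :: "'a::euclidean_space \<Rightarrow> complex" and d l :: 'a
  assumes g: "integrable lborel g" and ld: "l \<bullet> d = 1"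
    and line: "\<And>p. (LINT s|lborel. g (p + s *\<^sub>R d)) = 0"
  shows "(LINT p|lborel. g p) = 0"
proof -
  have gm[measurable]: "g \<in> borel_measurable borel" "g \<in> borel_measurable lborel" using g by auto
  define H where "H = (\<lambda>(s::real, p). indicator {0..1} (l \<bullet> p) *\<^sub>R g (p + s *\<^sub>R d))"
  have Hm: "H \<in> borel_measurable (lborel \<Otimes>\<^sub>M lborel)"
    unfolding H_def by measurable
  have shift: "indicator {0..1} (l \<bullet> (p - s *\<^sub>R d)) = (indicator {l \<bullet> p - 1..l \<bullet> p} s :: real)" for p s
    using ld by (auto simp: indicator_def inner_diff_right)
  have H2: "integrable lborel (\<lambda>p. H (s, p))" for s
    unfolding H_def split using lborel_translate_integrable[OF g, of "s *\<^sub>R d"]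
    by (intro Bochner_Integration.integrable_bound[OF lborel_translate_integrable[OF g, of "s *\<^sub>R d"]]) (auto simp: indicator_def)
  have H3: "(LINT p|lborel. norm (H (s, p))) = (LINT p|lborel. indicator {l \<bullet> p - 1..l \<bullet> p} s * norm (g p))" for s
  proof -
    have "(LINT p|lborel. norm (H (s, p))) = (LINT p|lborel. (\<lambda>p. indicator {0..1} (l \<bullet> (p - s *\<^sub>R d)) * norm (g p)) (p + s *\<^sub>R d))"
      by (simp add: H_def)
    also have "\<dots> = (LINT p|lborel. indicator {0..1} (l \<bullet> (p - s *\<^sub>R d)) * norm (g p))"
      by (rule lborel_translate) measurable
    finally show ?thesis by (simp add: shift)
  qed
  have H4: "(LINT p|lborel. H (s, p)) = (LINT p|lborel. indicator {l \<bullet> p - 1..l \<bullet> p} s *\<^sub>R g p)" for s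
  proof -
    have "(LINT p|lborel. H (s, p)) = (LINT p|lborel. (\<lambda>p. indicator {0..1} (l \<bullet> (p - s *\<^sub>R d)) *\<^sub>R g p) (p + s *\<^sub>R d))"
      by (simp add: H_def)
    also have "\<dots> = (LINT p|lborel. indicator {0..1} (l \<bullet> (p - s *\<^sub>R d)) *\<^sub>R g p)"
      by (rule lborel_translate) measurable
    finally show ?thesis by (simp add: shift)
  qed
  \<comment> \<open>The function \<open>K\<close> is \<open>H\<close> after the translation by \<open>s\<close> times \<open>d\<close>: its integral in \<open>s\<close> is \<open>g\<close>, while
    the integral of \<open>H\<close> in \<open>s\<close> is a line integral of \<open>g\<close>.\<close>
  define K where "K = (\<lambda>(s::real, p). indicator {l \<bullet> p - 1..l \<bullet> p} s *\<^sub>R g p)"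
  have Km[measurable]: "K \<in> borel_measurable (lborel \<Otimes>\<^sub>M lborel)"
    unfolding K_def indicator_def atLeastAtMost_iff by measurable
  have ind: "integrable lborel (indicator {l \<bullet> p - 1..l \<bullet> p} :: real \<Rightarrow> real)" for p
    by simp
  have Kswap: "integrable (lborel \<Otimes>\<^sub>M lborel) (\<lambda>(p, s). K (s, p))"
  proof (rule lborel_pair.Fubini_integrable)
    show "(\<lambda>(p, s). K (s, p)) \<in> borel_measurable (lborel \<Otimes>\<^sub>M lborel)" by measurable
    have "(LINT s|lborel. norm (K (s, p))) = norm (g p)" for p
    proof -
      have "(LINT s|lborel. norm (K (s, p))) = (LINT s|lborel. indicator {l \<bullet> p - 1..l \<bullet> p} s * norm (g p))"
        by (simp add: K_def)
      also have "\<dots> = norm (g p)" by (subst integral_mult_left_zero) simp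
      finally show ?thesis .
    qed
    then show "integrable lborel (\<lambda>x. LINT y|lborel. norm (case (x, y) of (p, s) \<Rightarrow> K (s, p)))"
      using g by simp
    show "AE x in lborel. integrable lborel (\<lambda>y. case (x, y) of (p, s) \<Rightarrow> K (s, p))"
      using ind by (simp add: K_def)
  qed
  have Kint: "integrable (lborel \<Otimes>\<^sub>M lborel) K"
    using lborel_pair.integrable_product_swap[OF Kswap] by (simp add: case_prod_unfold)
  have Kint1: "(LINT s|lborel. LINT p|lborel. K (s, p)) = (LINT p|lborel. g p)"
  proof -
    have "(LINT s|lborel. LINT p|lborel. K (s, p)) = (LINT p|lborel. LINT s|lborel. K (s, p))"
      using lborel_pair.Fubini_integral[of "\<lambda>p s. K (s,p)"] Kswap by simp
    also have "\<dots> = (LINT p|lborel. g p)"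
      by (simp add: K_def)
    finally show ?thesis .
  qed
  have Hint: "integrable (lborel \<Otimes>\<^sub>M lborel) H"
  proof (rule lborel_pair.Fubini_integrable[OF Hm])
    have "integrable lborel (\<lambda>s. LINT p|lborel. norm (K (s, p)))"
      using lborel_pair.integrable_fst'[OF integrable_norm[OF Kint]] by simp
    then show "integrable lborel (\<lambda>x. LINT y|lborel. norm (H (x, y)))"
      unfolding H3 by (simp add: K_def)
  qed (use H2 in auto)
  have "(LINT p|lborel. g p) = (LINT s|lborel. LINT p|lborel. H (s, p))"
    unfolding Kint1[symmetric] H4 by (simp add: K_def)
  also have "\<dots> = (LINT p|lborel. LINT s|lborel. H (s, p))"
    using lborel_pair.Fubini_integral[of "\<lambda>s p. H (s,p)"] Hint by simp
  also have "\<dots> = 0"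
    using line by (simp add: H_def)
  finally show ?thesis .
qed

section \<open>Substitution into a holomorphic parameter\<close>

lemma powser_eq_0_on_reals:
  fixes a :: "nat \<Rightarrow> complex"
  assumes "0 < e" and sums: "\<And>s. norm s < e \<Longrightarrow> (\<lambda>k. a k * s ^ k) sums F s"
    and zero: "\<And>s::real. \<bar>s\<bar> < e \<Longrightarrow> F (of_real s) = 0"
  shows "a k = 0"
proof (cases "k = 0")
  case True
  have "(\<lambda>k. a k * 0 ^ k) sums F 0" using sums[of 0] \<open>0 < e\<close> by simp
  then have "a 0 = F 0" by (simp add: powser_sums_zero_iff)
  then show ?thesis using zero[of 0] \<open>0 < e\<close> True by simp
next
  case False
  show ?thesis
  proof (rule ccontr)
    assume ak: "a k \<noteq> 0"
    obtain s where s: "0 < s" "\<And>z. z \<in> cball 0 s - {0} \<Longrightarrow> F z \<noteq> 0"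
      using powser_0_nonzero[of e 0 a F k] sums zero[of 0] \<open>0 < e\<close> ak False by auto
    define r where "r = min s (e / 2)"
    have "r > 0" "r < e" "r \<le> s" using s \<open>0 < e\<close> by (auto simp: r_def)
    then show False using s(2)[of "of_real r"] zero[of r] by auto
  qed
qed

text \<open>Derivatives are limits of difference quotients along a sequence, hence measurable in the parameter.\<close>

lemma higher_deriv_measurable:
  fixes h :: "complex \<Rightarrow> 'x \<Rightarrow> complex"
  assumes hol: "\<And>x. x \<in> space M \<Longrightarrow> (\<lambda>s. h s x) holomorphic_on ball 0 r"
    and meas: "\<And>s. norm s < r \<Longrightarrow> h s \<in> borel_measurable M" and "norm s < r"
  shows "(\<lambda>x. (deriv ^^ k) (\<lambda>s. h s x) s) \<in> borel_measurable M"
  using \<open>norm s < r\<close>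
proof (induction k arbitrary: s)
  case 0
  then show ?case using meas by simp
next
  case (Suc k)
  define y where "y = (\<lambda>n. of_real ((r - norm s) / (real n + 2)) :: complex)"
  have pos: "r - norm s > 0" using Suc.prems by simp
  have y0: "y n \<noteq> 0" and yn: "norm (s + y n) < r" for n
  proof -
    have yn: "norm (y n) = (r - norm s) / (real n + 2)" unfolding y_def norm_of_real using pos by simp
    then show "y n \<noteq> 0" using pos by (metis divide_pos_pos norm_zero of_nat_0_le_iff add_nonneg_pos zero_less_numeral less_irrefl)
    note yn
    also have "(r - norm s) / (real n + 2) < r - norm s" using mult_strict_left_mono[OF pos, of "1 + real n"]
      by (subst pos_divide_less_eq) (auto simp: algebra_simps)
    finally show "norm (s + y n) < r" using norm_triangle_ineq[of s "y n"] by simp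
  qed
  have ylim: "y \<longlonglongrightarrow> 0"
  proof -
    have "(\<lambda>n. (r - norm s) / (real n + 2)) \<longlonglongrightarrow> 0" by real_asymp
    from tendsto_of_real[OF this, where 'a=complex] show ?thesis by (simp add: y_def)
  qed
  show ?case
  proof (rule borel_measurable_LIMSEQ_metric)
    show "(\<lambda>x. ((deriv ^^ k) (\<lambda>s. h s x) (s + y n) - (deriv ^^ k) (\<lambda>s. h s x) s) / y n) \<in> borel_measurable M" for n
      using Suc.IH[OF yn[of n]] Suc.IH[OF Suc.prems] by measurable
    fix x assume x: "x \<in> space M"
    have "(deriv ^^ k) (\<lambda>s. h s x) holomorphic_on ball 0 r"
      by (rule holomorphic_higher_deriv[OF hol[OF x]]) auto
    then have "((deriv ^^ k) (\<lambda>s. h s x) has_field_derivative (deriv ^^ Suc k) (\<lambda>s. h s x) s) (at s)"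
      using Suc.prems by (simp add: holomorphic_derivI)
    then have "((\<lambda>y. ((deriv ^^ k) (\<lambda>s. h s x) (s + y) - (deriv ^^ k) (\<lambda>s. h s x) s) / y) \<longlongrightarrow>
       (deriv ^^ Suc k) (\<lambda>s. h s x) s) (at 0)"
      by (simp add: DERIV_def)
    then show "(\<lambda>n. ((deriv ^^ k) (\<lambda>s. h s x) (s + y n) - (deriv ^^ k) (\<lambda>s. h s x) s) / y n)
         \<longlonglongrightarrow> (deriv ^^ Suc k) (\<lambda>s. h s x) s"
      by (rule filterlim_compose) (use ylim y0 in \<open>auto simp: filterlim_at\<close>)
  qed
qed

text \<open>
  If an integral depending holomorphically on \<open>s\<close> vanishes for small real \<open>s\<close>, and still does so after
  multiplication of the integrand by the powers of \<open>\<theta>\<close>, then \<open>s\<close> may be replaced by the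
  function \<open>\<theta>\<close> of the integration variable. For if \<open>c k\<close> are the Taylor coefficients in \<open>s\<close>, each
  \<open>\<theta> ^ m * c k\<close> has integral zero, and the integrand in question is the sum of
  \<open>\<theta> ^ k * c k\<close>. With constant \<open>\<theta>\<close> this is the identity theorem.
\<close>

lemma analytic_substitution:
  fixes h :: "complex \<Rightarrow> 'x \<Rightarrow> complex" and \<theta> :: "'x \<Rightarrow> complex"
  assumes hol: "\<And>x. x \<in> space M \<Longrightarrow> (\<lambda>s. h s x) holomorphic_on ball 0 r"
    and meas: "\<And>s. norm s < r \<Longrightarrow> h s \<in> borel_measurable M"
    and bound: "\<And>s x. norm s < r \<Longrightarrow> x \<in> space M \<Longrightarrow> norm (h s x) \<le> b x"
    and b: "integrable M b"
    and \<theta>m[measurable]: "\<theta> \<in> borel_measurable M"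
    and \<theta>q: "\<And>x. x \<in> space M \<Longrightarrow> norm (\<theta> x) \<le> q" and q: "0 < q" "q < r"
    and e: "0 < e"
    and zero: "\<And>k s. \<bar>s\<bar> < e \<Longrightarrow> (LINT x|M. \<theta> x ^ k * h (of_real s) x) = 0"
  shows "(LINT x|M. h (\<theta> x) x) = 0"
proof -
  define r' where "r' = (q + r) / 2"
  have r': "q < r'" "r' < r" "0 < r'" using q by (auto simp: r'_def)
  define c where "c = (\<lambda>k x. (deriv ^^ k) (\<lambda>s. h s x) 0 / fact k)"
  have cm[measurable]: "c k \<in> borel_measurable M" for k
    using higher_deriv_measurable[where h=h and M=M and r=r and s=0 and k=k] hol meas q unfolding c_def by simp
  have cb: "norm (c k x) \<le> b x / r' ^ k" if x: "x \<in> space M" for k x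
  proof -
    have "norm ((deriv ^^ k) (\<lambda>s. h s x) 0) \<le> fact k * b x / r' ^ k"
    proof (rule Cauchy_inequality)
      show "(\<lambda>s. h s x) holomorphic_on ball 0 r'"
        using hol[OF x] r' by (auto intro: holomorphic_on_subset)
      have "(\<lambda>s. h s x) holomorphic_on cball 0 r'"
        using hol[OF x] r' by (auto intro: holomorphic_on_subset)
      then show "continuous_on (cball 0 r') (\<lambda>s. h s x)" by (rule holomorphic_on_imp_continuous_on)
    qed (use r' bound x in \<open>auto simp: norm_minus_commute\<close>)
    then show ?thesis by (simp add: c_def norm_divide field_simps)
  qed
  have sums: "(\<lambda>k. c k x * s ^ k) sums h s x" if "norm s < r" "x \<in> space M" for s x
    using holomorphic_power_series[OF hol[OF that(2)], of s] that by (simp add: c_def)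
  have bnn: "0 \<le> b x" if "x \<in> space M" for x
    using bound[of 0 x] that q by (smt (verit) norm_ge_zero norm_zero)
  have int: "integrable M (\<lambda>x. \<theta> x ^ m * (c k x * s ^ j))" for m k s j
  proof (rule Bochner_Integration.integrable_bound)
    show "integrable M (\<lambda>x. q ^ m * (b x / r' ^ k * norm s ^ j))" using b by simp
    show "AE x in M. norm (\<theta> x ^ m * (c k x * s ^ j)) \<le> norm (q ^ m * (b x / r' ^ k * norm s ^ j))"
    proof (rule AE_I2)
      fix x assume x: "x \<in> space M"
      have "norm (\<theta> x ^ m * (c k x * s ^ j)) = norm (\<theta> x) ^ m * (norm (c k x) * norm s ^ j)"
        by (simp add: norm_mult norm_power)
      also have "\<dots> \<le> q ^ m * (b x / r' ^ k * norm s ^ j)"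
        using cb[OF x] \<theta>q[OF x] bnn[OF x] r' q by (intro mult_mono power_mono) auto
      finally show "norm (\<theta> x ^ m * (c k x * s ^ j)) \<le> norm (q ^ m * (b x / r' ^ k * norm s ^ j))"
        by (rule order_trans) (simp only: real_norm_def abs_ge_self)
    qed
  qed measurable
  \<comment> \<open>The power series may be integrated termwise; this is used both for a constant \<open>s\<close> next to a fixed power of
    \<open>\<theta>\<close> and for \<open>\<theta>\<close> itself in place of \<open>s\<close>.\<close>
  have swap: "(\<lambda>k. LINT x|M. \<theta> x ^ m k * (c k x * s ^ j k)) sums (LINT x|M. (\<Sum>k. \<theta> x ^ m k * (c k x * s ^ j k)))"
    if ms: "\<And>k. q ^ m k * norm s ^ j k \<le> B * q ^ k" for m s j B
  proof (rule sums_integral)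
    have est: "norm (\<theta> x ^ m k * (c k x * s ^ j k)) \<le> b x * (B * (q / r') ^ k)" if x: "x \<in> space M" for x k
    proof -
      have "norm (\<theta> x ^ m k * (c k x * s ^ j k)) = norm (\<theta> x) ^ m k * (norm (c k x) * norm s ^ j k)"
        by (simp add: norm_mult norm_power)
      also have "\<dots> \<le> q ^ m k * (b x / r' ^ k * norm s ^ j k)"
        using cb[OF x] \<theta>q[OF x] bnn[OF x] r' q by (intro mult_mono power_mono) auto
      also have "\<dots> = (b x / r' ^ k) * (q ^ m k * norm s ^ j k)" by simp
      also have "\<dots> \<le> (b x / r' ^ k) * (B * q ^ k)"
        using bnn[OF x] r' by (intro mult_left_mono ms) auto
      finally show ?thesis by (simp add: power_divide)
    qed
    have geo: "summable (\<lambda>k. C * (B * (q / r') ^ k))" for C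
      using r' q by (intro summable_mult summable_geometric) auto
    show "AE x in M. summable (\<lambda>k. norm (\<theta> x ^ m k * (c k x * s ^ j k)))"
      by (rule AE_I2, rule summable_comparison_test'[OF geo]) (use est in auto)
    show "summable (\<lambda>k. LINT x|M. norm (\<theta> x ^ m k * (c k x * s ^ j k)))"
    proof (rule summable_comparison_test'[OF geo[of "LINT x|M. b x"]])
      fix k
      have "(LINT x|M. norm (\<theta> x ^ m k * (c k x * s ^ j k))) \<le> (LINT x|M. b x * (B * (q / r') ^ k))"
        by (rule integral_mono) (use est int b in auto)
      then show "norm (LINT x|M. norm (\<theta> x ^ m k * (c k x * s ^ j k))) \<le> (LINT x|M. b x) * (B * (q / r') ^ k)"
        by simp
    qed
  qed (rule int)
  have coeff: "(LINT x|M. \<theta> x ^ m * c k x) = 0" for m k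
  proof (rule powser_eq_0_on_reals)
    show "0 < min e q" using e q by simp
    show "(\<lambda>k. (LINT x|M. \<theta> x ^ m * c k x) * s ^ k) sums (LINT x|M. \<theta> x ^ m * h s x)" if s: "norm s < min e q" for s
    proof -
      have "(\<lambda>k. LINT x|M. \<theta> x ^ m * (c k x * s ^ k)) sums (LINT x|M. (\<Sum>k. \<theta> x ^ m * (c k x * s ^ k)))"
        using s q by (intro swap[where B="q ^ m"] mult_left_mono power_mono) auto
      also have "(LINT x|M. (\<Sum>k. \<theta> x ^ m * (c k x * s ^ k))) = (LINT x|M. \<theta> x ^ m * h s x)"
        using s q by (intro Bochner_Integration.integral_cong refl sums_unique[symmetric] sums_mult sums) auto
      finally show ?thesis by (simp add: mult.assoc[symmetric])
    qed
    show "(LINT x|M. \<theta> x ^ m * h (of_real s) x) = 0" if "\<bar>s\<bar> < min e q" for s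
      using zero[of s m] that by simp
  qed
  have "(\<lambda>k. LINT x|M. \<theta> x ^ k * (c k x * 1 ^ k)) sums (LINT x|M. (\<Sum>k. \<theta> x ^ k * (c k x * 1 ^ k)))"
    by (intro swap[where B=1]) auto
  also have "(LINT x|M. (\<Sum>k. \<theta> x ^ k * (c k x * 1 ^ k))) = (LINT x|M. h (\<theta> x) x)"
  proof (intro Bochner_Integration.integral_cong refl sums_unique[symmetric])
    fix x assume x: "x \<in> space M"
    show "(\<lambda>k. \<theta> x ^ k * (c k x * 1 ^ k)) sums h (\<theta> x) x"
      using sums[of "\<theta> x" x] \<theta>q[OF x] q x by (simp add: mult.commute)
  qed
  finally have "(\<lambda>k. 0) sums (LINT x|M. h (\<theta> x) x)" by (simp add: coeff)
  then show ?thesis using sums_unique2 sums_zero by blast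
qed

section \<open>The Carleman kernel on a circle of complex frequencies\<close>

definition circ :: "real \<Rightarrow> real \<Rightarrow> complex" where
  "circ L x = of_real L * exp (2 * of_real pi * \<i> * of_real x)"

text \<open>
  The factor that selects the half-line on which \<open>exp (\<i> u \<tau>)\<close> decays: the indicator of \<open>u > 0\<close> if
  \<open>\<tau>\<close> is in the upper half-plane, minus the indicator of \<open>u \<le> 0\<close> if it is in the lower one.
  In this form the difference \<open>jump \<tau> u - jump \<tau> v\<close> visibly does not depend on
  \<open>\<tau>\<close>, which is what makes the two half-line transforms fit together.
\<close>

definition jump :: "complex \<Rightarrow> real \<Rightarrow> real" where
  "jump \<tau> u = (if u > 0 then 1 else 0) - (if Im \<tau> < 0 then 1 else 0)"

text \<open>
  The density of \<open>(1 - (\<tau>/L)\<^sup>2)\<^sup>N d\<tau>\<close> on the circle, parametrised by the unit interval.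
\<close>

definition circ_weight :: "nat \<Rightarrow> real \<Rightarrow> real \<Rightarrow> complex" where
  "circ_weight N L x = indicator {0..1} x *\<^sub>R
     (2 * of_real pi * \<i> * circ L x * (1 - (circ L x / of_real L)\<^sup>2) ^ N)"

definition carleman :: "nat \<Rightarrow> real \<Rightarrow> real \<Rightarrow> real \<Rightarrow> complex" where
  "carleman N L x u = circ_weight N L x * of_real (jump (circ L x) u) * exp (\<i> * of_real u * circ L x)"

lemma norm_circ: "L \<ge> 0 \<Longrightarrow> norm (circ L x) = L"
  by (simp add: circ_def norm_mult)

lemma continuous_circ: "continuous_on S (circ L)"
  unfolding circ_def by (intro continuous_intros)

lemma circ_measurable [measurable]: "circ L \<in> borel_measurable borel"
  by (intro borel_measurable_continuous_onI continuous_circ)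

lemma jump_measurable [measurable (raw)]:
  assumes [measurable]: "f \<in> borel_measurable M" "g \<in> borel_measurable M"
  shows "(\<lambda>x. jump (f x) (g x)) \<in> borel_measurable M"
  unfolding jump_def by measurable

lemma circ_weight_measurable [measurable]: "circ_weight N L \<in> borel_measurable borel"
  unfolding circ_weight_def by measurable

lemma carleman_measurable [measurable (raw)]:
  assumes [measurable]: "f \<in> borel_measurable M" "g \<in> borel_measurable M"
  shows "(\<lambda>x. carleman N L (f x) (g x)) \<in> borel_measurable M"
  unfolding carleman_def by measurable

lemma circle_integral_eq_contour_integral:
  assumes "continuous_on (sphere 0 L) g" "L > 0"
  shows "(LINT x|lborel. indicator {0..1} x *\<^sub>R (2 * of_real pi * \<i> * circ L x * g (circ L x)))
     = contour_integral (circlepath 0 L) g"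
proof -
  have cont: "continuous_on {0..1} (\<lambda>x. 2 * of_real pi * \<i> * circ L x * g (circ L x))"
    by (intro continuous_intros continuous_circ continuous_on_compose2[OF assms(1)])
       (use \<open>L > 0\<close> in \<open>auto simp: norm_circ\<close>)
  have "(LINT x|lborel. indicator {0..1} x *\<^sub>R (2 * of_real pi * \<i> * circ L x * g (circ L x)))
      = integral {0..1} (\<lambda>x. 2 * of_real pi * \<i> * circ L x * g (circ L x))"
    using set_borel_integral_eq_integral(2)[OF borel_integrable_atLeastAtMost'[OF cont]]
    by (simp add: set_lebesgue_integral_def)
  also have "\<dots> = contour_integral (circlepath 0 L) g"
    unfolding contour_integral_integral
    by (intro integral_cong, subst vector_derivative_circlepath)
       (simp add: circlepath circ_def mult_ac)
  finally show ?thesis .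
qed

lemma circle_integral_holomorphic:
  assumes "g holomorphic_on ball 0 (2 * L)" "L > 0"
  shows "(LINT x|lborel. indicator {0..1} x *\<^sub>R (2 * of_real pi * \<i> * circ L x * g (circ L x))) = 0"
proof -
  have "sphere 0 L \<subseteq> ball 0 (2 * L)" using \<open>L > 0\<close> by auto
  then have "continuous_on (sphere 0 L) g"
    using assms(1) holomorphic_on_imp_continuous_on continuous_on_subset by blast
  moreover have "contour_integral (circlepath 0 L) g = 0"
    by (rule contour_integral_unique, rule Cauchy_theorem_disc_simple[OF assms(1)])
       (use \<open>L > 0\<close> in auto)
  ultimately show ?thesis using circle_integral_eq_contour_integral assms by simp
qed

text \<open>One term of the exponential series is at most the whole series.\<close>

lemma power_le_fact_exp:
  assumes "0 \<le> (y::real)"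
  shows "y ^ N \<le> fact N * exp y"
proof -
  have "(\<Sum>k\<in>{N}. y ^ k /\<^sub>R fact k) \<le> (\<Sum>k. y ^ k /\<^sub>R fact k)"
    using assms sums_summable[OF exp_converges[of y]] by (intro sum_le_suminf) auto
  then have "y ^ N / fact N \<le> exp y"
    using sums_unique[OF exp_converges[of y]] by (simp add: divide_inverse mult.commute)
  then show ?thesis by (simp add: field_simps)
qed

lemma norm_one_minus_square_unit:
  assumes "norm c = 1"
  shows "norm (1 - c\<^sup>2) = 2 * \<bar>Im c\<bar>"
proof -
  have "1 - c\<^sup>2 = c * (cnj c - c)"
    using complex_norm_square[of c] assms by (simp add: algebra_simps power2_eq_square)
  then have "norm (1 - c\<^sup>2) = norm (cnj c - c)" using assms by (simp add: norm_mult)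
  also have "cnj c - c = - of_real (2 * Im c) * \<i>" by (simp add: complex_eq_iff)
  finally show ?thesis by (simp only: norm_mult norm_minus_cancel norm_of_real) simp
qed

text \<open>
  With \<open>y\<close> the absolute value of the sine of the angle, the weight contributes \<open>(2 y)\<^sup>N\<close> and the exponential
  at most \<open>exp (- \<bar>u\<bar> y)\<close>; the supremum of the product over all \<open>y\<close> decays like the power
  \<open>N\<close> of \<open>1 / \<bar>u\<bar>\<close>, uniformly on the circle.
\<close>

lemma carleman_bound:
  assumes L: "L \<ge> 1"
  shows "norm (carleman N L x u) \<le> indicator {0..1} x * ((2 * pi * L * 2 ^ N * fact N * exp 1) / (1 + \<bar>u\<bar>) ^ N)"
proof (cases "x \<in> {0..1} \<and> jump (circ L x) u \<noteq> 0")
  case False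
  then have "carleman N L x u = 0" by (auto simp: carleman_def circ_weight_def)
  then show ?thesis using L by simp
next
  case True
  define c where "c = circ L x / of_real L"
  define y where "y = \<bar>Im c\<bar>"
  have c: "norm c = 1" using L by (simp add: c_def norm_divide norm_circ)
  have y: "0 \<le> y" "y \<le> 1" using abs_Im_le_cmod[of c] c by (auto simp: y_def)
  have Imc: "Im (circ L x) = L * Im c" using L by (simp add: c_def)
  have "norm (exp (\<i> * of_real u * circ L x)) = exp (- (u * Im (circ L x)))"
    by (simp add: norm_exp_eq_Re)
  also have "\<dots> \<le> exp (- (\<bar>u\<bar> * y))"
  proof -
    have "\<bar>u\<bar> * \<bar>Im (circ L x)\<bar> \<le> u * Im (circ L x)"
      using True L unfolding jump_def
      by (cases "u > 0"; cases "Im (circ L x) < 0") (auto simp: mult_nonpos_nonpos)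
    moreover have "\<bar>u\<bar> * y \<le> \<bar>u\<bar> * \<bar>Im (circ L x)\<bar>"
      unfolding Imc y_def using L mult_right_mono[of 1 L "\<bar>Im c\<bar>"] by (intro mult_left_mono) (auto simp: abs_mult)
    ultimately show ?thesis by simp
  qed
  finally have ex: "norm (exp (\<i> * of_real u * circ L x)) \<le> exp (- (\<bar>u\<bar> * y))" .
  have j: "\<bar>jump (circ L x) u\<bar> \<le> 1" by (auto simp: jump_def)
  have "norm (carleman N L x u) = 2 * pi * L * (2 * y) ^ N * \<bar>jump (circ L x) u\<bar> * norm (exp (\<i> * of_real u * circ L x))"
    using True L norm_one_minus_square_unit[OF c]
    by (simp add: carleman_def circ_weight_def norm_mult norm_power norm_circ c_def[symmetric] y_def)
  also have "\<dots> \<le> 2 * pi * L * (2 * y) ^ N * 1 * exp (- (\<bar>u\<bar> * y))"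
    using ex j L y by (intro mult_mono) auto
  finally have 1: "norm (carleman N L x u) \<le> 2 * pi * L * 2 ^ N * (y ^ N * exp (- (\<bar>u\<bar> * y)))"
    by (simp add: power_mult_distrib mult_ac)
  have "(y + y * \<bar>u\<bar>) ^ N \<le> fact N * exp (y + y * \<bar>u\<bar>)"
    using y by (intro power_le_fact_exp) auto
  also have "\<dots> = fact N * exp y * exp (y * \<bar>u\<bar>)" by (simp add: exp_add)
  also have "\<dots> \<le> fact N * exp 1 * exp (y * \<bar>u\<bar>)" using y by (intro mult_mono) auto
  finally have "(y * (1 + \<bar>u\<bar>)) ^ N * exp (- (\<bar>u\<bar> * y)) \<le> fact N * exp 1 * exp (y * \<bar>u\<bar>) * exp (- (\<bar>u\<bar> * y))"
    by (intro mult_right_mono) (auto simp: algebra_simps)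
  also have "\<dots> = fact N * exp 1" by (simp add: exp_minus mult.commute field_simps)
  finally have "y ^ N * exp (- (\<bar>u\<bar> * y)) \<le> fact N * exp 1 / (1 + \<bar>u\<bar>) ^ N"
    by (subst pos_le_divide_eq) (simp_all add: power_mult_distrib mult_ac)
  then have "2 * pi * L * 2 ^ N * (y ^ N * exp (- (\<bar>u\<bar> * y))) \<le> 2 * pi * L * 2 ^ N * (fact N * exp 1 / (1 + \<bar>u\<bar>) ^ N)"
    using L by (intro mult_left_mono) auto
  with 1 show ?thesis using True by (simp add: mult_ac)
qed

lemma integrable_prod_mult:
  fixes f :: "'a::euclidean_space \<Rightarrow> real" and g :: "'b::euclidean_space \<Rightarrow> real"
  assumes f: "integrable lborel f" and g: "integrable lborel g"
  shows "integrable lborel (\<lambda>(x, y). f x * g y)"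
proof -
  have [measurable]: "f \<in> borel_measurable borel" "g \<in> borel_measurable borel"
    using f g by auto
  have "integrable (lborel \<Otimes>\<^sub>M lborel) (\<lambda>(x, y). f x * g y)"
    by (rule lborel_pair.Fubini_integrable) (use f g in \<open>auto simp: abs_mult\<close>)
  then show ?thesis by (simp add: lborel_prod)
qed

lemma integrable_inverse_1_plus_square': "integrable lborel (\<lambda>u::real. inverse (1 + u\<^sup>2))"
  using integrable_inverse_1_plus_square by (simp add: set_integrable_def einterval_def)

text \<open>A common integrable majorant for the products of the kernel with functions that are compactly supported in
  space and grow polynomially in time.\<close>

definition dominator :: "real \<Rightarrow> real \<times> real \<times> 'b::euclidean_space \<Rightarrow> real" where
  "dominator R = (\<lambda>(x, u, z). indicator {0..1} x * (inverse (1 + u\<^sup>2) * indicator (cball 0 R) z))"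

lemma integrable_dominator: "integrable lborel (dominator R :: real \<times> real \<times> 'b::euclidean_space \<Rightarrow> real)"
proof -
  have "integrable lborel (indicator (cball 0 R) :: 'b \<Rightarrow> real)"
    using emeasure_lborel_cball_finite by (intro integrable_real_indicator) auto
  from integrable_prod_mult[OF integrable_inverse_1_plus_square' this]
  have "integrable lborel (\<lambda>(u::real, z::'b). inverse (1 + u\<^sup>2) * indicator (cball 0 R) z :: real)" .
  from integrable_prod_mult[OF _ this, of "indicator {0..1::real}"]
  show ?thesis by (simp add: dominator_def case_prod_unfold)
qed

lemma dominator_nonneg: "0 \<le> dominator R p"
  by (simp add: dominator_def case_prod_unfold)

definition poly_bounded :: "real \<Rightarrow> nat \<Rightarrow> real \<Rightarrow> (real \<times> 'b::euclidean_space \<Rightarrow> complex) \<Rightarrow> bool" where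
  "poly_bounded R m K a \<longleftrightarrow> continuous_on UNIV a \<and> (\<forall>u z. norm (a (u, z)) \<le> K * (1 + \<bar>u\<bar>) ^ m)
     \<and> (\<forall>u z. norm z > R \<longrightarrow> a (u, z) = 0)"

lemma poly_boundedD:
  assumes "poly_bounded R m K a"
  shows "continuous_on UNIV a" "norm (a (u, z)) \<le> K * (1 + \<bar>u\<bar>) ^ m" "norm z > R \<Longrightarrow> a (u, z) = 0"
    "a \<in> borel_measurable borel" "0 \<le> K"
proof -
  show "continuous_on UNIV a" "norm (a (u, z)) \<le> K * (1 + \<bar>u\<bar>) ^ m" "norm z > R \<Longrightarrow> a (u, z) = 0"
    using assms by (auto simp: poly_bounded_def)
  show "a \<in> borel_measurable borel"
    using assms by (auto simp: poly_bounded_def intro: borel_measurable_continuous_onI)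
  have "0 \<le> norm (a (0,z))" by simp
  also have "\<dots> \<le> K * (1 + \<bar>0\<bar>) ^ m" using assms unfolding poly_bounded_def by blast
  finally show "0 \<le> K" by simp
qed

text \<open>The exponent \<open>m + 2\<close> leaves an inverse square in time after the growth of order \<open>m\<close> is absorbed.\<close>

lemma carleman_dominated:
  assumes a: "poly_bounded R m K a" and L: "L \<ge> 1"
    and g: "norm z \<le> R \<Longrightarrow> x \<in> {0..1} \<Longrightarrow> norm g \<le> B" and B: "B \<ge> 0"
  shows "norm (carleman (m + 2) L x u * a (u, z) * g)
    \<le> (2 * pi * L * 2 ^ (m+2) * fact (m+2) * exp 1 * K * B) * dominator R (x, u, z)"
proof (cases "norm z \<le> R \<and> x \<in> {0..1}")
  case False
  then have 0: "carleman (m + 2) L x u * a (u, z) = 0"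
    using poly_boundedD(3)[OF a] by (auto simp: carleman_def circ_weight_def)
  have "0 \<le> 2 * pi * L * 2 ^ (m+2) * fact (m+2) * exp 1 * K * B"
    using L B poly_boundedD(5)[OF a] by (intro mult_nonneg_nonneg) auto
  from mult_nonneg_nonneg[OF this dominator_nonneg[of R "(x,u,z)"]] show ?thesis
    unfolding 0 by simp
next
  case True
  define Q where "Q = 2 * pi * L * 2 ^ (m+2) * fact (m+2) * exp (1::real)"
  have "norm (carleman (m + 2) L x u * a (u, z) * g) \<le> (Q / (1 + \<bar>u\<bar>) ^ (m+2)) * (K * (1 + \<bar>u\<bar>) ^ m) * B"
    unfolding norm_mult using carleman_bound[OF L, of "m+2" x u] poly_boundedD(2,5)[OF a] g L B True
    by (intro mult_mono) (auto simp: Q_def)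
  also have "\<dots> = Q * K * B * (1 / (1 + \<bar>u\<bar>)\<^sup>2)"
  proof -
    have "(Q / w ^ (m+2)) * (K * w ^ m) * B = Q * K * B * (1 / w\<^sup>2)" if "w > 0" for w
      using that by (simp add: power_add power2_eq_square field_simps)
    from this[of "1 + \<bar>u\<bar>"] show ?thesis by simp
  qed
  also have "\<dots> \<le> Q * K * B * inverse (1 + u\<^sup>2)"
  proof (intro mult_left_mono)
    have "1 + u\<^sup>2 \<le> (1 + \<bar>u\<bar>)\<^sup>2" by (simp add: power2_sum)
    then show "1 / (1 + \<bar>u\<bar>)\<^sup>2 \<le> inverse (1 + u\<^sup>2)"
      by (simp add: inverse_eq_divide frac_le add_pos_nonneg)
    show "0 \<le> Q * K * B" using L B poly_boundedD(5)[OF a] by (simp add: Q_def)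
  qed
  finally show ?thesis using True by (simp add: Q_def dominator_def)
qed

lemma borel_measurable_triple:
  fixes f :: "'a::euclidean_space \<times> 'b::euclidean_space \<times> 'c::euclidean_space \<Rightarrow> 'd::topological_space"
  shows "f \<in> borel_measurable (borel \<Otimes>\<^sub>M (borel \<Otimes>\<^sub>M borel)) \<Longrightarrow> f \<in> borel_measurable lborel"
  by (simp add: borel_prod)

lemma compact_norm_bound:
  fixes f :: "'a::metric_space \<Rightarrow> 'b::real_normed_vector"
  assumes "continuous_on S f" "compact S"
  obtains B where "B \<ge> 0" "\<And>x. x \<in> S \<Longrightarrow> norm (f x) \<le> B"
proof -
  have "bounded (f ` S)" using assms compact_continuous_image compact_imp_bounded by blast
  then obtain B where "B > 0" "\<forall>y\<in>f ` S. norm y \<le> B" using bounded_pos by metis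
  then show ?thesis using that[of B] by auto
qed

section \<open>Orthogonality relations from ray integrals\<close>

text \<open>
  Let \<open>\<eta> \<bullet> \<omega> = 0\<close>. The phase in the integrand is a function of \<open>u - \<omega> \<bullet> z\<close> and of
  \<open>\<eta> \<bullet> z\<close>, hence constant along the rays of direction \<open>\<omega>\<close>. If also the jump were taken at
  \<open>u - \<omega> \<bullet> z\<close> instead of \<open>u\<close>, the whole factor next to \<open>a\<close> would be constant along rays, and the
  integral over \<open>(u, z)\<close> would vanish for every fixed point of the circle. The
  correction has an integrand of compact support that is holomorphic in \<open>\<tau>\<close> on a disc containing the circle, so
  it vanishes by Cauchy's theorem when the circle is integrated first.
\<close>

lemma ray_orthogonality:
  fixes a :: "real \<times> 'b::euclidean_space \<Rightarrow> complex"
  assumes a: "poly_bounded R m K a" and L: "L \<ge> 1"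
    and ray: "\<And>t x. (LINT s|lborel. a (t + s, x + s *\<^sub>R \<omega>)) = 0"
    and \<omega>: "\<omega> \<bullet> \<omega> = 1" and \<eta>: "\<eta> \<bullet> \<omega> = 0" and f: "f holomorphic_on ball 0 (2 * L)"
  shows "integrable lborel (\<lambda>(x, u, z). carleman (m + 2) L x u * a (u, z) *
            (f (circ L x) * exp (- \<i> * (circ L x * of_real (\<omega> \<bullet> z) + of_real (\<eta> \<bullet> z)))))" (is "integrable lborel ?I")
    and "(LINT (x, u, z)|lborel. carleman (m + 2) L x u * a (u, z) *
            (f (circ L x) * exp (- \<i> * (circ L x * of_real (\<omega> \<bullet> z) + of_real (\<eta> \<bullet> z))))) = 0"
proof -
  define N where "N = m + 2"
  have am[measurable]: "a \<in> borel_measurable (borel \<Otimes>\<^sub>M borel)"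
    using poly_boundedD(4)[OF a] by (simp add: borel_prod)
  have sub: "circ L x \<in> ball 0 (2 * L)" for x using L by (simp add: norm_circ)
  have fc: "continuous_on UNIV (\<lambda>x. f (circ L x))"
    by (rule continuous_on_compose2[OF holomorphic_on_imp_continuous_on[OF f] continuous_circ]) (use sub in blast)
  then have [measurable]: "(\<lambda>x. f (circ L x)) \<in> borel_measurable borel"
    by (rule borel_measurable_continuous_onI)
  define E where "E = (\<lambda>x z. f (circ L x) * exp (- \<i> * (circ L x * of_real (\<omega> \<bullet> z) + of_real (\<eta> \<bullet> z))))"
  have Ec: "continuous_on UNIV (\<lambda>(x, z). E x z)"
    unfolding E_def case_prod_unfold
    by (intro continuous_intros continuous_on_compose2[OF fc] continuous_on_compose2[OF continuous_circ[of UNIV]]) auto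
  obtain B where B: "B \<ge> 0" "\<And>p. p \<in> {0..1} \<times> cball 0 R \<Longrightarrow> norm (case p of (x, z) \<Rightarrow> E x z) \<le> B"
    by (rule compact_norm_bound[OF continuous_on_subset[OF Ec], of "{0..1} \<times> cball 0 R"]) (auto intro: compact_Times)
  have EB: "norm (E x z) \<le> B" if "norm z \<le> R" "x \<in> {0..1}" for x z
    using B(2)[of "(x, z)"] that by simp
  define I where "I = (\<lambda>(x, u, z). carleman N L x u * a (u, z) * E x z)"
  have Im: "I \<in> borel_measurable lborel"
    unfolding I_def E_def by (intro borel_measurable_triple) measurable
  have I_int: "integrable lborel I"
  proof (rule Bochner_Integration.integrable_bound[OF integrable_mult_right[OF integrable_dominator] Im])
    show "AE p in lborel. norm (I p) \<le> norm ((2 * pi * L * 2 ^ (m+2) * fact (m+2) * exp 1 * K * B) * dominator R p)"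
    proof (rule AE_I2)
      fix p :: "real \<times> real \<times> 'b"
      obtain x u z where p: "p = (x, u, z)" by (cases p)
      have "norm (I p) \<le> (2 * pi * L * 2 ^ (m+2) * fact (m+2) * exp 1 * K * B) * dominator R p"
        unfolding p I_def N_def split using B(1) EB by (intro carleman_dominated[OF a L]) auto
      then show "norm (I p) \<le> norm ((2 * pi * L * 2 ^ (m+2) * fact (m+2) * exp 1 * K * B) * dominator R p)"
        by (rule order_trans) (simp only: real_norm_def abs_ge_self)
    qed
  qed
  have I_eq: "I = ?I" by (auto simp: I_def E_def N_def)
  show "integrable lborel ?I" using I_int I_eq by simp
  \<comment> \<open>The integrand is split into \<open>T1\<close>, with the jump at \<open>u - \<omega> \<bullet> z\<close>, and the correction \<open>T2\<close>.\<close>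
  define V where "V = (\<lambda>x u z. exp (\<i> * of_real u * circ L x) * a (u, z) * E x z)"
  define G where "G = (\<lambda>x v. of_real (jump (circ L x) v) * (circ_weight N L x * f (circ L x) * exp (\<i> * of_real v * circ L x)))"
  define H where "H = (\<lambda>u::real. if u > 0 then 1 else (0::real))"
  define T1 where "T1 = (\<lambda>(x, u, z). of_real (jump (circ L x) (u - \<omega> \<bullet> z)) * (circ_weight N L x * V x u z))"
  define T2 where "T2 = (\<lambda>(x, u, z). of_real (H u - H (u - \<omega> \<bullet> z)) * (circ_weight N L x * V x u z))"
  have decomp: "I p = T1 p + T2 p" for p
    by (cases p) (auto simp: I_def T1_def T2_def V_def carleman_def jump_def H_def algebra_simps)
  have T2m: "T2 \<in> borel_measurable lborel"
    unfolding T2_def V_def E_def H_def by (intro borel_measurable_triple) measurable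
  define r where "r = R * norm \<omega>"
  define S where "S = {0..1::real} \<times> ({-r..r} \<times> cball (0::'b) R)"
  have S: "compact S" unfolding S_def by (intro compact_Times) auto
  define W where "W = (\<lambda>x. 2 * of_real pi * \<i> * circ L x * (1 - (circ L x / of_real L)\<^sup>2) ^ N)"
  have c1: "continuous_on UNIV (\<lambda>p::real \<times> real \<times> 'b. circ L (fst p))"
    by (rule continuous_on_compose2[OF continuous_circ[of UNIV]]) (auto intro!: continuous_intros)
  have c2: "continuous_on UNIV (\<lambda>p::real \<times> real \<times> 'b. a (fst (snd p), snd (snd p)))"
    by (rule continuous_on_compose2[OF poly_boundedD(1)[OF a]]) (auto intro!: continuous_intros)
  have "continuous_on UNIV (\<lambda>p::real \<times> real \<times> 'b. (\<lambda>(x, z). E x z) (fst p, snd (snd p)))"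
    by (rule continuous_on_compose2[OF Ec]) (auto intro!: continuous_intros)
  then have c3: "continuous_on UNIV (\<lambda>p::real \<times> real \<times> 'b. E (fst p) (snd (snd p)))" by simp
  have cWV: "continuous_on UNIV (\<lambda>(x, u, z). W x * V x u z)"
    unfolding W_def V_def case_prod_unfold using L by (intro continuous_intros c1 c2 c3) auto
  obtain B2 where B2: "B2 \<ge> 0" "\<And>p. p \<in> S \<Longrightarrow> norm (case p of (x, u, z) \<Rightarrow> W x * V x u z) \<le> B2"
    by (rule compact_norm_bound[OF continuous_on_subset[OF cWV subset_UNIV] S]) blast
  \<comment> \<open>Where \<open>T2\<close> is nonzero, \<open>u\<close> lies between \<open>0\<close> and \<open>\<omega> \<bullet> z\<close>, so \<open>T2\<close> lives on the compact set
    \<open>S\<close>.\<close>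
  have T2_int: "integrable lborel T2"
  proof (rule Bochner_Integration.integrable_bound[OF _ T2m])
    show "integrable lborel (\<lambda>p. B2 * indicator S p)"
      using S emeasure_bounded_finite[OF compact_imp_bounded[OF S]]
      by (intro integrable_mult_right integrable_real_indicator) (auto simp: borel_compact)
    show "AE p in lborel. norm (T2 p) \<le> norm (B2 * indicator S p)"
    proof (rule AE_I2)
      fix p :: "real \<times> real \<times> 'b"
      obtain x u z where p: "p = (x, u, z)" by (cases p)
      show "norm (T2 p) \<le> norm (B2 * indicator S p)"
      proof (cases "p \<in> S")
        case True
        then have "norm (W x * V x u z) \<le> B2" using B2(2)[of p] p by simp
        moreover have "norm (T2 p) \<le> 1 * norm (W x * V x u z)"
          unfolding p T2_def split norm_mult[of "of_real _"] norm_of_real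
          using True p by (intro mult_mono) (auto simp: H_def circ_weight_def W_def S_def)
        ultimately show ?thesis using True B2 by simp
      next
        case False
        have "T2 p = 0"
        proof (rule ccontr)
          assume nz: "T2 p \<noteq> 0"
          then have x: "x \<in> {0..1}" and az: "a (u, z) \<noteq> 0" and h: "H u \<noteq> H (u - \<omega> \<bullet> z)"
            by (auto simp: p T2_def V_def circ_weight_def indicator_def split: if_splits)
          have z: "norm z \<le> R" using az poly_boundedD(3)[OF a, of z u] by force
          have "\<bar>\<omega> \<bullet> z\<bar> \<le> r"
            using Cauchy_Schwarz_ineq2[of \<omega> z] mult_right_mono[OF z norm_ge_zero[of \<omega>]] by (simp add: r_def mult.commute)
          moreover have "\<bar>u\<bar> \<le> \<bar>\<omega> \<bullet> z\<bar>" using h by (auto simp: H_def split: if_splits)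
          ultimately show False using False x z by (auto simp: p S_def)
        qed
        then show ?thesis by simp
      qed
    qed
  qed
  have T1_int: "integrable lborel T1"
  proof -
    have "T1 = (\<lambda>p. I p - T2 p)" using decomp by (auto simp: fun_eq_iff)
    then show ?thesis using I_int T2_int by simp
  qed
  have "(LINT p|lborel. T2 p) = (LINT q|lborel. LINT x|lborel. T2 (x, q))"
    using lborel_pair.integral_snd[of "\<lambda>x q. T2 (x, q)"] T2_int by (simp add: lborel_prod)
  also have "\<dots> = (LINT (q::real \<times> 'b)|lborel. 0)"
  proof (rule Bochner_Integration.integral_cong[OF refl])
    fix q :: "real \<times> 'b"
    obtain u z where q: "q = (u, z)" by (cases q)
    have "(LINT x|lborel. T2 (x, q)) = (LINT x|lborel. (of_real (H u - H (u - \<omega> \<bullet> z)) * (a (u, z) * exp (- \<i> * of_real (\<eta> \<bullet> z)))) *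
        (indicator {0..1} x *\<^sub>R (2 * of_real pi * \<i> * circ L x *
          (\<lambda>\<tau>. (1 - (\<tau> / of_real L)\<^sup>2) ^ N * f \<tau> * exp (\<i> * \<tau> * of_real (u - \<omega> \<bullet> z))) (circ L x))))"
      by (intro Bochner_Integration.integral_cong refl)
         (simp add: q T2_def V_def E_def circ_weight_def scaleR_conv_of_real exp_add[symmetric] exp_diff[symmetric] algebra_simps
           flip: exp_add exp_diff)
    also have "\<dots> = 0"
      by (subst integral_mult_right_zero, subst circle_integral_holomorphic)
         (use L in \<open>auto intro!: holomorphic_intros f\<close>)
    finally show "(LINT x|lborel. T2 (x, q)) = 0" .
  qed
  finally have T2_0: "(LINT p|lborel. T2 p) = 0" by simp
  have "(LINT p|lborel. T1 p) = (LINT x|lborel. LINT q|lborel. T1 (x, q))"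
    using lborel_pair.integral_fst'[of T1] T1_int by (simp add: lborel_prod)
  also have "\<dots> = (LINT (x::real)|lborel. 0)"
  proof (rule Bochner_Integration.integral_cong[OF refl])
    fix x :: real
    show "(LINT q|lborel. T1 (x, q)) = 0"
    proof (cases "integrable lborel (\<lambda>q. T1 (x, q))")
      case True
      then show ?thesis
      proof (rule integral_eq_0_if_line_integrals_eq_0)
        show "(1::real, 0::'b) \<bullet> (1, \<omega>) = 1" by simp
        fix q :: "real \<times> 'b"
        obtain u z where q: "q = (u, z)" by (cases q)
        have *: "T1 (x, q) = G x (u - \<omega> \<bullet> z) * exp (- \<i> * of_real (\<eta> \<bullet> z)) * a (u, z)" if "q = (u, z)" for u z q
          unfolding that T1_def V_def E_def G_def by (simp add: algebra_simps flip: exp_add)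
        have "T1 (x, q + s *\<^sub>R (1, \<omega>)) = G x (u - \<omega> \<bullet> z) * exp (- \<i> * of_real (\<eta> \<bullet> z)) * a (u + s, z + s *\<^sub>R \<omega>)" for s
          using *[of "q + s *\<^sub>R (1, \<omega>)" "u + s" "z + s *\<^sub>R \<omega>"] \<omega> \<eta> by (simp add: q inner_add_right)
        then show "(LINT s|lborel. T1 (x, q + s *\<^sub>R (1, \<omega>))) = 0"
          using ray[of u z] by simp
      qed
    qed (simp add: not_integrable_integral_eq)
  qed
  finally have T1_0: "(LINT p|lborel. T1 p) = 0" by simp
  have "(LINT p|lborel. I p) = 0"
    unfolding decomp using T1_0 T2_0 T1_int T2_int by simp
  then show "(LINT (x, u, z)|lborel. carleman (m + 2) L x u * a (u, z) *
            (f (circ L x) * exp (- \<i> * (circ L x * of_real (\<omega> \<bullet> z) + of_real (\<eta> \<bullet> z))))) = 0"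
    by (simp add: I_eq)
qed

lemma poly_bounded_add:
  assumes "poly_bounded R m K a" "poly_bounded R m K' b"
  shows "poly_bounded R m (K + K') (\<lambda>p. a p + b p)"
  using assms unfolding poly_bounded_def
  by (auto intro!: continuous_intros norm_triangle_le add_mono simp: distrib_right)

lemma poly_bounded_mult:
  assumes "poly_bounded R m K a" "norm c \<le> 1"
  shows "poly_bounded R m K (\<lambda>p. c * a p)"
proof -
  have "norm c * norm (a p) \<le> norm (a p)" for p
    using mult_right_mono[OF assms(2), of "norm (a p)"] by simp
  then have "norm (c * a p) \<le> norm (a p)" for p by (simp add: norm_mult)
  then show ?thesis using assms(1) unfolding poly_bounded_def
    by (auto intro!: continuous_intros simp del: norm_mult) (metis order_trans)
qed

lemma carleman_integrable:
  assumes a: "poly_bounded R m K a" and L: "L \<ge> 1"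
    and gm: "(\<lambda>(x::real, u::real, z). g x z) \<in> borel_measurable (borel \<Otimes>\<^sub>M (borel \<Otimes>\<^sub>M borel))"
    and g: "\<And>x z. norm z \<le> R \<Longrightarrow> x \<in> {0..1} \<Longrightarrow> norm (g x z) \<le> B" and B: "B \<ge> 0"
  shows "integrable lborel (\<lambda>(x, u, z::'b::euclidean_space). carleman (m + 2) L x u * a (u, z) * g x z)"
proof (rule Bochner_Integration.integrable_bound[OF integrable_mult_right[OF integrable_dominator]])
  have [measurable]: "a \<in> borel_measurable (borel \<Otimes>\<^sub>M borel)"
    using poly_boundedD(4)[OF a] by (simp add: borel_prod)
  have [measurable]: "(\<lambda>p::real \<times> real \<times> 'b. g (fst p) (snd (snd p))) \<in> borel_measurable (borel \<Otimes>\<^sub>M (borel \<Otimes>\<^sub>M borel))"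
    using gm by (simp only: case_prod_unfold)
  show "(\<lambda>(x, u, z). carleman (m + 2) L x u * a (u, z) * g x z) \<in> borel_measurable lborel"
    by (intro borel_measurable_triple) (simp add: case_prod_unfold)
  show "AE p in lborel. norm (case p of (x, u, z) \<Rightarrow> carleman (m + 2) L x u * a (u, z) * g x z)
     \<le> norm ((2 * pi * L * 2 ^ (m+2) * fact (m+2) * exp 1 * K * B) * dominator R p)"
  proof (rule AE_I2, clarsimp simp only: split)
    fix x u z
    have "norm (carleman (m + 2) L x u * a (u, z) * g x z)
       \<le> (2 * pi * L * 2 ^ (m+2) * fact (m+2) * exp 1 * K * B) * dominator R (x, u, z)"
      using B g by (intro carleman_dominated[OF a L]) auto
    then show "norm (carleman (m + 2) L x u * a (u, z) * g x z)
       \<le> norm ((2 * pi * L * 2 ^ (m+2) * fact (m+2) * exp 1 * K * B) * dominator R (x, u, z))"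
      by (rule order_trans) (simp only: real_norm_def abs_ge_self)
  qed
qed

text \<open>
  For the direction \<open>\<omega> = sin \<theta> e1 + cos \<theta> e2\<close> take the orthogonal covector
  \<open>\<eta> = \<rho> cos \<theta> (cos \<theta> e1 - sin \<theta> e2)\<close>. The total spatial frequency
  \<open>\<tau> \<omega> + \<eta>\<close> becomes \<open>\<rho> e1\<close> precisely if \<open>\<tau> = \<rho> sin \<theta>\<close>, and replacing
  \<open>\<theta>\<close> by \<open>pi - \<theta>\<close> only reverses the sign of \<open>cos \<theta>\<close>. So one substitutes
  \<open>\<theta> = Arcsin (\<tau> / \<rho>)\<close> in the difference of the two orthogonality relations, where only
  \<open>2 cos \<theta>\<close> times \<open>a2\<close> survives. The bound \<open>\<rho> \<ge> 4 L\<close> keeps \<open>\<tau> / \<rho>\<close> of modulus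
  less than \<open>1 / 2\<close> on the disc of radius \<open>2 L\<close>, where \<open>Arcsin\<close> is holomorphic and its cosine has no zero.
\<close>

lemma band_orthogonality_large:
  fixes a0 a1 a2 :: "real \<times> 'b::euclidean_space \<Rightarrow> complex" and e1 e2 :: 'b
  assumes a: "poly_bounded R m K a0" "poly_bounded R m K a1" "poly_bounded R m K a2" and L: "L \<ge> 1"
    and e: "e1 \<bullet> e1 = 1" "e2 \<bullet> e2 = 1" "e1 \<bullet> e2 = 0"
    and ray: "\<And>\<theta> t x. (LINT s|lborel. (\<lambda>p. a0 p + of_real (sin \<theta>) * a1 p + of_real (cos \<theta>) * a2 p)
         (t + s, x + s *\<^sub>R (sin \<theta> *\<^sub>R e1 + cos \<theta> *\<^sub>R e2))) = 0"
    and \<rho>: "\<rho> \<ge> 4 * L"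
  shows "(LINT (x, u, z)|lborel. carleman (m + 2) L x u * a2 (u, z) * exp (- \<i> * of_real (\<rho> * (e1 \<bullet> z)))) = 0"
proof -
  have \<rho>0: "\<rho> > 0" using \<rho> L by simp
  have Arc_hol: "(\<lambda>\<tau>. Arcsin (\<tau> / of_real \<rho>)) holomorphic_on ball 0 (2 * L)"
  proof -
    have 1: "Arcsin holomorphic_on ball 0 1"
      by (rule holomorphic_on_Arcsin) (auto intro: le_less_trans[OF abs_Re_le_cmod])
    have 2: "(\<lambda>\<tau>. \<tau> / of_real \<rho> :: complex) ` ball 0 (2 * L) \<subseteq> ball 0 1"
      using \<rho> L by (auto simp: norm_divide field_simps)
    have 3: "(\<lambda>\<tau>. \<tau> / of_real \<rho> :: complex) holomorphic_on ball 0 (2 * L)"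
      using \<rho>0 by (intro holomorphic_intros) auto
    show ?thesis using holomorphic_on_compose_gen[OF 3 1 2] by (simp add: o_def)
  qed
  have cos_nz: "cos (Arcsin (\<tau> / of_real \<rho>)) \<noteq> 0" if "\<tau> \<in> ball 0 (2 * L)" for \<tau>
  proof (rule cos_Arcsin_nonzero)
    have "norm (\<tau> / of_real \<rho>) < 1" using that \<rho> L by (simp add: norm_divide field_simps)
    then have "norm ((\<tau> / of_real \<rho>)\<^sup>2) < 1" unfolding norm_power by (simp add: power_less_one_iff)
    then show "(\<tau> / of_real \<rho>)\<^sup>2 \<noteq> 1" by auto
  qed
  have sub: "circ L x \<in> ball 0 (2 * L)" for x using L by (simp add: norm_circ)
  define \<theta> where "\<theta> = (\<lambda>x. Arcsin (circ L x / of_real \<rho>))"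
  \<comment> \<open>The factor \<open>c\<close> cancels the cosine that is left over at the end.\<close>
  define c where "c = (\<lambda>x. 1 / cos (\<theta> x))"
  have \<theta>c: "continuous_on UNIV \<theta>"
    unfolding \<theta>_def
    by (rule continuous_on_compose2[OF holomorphic_on_imp_continuous_on[OF Arc_hol] continuous_circ]) (use sub in blast)
  have cc: "continuous_on UNIV c"
    unfolding c_def by (intro continuous_intros continuous_on_cos \<theta>c) (use cos_nz sub in \<open>auto simp: \<theta>_def\<close>)
  note [measurable] = borel_measurable_continuous_onI[OF \<theta>c] borel_measurable_continuous_onI[OF cc]
  obtain q0 where q0: "q0 \<ge> 0" "\<And>x. x \<in> sphere 0 L \<Longrightarrow> norm (Arcsin (x / of_real \<rho>)) \<le> q0"
    by (rule compact_norm_bound[OF continuous_on_subset[OF holomorphic_on_imp_continuous_on[OF Arc_hol]], of "sphere 0 L"]) (use L in auto)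
  define q where "q = q0 + 1"
  define r where "r = q + 1"
  have q: "q > 0" "q < r" and \<theta>q: "norm (\<theta> x) \<le> q" for x
  proof -
    have "norm (\<theta> x) \<le> q0" unfolding \<theta>_def by (rule q0(2)) (use L in \<open>simp add: norm_circ\<close>)
    then show "norm (\<theta> x) \<le> q" by (simp add: q_def)
  qed (use q0 in \<open>auto simp: q_def r_def\<close>)
  \<comment> \<open>The phases for the two directions \<open>sin s e1 + \<sigma> cos s e2\<close>, with \<open>\<sigma> = 1\<close> and \<open>\<sigma> = - 1\<close>.\<close>
  define E where "E = (\<lambda>\<sigma> s x z. exp (- \<i> * (circ L x * (sin s * of_real (e1 \<bullet> z) + \<sigma> * cos s * of_real (e2 \<bullet> z))
      + of_real \<rho> * (cos s * cos s * of_real (e1 \<bullet> z) - \<sigma> * cos s * sin s * of_real (e2 \<bullet> z)))))"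
  define g0 where "g0 = (\<lambda>s x z. (E 1 s x z - E (-1) s x z) * c x)"
  define g1 where "g1 = (\<lambda>s x z. sin s * (E 1 s x z - E (-1) s x z) * c x)"
  define g2 where "g2 = (\<lambda>s x z. cos s * (E 1 s x z + E (-1) s x z) * c x)"
  define h where "h = (\<lambda>s (x, u, z). carleman (m + 2) L x u * a0 (u, z) * g0 s x z
     + carleman (m + 2) L x u * a1 (u, z) * g1 s x z + carleman (m + 2) L x u * a2 (u, z) * g2 s x z)"
  have Emeas[measurable]: "(\<lambda>p. E \<sigma> s (fst p) (snd (snd p))) \<in> borel_measurable (borel \<Otimes>\<^sub>M (borel \<Otimes>\<^sub>M borel))" for \<sigma> s
    unfolding E_def by measurable
  have am[measurable]: "a0 \<in> borel_measurable (borel \<Otimes>\<^sub>M borel)" "a1 \<in> borel_measurable (borel \<Otimes>\<^sub>M borel)"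
    "a2 \<in> borel_measurable (borel \<Otimes>\<^sub>M borel)"
    using a[THEN poly_boundedD(4)] by (simp_all add: borel_prod)
  have hm: "h s \<in> borel_measurable lborel" for s
    unfolding h_def g0_def g1_def g2_def by (intro borel_measurable_triple) measurable
  define X where "X = cball (0::complex) r \<times> ({0..1::real} \<times> cball (0::'b) R)"
  have X: "compact X" unfolding X_def by (intro compact_Times) auto
  have c1: "continuous_on X (\<lambda>p. circ L (fst (snd p)))"
    by (rule continuous_on_compose2[OF continuous_circ[of UNIV]]) (auto intro!: continuous_intros)
  have c2: "continuous_on X (\<lambda>p. c (fst (snd p)))"
    by (rule continuous_on_compose2[OF cc]) (auto intro!: continuous_intros)
  have cE: "continuous_on X (\<lambda>p. E \<sigma> (fst p) (fst (snd p)) (snd (snd p)))" for \<sigma>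
    unfolding E_def by (intro continuous_intros continuous_on_sin continuous_on_cos c1)
  obtain B0 where B0: "B0 \<ge> 0" "\<And>p. p \<in> X \<Longrightarrow> norm (g0 (fst p) (fst (snd p)) (snd (snd p))) \<le> B0"
    by (rule compact_norm_bound[OF _ X, of "\<lambda>p. g0 (fst p) (fst (snd p)) (snd (snd p))"])
       (auto simp: g0_def intro!: continuous_intros c2 cE)
  obtain B1 where B1: "B1 \<ge> 0" "\<And>p. p \<in> X \<Longrightarrow> norm (g1 (fst p) (fst (snd p)) (snd (snd p))) \<le> B1"
    by (rule compact_norm_bound[OF _ X, of "\<lambda>p. g1 (fst p) (fst (snd p)) (snd (snd p))"])
       (auto simp: g1_def intro!: continuous_intros continuous_on_sin c2 cE)
  obtain B2 where B2: "B2 \<ge> 0" "\<And>p. p \<in> X \<Longrightarrow> norm (g2 (fst p) (fst (snd p)) (snd (snd p))) \<le> B2"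
    by (rule compact_norm_bound[OF _ X, of "\<lambda>p. g2 (fst p) (fst (snd p)) (snd (snd p))"])
       (auto simp: g2_def intro!: continuous_intros continuous_on_cos c2 cE)
  define Q where "Q = 2 * pi * L * 2 ^ (m+2) * fact (m+2) * exp (1::real) * K"
  define b where "b = (\<lambda>p::real \<times> real \<times> 'b. Q * B0 * dominator R p + Q * B1 * dominator R p + Q * B2 * dominator R p)"
  have "(LINT p|lborel. h (\<theta> (fst p)) p) = 0"
  proof (rule analytic_substitution[where h=h and \<theta>="\<lambda>p. \<theta> (fst p)" and e=1 and b=b])
    show "(\<lambda>s. h s p) holomorphic_on ball 0 r" for p
      by (cases p) (auto simp: h_def g0_def g1_def g2_def E_def intro!: holomorphic_intros)
    show "h s \<in> borel_measurable lborel" for s by (rule hm)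
    show "integrable lborel b"
      unfolding b_def by (intro Bochner_Integration.integrable_add integrable_mult_right integrable_dominator)
    show "norm (h s p) \<le> b p" if s: "norm s < r" for s p
    proof -
      obtain x u z where p: "p = (x, u, z)" by (cases p)
      have "norm (carleman (m + 2) L x u * a0 (u, z) * g0 s x z) \<le> Q * B0 * dominator R p"
        unfolding p Q_def using B0(1) B0(2)[of "(s, x, z)"] s by (intro carleman_dominated[OF a(1) L]) (auto simp: X_def)
      moreover have "norm (carleman (m + 2) L x u * a1 (u, z) * g1 s x z) \<le> Q * B1 * dominator R p"
        unfolding p Q_def using B1(1) B1(2)[of "(s, x, z)"] s by (intro carleman_dominated[OF a(2) L]) (auto simp: X_def)
      moreover have "norm (carleman (m + 2) L x u * a2 (u, z) * g2 s x z) \<le> Q * B2 * dominator R p"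
        unfolding p Q_def using B2(1) B2(2)[of "(s, x, z)"] s by (intro carleman_dominated[OF a(3) L]) (auto simp: X_def)
      ultimately show ?thesis
        unfolding p h_def b_def split by (intro norm_triangle_le add_mono order_trans[OF norm_triangle_ineq]) auto
    qed
    show "(\<lambda>p::real \<times> real \<times> 'b. \<theta> (fst p)) \<in> borel_measurable lborel"
      by (intro borel_measurable_triple) measurable
    show "(LINT p|lborel. \<theta> (fst p) ^ k * h (of_real s) p) = 0" for k and s :: real
    proof -
      define f where "f = (\<lambda>\<tau>. Arcsin (\<tau> / of_real \<rho>) ^ k / cos (Arcsin (\<tau> / of_real \<rho>)))"
      have fh: "f holomorphic_on ball 0 (2 * L)"
        unfolding f_def using cos_nz by (intro holomorphic_intros Arc_hol) auto
      define A where "A = (\<lambda>\<phi> p. a0 p + of_real (sin \<phi>) * a1 p + of_real (cos \<phi>) * a2 p)"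
      define \<omega> where "\<omega> = (\<lambda>\<phi>. sin \<phi> *\<^sub>R e1 + cos \<phi> *\<^sub>R e2)"
      define \<eta> where "\<eta> = (\<lambda>\<phi>. (\<rho> * cos \<phi> * cos \<phi>) *\<^sub>R e1 - (\<rho> * cos \<phi> * sin \<phi>) *\<^sub>R e2)"
      have Ab: "poly_bounded R m (K + K + K) (A \<phi>)" for \<phi>
        unfolding A_def by (intro poly_bounded_add poly_bounded_mult a) (auto simp: norm_of_real)
      have A_ray: "(LINT s|lborel. A \<phi> (t + s, x + s *\<^sub>R \<omega> \<phi>)) = 0" for \<phi> t x
        using ray[where \<theta>=\<phi> and t=t and x=x] by (simp add: A_def \<omega>_def)
      have \<eta>\<omega>: "\<eta> \<phi> \<bullet> \<omega> \<phi> = 0" for \<phi>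
        using e by (simp add: \<eta>_def \<omega>_def inner_diff_left inner_add_right inner_commute[of e2 e1])
      have \<omega>1: "\<omega> \<phi> \<bullet> \<omega> \<phi> = 1" for \<phi>
        using e by (simp add: \<omega>_def inner_add_left inner_add_right inner_commute[of e2 e1] flip: power2_eq_square)
      define J where "J = (\<lambda>\<phi> (x, u, z). carleman (m + 2) L x u * A \<phi> (u, z) *
            (f (circ L x) * exp (- \<i> * (circ L x * of_real (\<omega> \<phi> \<bullet> z) + of_real (\<eta> \<phi> \<bullet> z)))))"
      have J: "integrable lborel (J \<phi>)" "integral\<^sup>L lborel (J \<phi>) = 0" for \<phi>
        using ray_orthogonality[OF Ab L A_ray \<omega>1 \<eta>\<omega> fh, of \<phi>] by (simp_all add: J_def)
      have "\<theta> (fst p) ^ k * h (of_real s) p = J s p - J (pi - s) p" for p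
      proof -
        obtain x u z where p: "p = (x, u, z)" by (cases p)
        have 1: "exp (- \<i> * (circ L x * of_real (\<omega> s \<bullet> z) + of_real (\<eta> s \<bullet> z))) = E 1 (of_real s) x z"
          unfolding E_def \<omega>_def \<eta>_def
          by (intro arg_cong[where f=exp] arg_cong[where f="\<lambda>w. - \<i> * w"] arg_cong2[where f="(+)"])
             (simp_all add: inner_add_left inner_diff_left sin_of_real cos_of_real right_diff_distrib mult_ac)
        have 2: "exp (- \<i> * (circ L x * of_real (\<omega> (pi - s) \<bullet> z) + of_real (\<eta> (pi - s) \<bullet> z))) = E (-1) (of_real s) x z"
          unfolding E_def \<omega>_def \<eta>_def
          by (intro arg_cong[where f=exp] arg_cong[where f="\<lambda>w. - \<i> * w"] arg_cong2[where f="(+)"])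
             (simp_all add: inner_add_left inner_diff_left sin_of_real cos_of_real distrib_left right_diff_distrib mult_ac)
        have 3: "f (circ L x) = \<theta> x ^ k * c x" by (simp add: f_def \<theta>_def c_def)
        have alg: "T * (w * b0 * ((Ep - Em) * d) + w * b1 * (S * (Ep - Em) * d) + w * b2 * (C * (Ep + Em) * d))
          = w * (b0 + S * b1 + C * b2) * (T * d * Ep) - w * (b0 + S * b1 + (- C) * b2) * (T * d * Em)"
          for T w b0 b1 b2 Ep Em d S C :: complex
          by (simp add: algebra_simps)
        have 4: "sin (of_real s :: complex) = of_real (sin s)" "cos (of_real s :: complex) = of_real (cos s)"
          "of_real (sin (pi - s)) = (of_real (sin s) :: complex)" "of_real (cos (pi - s)) = (- of_real (cos s) :: complex)"
          by (simp_all add: sin_of_real cos_of_real)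
        show ?thesis
          unfolding p J_def split 1 2 3 h_def g0_def g1_def g2_def A_def fst_conv 4 by (rule alg)
      qed
      then have "(LINT p|lborel. \<theta> (fst p) ^ k * h (of_real s) p) = (LINT p|lborel. J s p - J (pi - s) p)"
        by (intro Bochner_Integration.integral_cong refl)
      also have "\<dots> = 0"
        using Bochner_Integration.integral_diff[OF J(1)[of s] J(1)[of "pi - s"]] J(2) by simp
      finally show ?thesis .
    qed
  qed (use \<theta>q q in auto)
  moreover have "h (\<theta> (fst p)) p = 2 * (case p of (x, u, z) \<Rightarrow> carleman (m + 2) L x u * a2 (u, z) * exp (- \<i> * of_real (\<rho> * (e1 \<bullet> z))))" for p
  proof -
    obtain x u z where p: "p = (x, u, z)" by (cases p)
    have s: "sin (\<theta> x) = circ L x / of_real \<rho>" by (simp add: \<theta>_def)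
    then have \<tau>: "circ L x = of_real \<rho> * sin (\<theta> x)" using \<rho>0 by simp
    have cn: "cos (\<theta> x) \<noteq> 0" using cos_nz[OF sub] by (simp add: \<theta>_def)
    have E: "E \<sigma> (\<theta> x) x z = exp (- \<i> * of_real (\<rho> * (e1 \<bullet> z)))" for \<sigma>
    proof -
      have "circ L x * (sin (\<theta> x) * of_real (e1 \<bullet> z) + \<sigma> * cos (\<theta> x) * of_real (e2 \<bullet> z))
      + of_real \<rho> * (cos (\<theta> x) * cos (\<theta> x) * of_real (e1 \<bullet> z) - \<sigma> * cos (\<theta> x) * sin (\<theta> x) * of_real (e2 \<bullet> z))
        = of_real \<rho> * ((sin (\<theta> x))\<^sup>2 + (cos (\<theta> x))\<^sup>2) * of_real (e1 \<bullet> z)"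
        unfolding \<tau> power2_eq_square by (simp only: algebra_simps)
      then show ?thesis unfolding E_def by (simp only: sin_cos_squared_add mult_1_right of_real_mult)
    qed
    show ?thesis
      unfolding p h_def split fst_conv g0_def g1_def g2_def E using cn by (simp add: c_def)
  qed
  ultimately have "(LINT p|lborel. 2 * (case p of (x, u, z) \<Rightarrow> carleman (m + 2) L x u * a2 (u, z) * exp (- \<i> * of_real (\<rho> * (e1 \<bullet> z))))) = 0"
    by (simp only:)
  then show ?thesis unfolding integral_mult_right_zero by simp
qed

text \<open>The integral is analytic in \<open>\<rho>\<close>, so it vanishes for small and negative \<open>\<rho>\<close> as well.\<close>

lemma band_orthogonality:
  fixes a0 a1 a2 :: "real \<times> 'b::euclidean_space \<Rightarrow> complex" and e1 e2 :: 'b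
  assumes a: "poly_bounded R m K a0" "poly_bounded R m K a1" "poly_bounded R m K a2" and L: "L \<ge> 1"
    and e: "e1 \<bullet> e1 = 1" "e2 \<bullet> e2 = 1" "e1 \<bullet> e2 = 0"
    and ray: "\<And>\<theta> t x. (LINT s|lborel. (\<lambda>p. a0 p + of_real (sin \<theta>) * a1 p + of_real (cos \<theta>) * a2 p)
         (t + s, x + s *\<^sub>R (sin \<theta> *\<^sub>R e1 + cos \<theta> *\<^sub>R e2))) = 0"
  shows "(LINT (x, u, z)|lborel. carleman (m + 2) L x u * a2 (u, z) * exp (- \<i> * of_real (\<rho> * (e1 \<bullet> z)))) = 0"
proof -
  \<comment> \<open>An interior point of the range of \<open>\<rho>\<close> covered so far, at distance one from its end.\<close>
  define \<rho>0 where "\<rho>0 = 4 * L + 1"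
  define q where "q = \<bar>\<rho> - \<rho>0\<bar> + 1"
  define h where "h = (\<lambda>s (x, u, z). carleman (m + 2) L x u * a2 (u, z) * exp (- \<i> * ((of_real \<rho>0 + s) * of_real (e1 \<bullet> z))))"
  have am[measurable]: "a2 \<in> borel_measurable (borel \<Otimes>\<^sub>M borel)"
    using a(3)[THEN poly_boundedD(4)] by (simp_all add: borel_prod)
  define X where "X = cball (0::complex) (q + 1) \<times> cball (0::'b) R"
  have X: "compact X" unfolding X_def by (intro compact_Times) auto
  obtain B where B: "B \<ge> 0" "\<And>p. p \<in> X \<Longrightarrow> norm (exp (- \<i> * ((of_real \<rho>0 + fst p) * of_real (e1 \<bullet> snd p)))) \<le> B"
    by (rule compact_norm_bound[OF _ X, of "\<lambda>p. exp (- \<i> * ((of_real \<rho>0 + fst p) * of_real (e1 \<bullet> snd p)))"])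
       (auto intro!: continuous_intros)
  define Q where "Q = 2 * pi * L * 2 ^ (m+2) * fact (m+2) * exp (1::real) * K"
  have "(LINT p|lborel. h ((\<lambda>p. of_real (\<rho> - \<rho>0)) p) p) = 0"
  proof (rule analytic_substitution[where h=h and e=1 and b="\<lambda>p. Q * B * dominator R p" and q=q and r="q + 1"])
    show "(\<lambda>s. h s p) holomorphic_on ball 0 (q + 1)" for p
      by (cases p) (auto simp: h_def intro!: holomorphic_intros)
    show "h s \<in> borel_measurable lborel" for s
      unfolding h_def by (intro borel_measurable_triple) measurable
    show "integrable lborel (\<lambda>p. Q * B * dominator R p)"
      by (intro integrable_mult_right integrable_dominator)
    show "norm (h s p) \<le> Q * B * dominator R p" if s: "norm s < q + 1" for s p
    proof -
      obtain x u z where p: "p = (x, u, z)" by (cases p)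
      show ?thesis
        unfolding p Q_def h_def split using B(1) B(2)[of "(s, z)"] s
        by (intro carleman_dominated[OF a(3) L]) (auto simp: X_def)
    qed
    show "(LINT p|lborel. of_real (\<rho> - \<rho>0) ^ k * h (of_real s) p) = 0" if "\<bar>s\<bar> < 1" for k and s :: real
    proof -
      have "(LINT p|lborel. h (of_real s) p) = 0"
        using band_orthogonality_large[OF a L e ray, of "\<rho>0 + s"] that by (simp add: h_def \<rho>0_def)
      then show ?thesis by simp
    qed
  qed (auto simp: q_def simp flip: of_real_diff)
  then show "(LINT (x, u, z)|lborel. carleman (m + 2) L x u * a2 (u, z) * exp (- \<i> * of_real (\<rho> * (e1 \<bullet> z)))) = 0"
    by (simp add: h_def)
qed

section \<open>Letting the frequency band grow\<close>

lemma integral_exp_half_line: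
  fixes c :: complex
  assumes c: "Re c < 0"
  shows "integrable lborel (\<lambda>u::real. indicator {0<..} u *\<^sub>R exp (c * of_real u))"
    and "(LINT u|lborel. indicator {0<..} u *\<^sub>R exp (c * of_real u)) = - 1 / c"
proof -
  have c0: "c \<noteq> 0" using c by auto
  have ei: "einterval 0 \<infinity> = {0<..}" by (auto simp: einterval_def zero_ereal_def)
  have "integrable lborel (\<lambda>u. indicator {0<..} u *\<^sub>R exp (Re c * u))"
  proof -
    have "(\<lambda>x. exp (- (- Re c) * x)) integrable_on {0..}"
      using has_integral_exp_minus_to_infinity[of "- Re c" 0] c by (auto simp: integrable_on_def)
    then have "(\<lambda>x. exp (Re c * x)) absolutely_integrable_on {0..}"
      by (intro nonnegative_absolutely_integrable_1) auto
    then have "set_integrable lebesgue {0..} (\<lambda>x. exp (Re c * x))"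
      by (simp add: absolutely_integrable_on_def set_integrable_def)
    then have "set_integrable lebesgue {0<..} (\<lambda>x. exp (Re c * x))"
      by (rule set_integrable_subset) auto
    then show ?thesis
      unfolding set_integrable_def by (subst (asm) integrable_completion) auto
  qed
  then show int: "integrable lborel (\<lambda>u::real. indicator {0<..} u *\<^sub>R exp (c * of_real u))"
    by (rule Bochner_Integration.integrable_bound) (auto simp: indicator_def norm_exp_eq_Re)
  have "(LBINT u=0..\<infinity>. exp (c * of_real u)) = 0 - 1 / c"
  proof (rule interval_integral_FTC_integrable)
    show "((\<lambda>u. exp (c * of_real u) / c) has_vector_derivative exp (c * of_real u)) (at u)" for u :: real
      using c0 by (auto intro!: derivative_eq_intros has_vector_derivative_real_field simp: field_simps)
    show "set_integrable lborel (einterval 0 \<infinity>) (\<lambda>u. exp (c * of_real u))"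
      unfolding ei set_integrable_def by (rule int)
    have "isCont (\<lambda>u::real. exp (c * of_real u) / c) 0" by (intro continuous_intros) (use c0 in auto)
    then have "((\<lambda>u::real. exp (c * of_real u) / c) \<longlongrightarrow> 1 / c) (at_right 0)"
      by (auto simp: isCont_def intro: tendsto_within_subset)
    then show "(((\<lambda>u. exp (c * of_real u) / c) \<circ> real_of_ereal) \<longlongrightarrow> 1 / c) (at_right 0)"
      by (simp add: ereal_tendsto_simps1 zero_ereal_def)
    have "((\<lambda>u. exp (Re c * u) / norm c) \<longlongrightarrow> 0) at_top"
      using c c0 by real_asymp
    then have "((\<lambda>u::real. exp (c * of_real u) / c) \<longlongrightarrow> 0) at_top"
      by (subst tendsto_norm_zero_iff[symmetric]) (simp add: norm_divide norm_exp_eq_Re)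
    then show "(((\<lambda>u. exp (c * of_real u) / c) \<circ> real_of_ereal) \<longlongrightarrow> 0) (at_left \<infinity>)"
      by (simp add: ereal_tendsto_simps1)
  qed (auto intro!: continuous_intros)
  then show "(LINT u|lborel. indicator {0<..} u *\<^sub>R exp (c * of_real u)) = - 1 / c"
    by (simp add: interval_lebesgue_integral_def ei set_lebesgue_integral_def)
qed

lemma integral_jump_exp:
  assumes "Im \<tau> \<noteq> 0"
  shows "(LINT u|lborel. of_real (jump \<tau> u) * exp (\<i> * of_real u * \<tau>)) = \<i> / \<tau>"
proof (cases "Im \<tau> > 0")
  case True
  have "(LINT u|lborel. of_real (jump \<tau> u) * exp (\<i> * of_real u * \<tau>))
      = (LINT u|lborel. indicator {0<..} u *\<^sub>R exp ((\<i> * \<tau>) * of_real u))"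
    using True by (intro Bochner_Integration.integral_cong) (auto simp: jump_def indicator_def mult_ac)
  also have "\<dots> = - 1 / (\<i> * \<tau>)" using True by (intro integral_exp_half_line) auto
  also have "\<dots> = \<i> / \<tau>"
  proof -
    have "\<tau> \<noteq> 0" using True by auto
    then show ?thesis by (simp add: field_simps)
  qed
  finally show ?thesis .
next
  case False
  then have neg: "Im \<tau> < 0" using assms by auto
  have "(LINT u|lborel. of_real (jump \<tau> u) * exp (\<i> * of_real u * \<tau>))
      = (LINT u|lborel. of_real (jump \<tau> (- u)) * exp (\<i> * of_real (- u) * \<tau>))"
    by (subst lborel_integral_real_affine[where c="-1" and t=0]) auto
  also have "\<dots> = (LINT u|lborel. - (indicator {0<..} u *\<^sub>R exp ((- \<i> * \<tau>) * of_real u)))"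
  proof (rule integral_cong_AE)
    have [measurable]: "\<tau> \<in> space borel" by simp
    show "(\<lambda>u. of_real (jump \<tau> (- u)) * exp (\<i> * of_real (- u) * \<tau>)) \<in> borel_measurable lborel"
      unfolding jump_def by measurable
    show "AE u in lborel. of_real (jump \<tau> (- u)) * exp (\<i> * of_real (- u) * \<tau>)
        = - (indicator {0<..} u *\<^sub>R exp ((- \<i> * \<tau>) * of_real u))"
      using AE_lborel_singleton[of 0] by eventually_elim (use neg in \<open>auto simp: jump_def indicator_def mult_ac\<close>)
  qed measurable
  also have "\<dots> = - (- 1 / (- \<i> * \<tau>))"
    using neg by (subst Bochner_Integration.integral_minus, subst integral_exp_half_line) auto
  also have "\<dots> = \<i> / \<tau>"
  proof -
    have "\<tau> \<noteq> 0" using neg by auto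
    then show ?thesis by (simp add: field_simps)
  qed
  finally show ?thesis .
qed

lemma Im_circ: "Im (circ 1 x) = sin (2 * pi * x)"
  by (simp add: circ_def Im_exp)

lemma AE_Im_circ: "AE x in lborel. x \<in> {0..1} \<longrightarrow> Im (circ 1 x) \<noteq> 0"
proof -
  have H: "sin (2 * pi * x) \<noteq> 0" if "x \<noteq> 0" "x \<noteq> 1/2" "x \<noteq> 1" "x \<in> {0..1}" for x
  proof
    assume "sin (2 * pi * x) = 0"
    then obtain i :: int where "2 * pi * x = of_int i * pi" by (auto simp: sin_zero_iff_int2)
    then have "2 * x = of_int i" by simp
    moreover from this have "0 \<le> i" "i \<le> 2" using that(4) by (auto simp: le_less of_int_le_iff[symmetric, where 'a=real] simp del: of_int_le_iff)
    then have "i = 0 \<or> i = 1 \<or> i = 2" by auto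
    ultimately show False using that by auto
  qed
  show ?thesis
    using AE_lborel_singleton[of "0::real"] AE_lborel_singleton[of "1/2::real"] AE_lborel_singleton[of "1::real"]
    unfolding Im_circ by eventually_elim (use H in blast)
qed

text \<open>
  Both half-line transforms of the constant \<open>1\<close> are \<open>\<i> / \<tau>\<close>, so the total mass of the kernel is a Cauchy
  integral around the origin. That it is not zero is what allows a value of the form to be recovered in the
  limit.
\<close>

lemma integral_carleman:
  "(LINT x|lborel. LINT u|lborel. carleman N 1 x u) = - 2 * of_real pi"
proof -
  let ?g = "\<lambda>\<tau>::complex. (1 - \<tau>\<^sup>2) ^ N / \<tau>"
  have eq: "(LINT u|lborel. carleman N 1 x u) = circ_weight N 1 x * (LINT u|lborel. of_real (jump (circ 1 x) u) * exp (\<i> * of_real u * circ 1 x))" for x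
    by (simp add: carleman_def mult.assoc)
  have "(LINT x|lborel. LINT u|lborel. carleman N 1 x u)
     = (LINT x|lborel. \<i> * (indicator {0..1} x *\<^sub>R (2 * of_real pi * \<i> * circ 1 x * ?g (circ 1 x))))"
  proof (rule integral_cong_AE)
    show "AE x in lborel. (LINT u|lborel. carleman N 1 x u)
       = \<i> * (indicator {0..1} x *\<^sub>R (2 * of_real pi * \<i> * circ 1 x * ?g (circ 1 x)))"
      using AE_Im_circ
      by eventually_elim (auto simp: eq circ_weight_def integral_jump_exp indicator_def)
    show "(\<lambda>x. LINT u|lborel. carleman N 1 x u) \<in> borel_measurable lborel"
      by (rule lborel.borel_measurable_lebesgue_integral) measurable
  qed measurable
  also have "\<dots> = \<i> * contour_integral (circlepath 0 1) ?g"
    by (subst integral_mult_right_zero, subst circle_integral_eq_contour_integral)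
       (auto intro!: continuous_intros)
  also have "contour_integral (circlepath 0 1) ?g = 2 * of_real pi * \<i> * (1 - 0\<^sup>2) ^ N"
  proof (rule contour_integral_unique)
    have "(\<lambda>\<tau>. (1 - \<tau>\<^sup>2) ^ N) holomorphic_on cball (0::complex) 1" by (intro holomorphic_intros)
    from Cauchy_integral_circlepath_simple[OF this, of 0]
    show "(?g has_contour_integral 2 * of_real pi * \<i> * (1 - 0\<^sup>2) ^ N) (circlepath 0 1)" by simp
  qed
  finally show ?thesis by simp
qed

lemma carleman_scale:
  assumes "L > 0"
  shows "carleman N L x (u / L) = of_real L * carleman N 1 x u"
proof -
  have c: "circ L x = of_real L * circ 1 x" by (simp add: circ_def)
  have "Im (circ L x) < 0 \<longleftrightarrow> Im (circ 1 x) < 0" unfolding c using assms by (simp add: mult_less_0_iff)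
  then have "jump (circ L x) (u / L) = jump (circ 1 x) u"
    using assms by (simp add: jump_def zero_less_divide_iff)
  moreover have "\<i> * of_real (u / L) * circ L x = \<i> * of_real u * circ 1 x" using assms by (simp add: c)
  moreover have "circ_weight N L x = of_real L * circ_weight N 1 x"
    using assms by (simp add: circ_weight_def c)
  ultimately show ?thesis by (simp add: carleman_def)
qed

lemma carleman_integral_iterated:
  fixes a :: "real \<times> 'b::euclidean_space \<Rightarrow> complex" and e :: "'b \<Rightarrow> complex"
  assumes a: "poly_bounded R m K a" and L: "L \<ge> 1"
    and [measurable]: "e \<in> borel_measurable borel" and e: "\<And>z. norm (e z) \<le> 1"
  shows "(LINT (x, u, z)|lborel. carleman (m + 2) L x u * a (u, z) * e z)
    = (LINT x|lborel. LINT u|lborel. carleman (m + 2) L x u * (LINT z|lborel. a (u, z) * e z))"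
proof -
  define T where "T = (\<lambda>(x, u, z). carleman (m + 2) L x u * a (u, z) * e z)"
  have [measurable]: "a \<in> borel_measurable (borel \<Otimes>\<^sub>M borel)"
    using poly_boundedD(4)[OF a] by (simp add: borel_prod)
  have T: "integrable lborel T"
    unfolding T_def by (rule carleman_integrable[OF a L, where B=1]) (use e in \<open>auto simp: case_prod_unfold\<close>)
  have Tx: "integrable lborel (\<lambda>q. T (x, q))" for x
  proof (rule Bochner_Integration.integrable_bound)
    define Q where "Q = 2 * pi * L * 2 ^ (m+2) * fact (m+2) * exp (1::real) * K * 1"
    have "integrable lborel (indicator (cball 0 R) :: 'b \<Rightarrow> real)"
      using emeasure_lborel_cball_finite by (intro integrable_real_indicator) auto
    from integrable_prod_mult[OF integrable_inverse_1_plus_square' this]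
    show "integrable lborel (\<lambda>(u::real, z::'b). Q * (indicator {0..1} x * (inverse (1 + u\<^sup>2) * indicator (cball 0 R) z)))"
      by (simp add: case_prod_unfold)
    show "AE q in lborel. norm (T (x, q)) \<le> norm (case q of (u, z) \<Rightarrow> Q * (indicator {0..1} x * (inverse (1 + u\<^sup>2) * indicator (cball 0 R) z)))"
    proof (rule AE_I2)
      fix q :: "real \<times> 'b"
      obtain u z where q: "q = (u, z)" by (cases q)
      have "norm (T (x, q)) \<le> Q * dominator R (x, u, z)"
        unfolding q T_def split Q_def by (rule carleman_dominated[OF a L]) (use e in auto)
      then show "norm (T (x, q)) \<le> norm (case q of (u, z) \<Rightarrow> Q * (indicator {0..1} x * (inverse (1 + u\<^sup>2) * indicator (cball 0 R) z)))"
        unfolding q dominator_def split by (rule order_trans) (simp only: real_norm_def abs_ge_self)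
    qed
    have "(\<lambda>q. T (x, q)) \<in> borel_measurable (borel \<Otimes>\<^sub>M borel)"
      unfolding T_def case_prod_unfold fst_conv snd_conv by measurable
    then show "(\<lambda>q. T (x, q)) \<in> borel_measurable lborel" by (simp add: borel_prod)
  qed
  have "(LINT p|lborel. T p) = (LINT x|lborel. LINT q|lborel. T (x, q))"
    using lborel_pair.integral_fst'[of T] T by (simp add: lborel_prod)
  also have "\<dots> = (LINT x|lborel. LINT u|lborel. LINT z|lborel. T (x, u, z))"
  proof (rule Bochner_Integration.integral_cong[OF refl])
    fix x
    show "(LINT q|lborel. T (x, q)) = (LINT u|lborel. LINT z|lborel. T (x, u, z))"
      using lborel_pair.integral_fst'[of "\<lambda>q. T (x, q)"] Tx[of x] by (simp add: lborel_prod)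
  qed
  also have "\<dots> = (LINT x|lborel. LINT u|lborel. carleman (m + 2) L x u * (LINT z|lborel. a (u, z) * e z))"
    by (simp add: T_def mult.assoc)
  finally show ?thesis by (simp add: T_def)
qed

text \<open>
  By the scaling of the kernel, \<open>L\<close> can be moved from the kernel into the time argument of \<open>a2\<close>, where it appears
  as \<open>u / L\<close>. For large \<open>L\<close> dominated convergence replaces \<open>a2 (u / L, z)\<close> by \<open>a2 (0, z)\<close>, and the
  integral factors into the total mass of the kernel and the Fourier integral at time zero.
\<close>

lemma plane_fourier_vanishes_at_0:
  fixes a0 a1 a2 :: "real \<times> 'b::euclidean_space \<Rightarrow> complex" and e1 e2 :: 'b
  assumes a: "poly_bounded R m K a0" "poly_bounded R m K a1" "poly_bounded R m K a2"
    and e: "e1 \<bullet> e1 = 1" "e2 \<bullet> e2 = 1" "e1 \<bullet> e2 = 0"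
    and ray: "\<And>\<theta> t x. (LINT s|lborel. (\<lambda>p. a0 p + of_real (sin \<theta>) * a1 p + of_real (cos \<theta>) * a2 p)
         (t + s, x + s *\<^sub>R (sin \<theta> *\<^sub>R e1 + cos \<theta> *\<^sub>R e2))) = 0"
  shows "(LINT z|lborel. a2 (0, z) * exp (- \<i> * of_real (\<rho> * (e1 \<bullet> z)))) = 0"
proof -
  define E where "E = (\<lambda>z. exp (- \<i> * of_real (\<rho> * (e1 \<bullet> z))))"
  have E: "norm (E z) \<le> 1" for z by (simp add: E_def norm_exp_eq_Re)
  have Em[measurable]: "E \<in> borel_measurable borel" unfolding E_def by measurable
  define g where "g = (\<lambda>u. LINT z|lborel. a2 (u, z) * E z)"
  define b where "b = (\<lambda>L (u, z). a2 (u / L, z))"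
  have b: "poly_bounded R m K (b L)" if L: "L \<ge> 1" for L
  proof -
    have K: "K \<ge> 0" using poly_boundedD(5)[OF a(3)] .
    have "norm (a2 (u / L, z)) \<le> K * (1 + \<bar>u\<bar>) ^ m" for u z
    proof -
      have "\<bar>u / L\<bar> \<le> \<bar>u\<bar>" using L mult_left_mono[of 1 L "\<bar>u\<bar>"] by (simp add: abs_divide field_simps)
      then have "K * (1 + \<bar>u / L\<bar>) ^ m \<le> K * (1 + \<bar>u\<bar>) ^ m" using K by (intro mult_left_mono power_mono) auto
      then show ?thesis using poly_boundedD(2)[OF a(3), of "u / L" z] by linarith
    qed
    moreover have "continuous_on UNIV (b L)"
      unfolding b_def case_prod_unfold
      by (rule continuous_on_compose2[OF poly_boundedD(1)[OF a(3)]]) (use L in \<open>auto intro!: continuous_intros\<close>)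
    ultimately show ?thesis using poly_boundedD(3)[OF a(3)] by (auto simp: poly_bounded_def b_def)
  qed
  have zero: "(LINT (x, u, z)|lborel. carleman (m + 2) 1 x u * b L (u, z) * E z) = 0" if L: "L \<ge> 1" for L
  proof -
    have "(LINT (x, u, z)|lborel. carleman (m + 2) 1 x u * b L (u, z) * E z)
      = (LINT x|lborel. LINT u|lborel. carleman (m + 2) 1 x u * g (u / L))"
      using carleman_integral_iterated[OF b[OF L] _ Em E] by (simp add: g_def b_def)
    also have "\<dots> = (LINT x|lborel. LINT u|lborel. carleman (m + 2) L x u * g u)"
    proof (rule Bochner_Integration.integral_cong[OF refl])
      fix x
      have "(LINT u|lborel. carleman (m + 2) L x u * g u) = (1 / L) *\<^sub>R (LINT u|lborel. carleman (m + 2) L x (u / L) * g (u / L))"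
        using L by (subst lborel_integral_real_affine[where c="1 / L" and t=0]) auto
      also have "(LINT u|lborel. carleman (m + 2) L x (u / L) * g (u / L)) = of_real L * (LINT u|lborel. carleman (m + 2) 1 x u * g (u / L))"
        using L by (simp add: carleman_scale mult.assoc)
      finally show "(LINT u|lborel. carleman (m + 2) 1 x u * g (u / L)) = (LINT u|lborel. carleman (m + 2) L x u * g u)"
        using L by (simp add: scaleR_conv_of_real)
    qed
    also have "\<dots> = (LINT (x, u, z)|lborel. carleman (m + 2) L x u * a2 (u, z) * E z)"
      using carleman_integral_iterated[OF a(3) L Em E] by (simp add: g_def)
    also have "\<dots> = 0"
      using band_orthogonality[OF a L e ray, of \<rho>] by (simp add: E_def)
    finally show ?thesis .
  qed
  define b0 where "b0 = (\<lambda>(u::real, z). a2 (0, z))"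
  have b0: "poly_bounded R m K b0"
  proof -
    have "norm (a2 (0, z)) \<le> K * (1 + \<bar>u\<bar>) ^ m" for u z
    proof -
      have "K * 1 \<le> K * (1 + \<bar>u\<bar>) ^ m" using poly_boundedD(5)[OF a(3)] by (intro mult_left_mono) auto
      then show ?thesis using poly_boundedD(2)[OF a(3), of 0 z] by simp
    qed
    moreover have "continuous_on UNIV b0"
      unfolding b0_def case_prod_unfold
      by (rule continuous_on_compose2[OF poly_boundedD(1)[OF a(3)]]) (auto intro!: continuous_intros)
    ultimately show ?thesis using poly_boundedD(3)[OF a(3)] by (auto simp: poly_bounded_def b0_def)
  qed
  define Q where "Q = 2 * pi * 1 * 2 ^ (m+2) * fact (m+2) * exp (1::real) * K * 1"
  have int: "integrable lborel (\<lambda>(x, u, z). carleman (m + 2) 1 x u * c (u, z) * E z)" if "poly_bounded R m K c" for c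
    by (rule carleman_integrable[OF that, where B=1]) (use E in \<open>auto simp: case_prod_unfold\<close>)
  have "(\<lambda>k. LINT (x, u, z)|lborel. carleman (m + 2) 1 x u * b (real k + 1) (u, z) * E z)
     \<longlonglongrightarrow> (LINT (x, u, z)|lborel. carleman (m + 2) 1 x u * b0 (u, z) * E z)"
  proof (rule integral_dominated_convergence)
    show "integrable lborel (\<lambda>p. Q * dominator R p)" by (intro integrable_mult_right integrable_dominator)
    show "AE p in lborel. norm (case p of (x, u, z) \<Rightarrow> carleman (m + 2) 1 x u * b (real k + 1) (u, z) * E z) \<le> Q * dominator R p" for k
    proof (rule AE_I2)
      fix p :: "real \<times> real \<times> 'b"
      obtain x u z where p: "p = (x, u, z)" by (cases p)
      show "norm (case p of (x, u, z) \<Rightarrow> carleman (m + 2) 1 x u * b (real k + 1) (u, z) * E z) \<le> Q * dominator R p"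
        unfolding p split Q_def by (rule carleman_dominated[OF b]) (use E in auto)
    qed
    show "AE p in lborel. (\<lambda>k. case p of (x, u, z) \<Rightarrow> carleman (m + 2) 1 x u * b (real k + 1) (u, z) * E z)
       \<longlonglongrightarrow> (case p of (x, u, z) \<Rightarrow> carleman (m + 2) 1 x u * b0 (u, z) * E z)"
    proof (rule AE_I2)
      fix p :: "real \<times> real \<times> 'b"
      obtain x u z where p: "p = (x, u, z)" by (cases p)
      have "(\<lambda>k. u / (real k + 1)) \<longlonglongrightarrow> 0" by real_asymp
      then have "(\<lambda>k. (u / (real k + 1), z)) \<longlonglongrightarrow> (0, z)" by (intro tendsto_intros)
      then have "(\<lambda>k. a2 (u / (real k + 1), z)) \<longlonglongrightarrow> a2 (0, z)"
        by (rule continuous_on_tendsto_compose[OF poly_boundedD(1)[OF a(3)]]) auto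
      then show "(\<lambda>k. case p of (x, u, z) \<Rightarrow> carleman (m + 2) 1 x u * b (real k + 1) (u, z) * E z)
         \<longlonglongrightarrow> (case p of (x, u, z) \<Rightarrow> carleman (m + 2) 1 x u * b0 (u, z) * E z)"
        unfolding p split b_def b0_def by (intro tendsto_intros)
    qed
  qed (use int[OF b] int[OF b0] in auto)
  then have "(LINT (x, u, z)|lborel. carleman (m + 2) 1 x u * b0 (u, z) * E z) = 0"
    using zero by (simp add: LIMSEQ_const_iff)
  then have "0 = (LINT x|lborel. LINT u|lborel. carleman (m + 2) 1 x u * g 0)"
    using carleman_integral_iterated[OF b0 _ Em E, of 1] by (simp add: b0_def g_def)
  also have "\<dots> = (LINT x|lborel. LINT u|lborel. carleman (m + 2) 1 x u) * g 0"
    by simp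
  finally show ?thesis by (simp add: integral_carleman g_def E_def)
qed

text \<open>The general case follows by translation in time, which preserves the growth condition with a larger constant.\<close>

lemma plane_fourier_vanishes:
  fixes a0 a1 a2 :: "real \<times> 'b::euclidean_space \<Rightarrow> complex" and e1 e2 :: 'b
  assumes a: "poly_bounded R m K a0" "poly_bounded R m K a1" "poly_bounded R m K a2"
    and e: "e1 \<bullet> e1 = 1" "e2 \<bullet> e2 = 1" "e1 \<bullet> e2 = 0"
    and ray: "\<And>\<theta> t x. (LINT s|lborel. (\<lambda>p. a0 p + of_real (sin \<theta>) * a1 p + of_real (cos \<theta>) * a2 p)
         (t + s, x + s *\<^sub>R (sin \<theta> *\<^sub>R e1 + cos \<theta> *\<^sub>R e2))) = 0"
  shows "(LINT z|lborel. a2 (t, z) * exp (- \<i> * of_real (\<rho> * (e1 \<bullet> z)))) = 0"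
proof -
  have shift: "poly_bounded R m (K * (1 + \<bar>t\<bar>) ^ m) (\<lambda>(u, z). c (t + u, z))" if c: "poly_bounded R m K c" for c :: "real \<times> 'b \<Rightarrow> complex"
  proof -
    have "norm (c (t + u, z)) \<le> K * (1 + \<bar>t\<bar>) ^ m * (1 + \<bar>u\<bar>) ^ m" for u z
    proof -
      have "1 + \<bar>t + u\<bar> \<le> (1 + \<bar>t\<bar>) * (1 + \<bar>u\<bar>)"
        using mult_nonneg_nonneg[of "\<bar>t\<bar>" "\<bar>u\<bar>"] abs_triangle_ineq[of t u]
        unfolding distrib_left distrib_right by linarith
      then have "K * (1 + \<bar>t + u\<bar>) ^ m \<le> K * ((1 + \<bar>t\<bar>) * (1 + \<bar>u\<bar>)) ^ m"
        using poly_boundedD(5)[OF c] by (intro mult_left_mono power_mono) auto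
      then show ?thesis using poly_boundedD(2)[OF c, of "t + u" z] by (simp add: power_mult_distrib mult.assoc)
    qed
    moreover have "continuous_on UNIV (\<lambda>(u, z). c (t + u, z))"
      unfolding case_prod_unfold
      by (rule continuous_on_compose2[OF poly_boundedD(1)[OF c]]) (auto intro!: continuous_intros)
    ultimately show ?thesis using poly_boundedD(3)[OF c] by (auto simp: poly_bounded_def)
  qed
  have "(LINT z|lborel. (\<lambda>(u, z). a2 (t + u, z)) (0, z) * exp (- \<i> * of_real (\<rho> * (e1 \<bullet> z)))) = 0"
    by (rule plane_fourier_vanishes_at_0[OF shift[OF a(1)] shift[OF a(2)] shift[OF a(3)] e])
       (use ray[where t="t + _"] in \<open>simp add: add.assoc\<close>)
  then show ?thesis by simp
qed

section \<open>Integrals of compactly supported functions\<close>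

lemma integrable_compact_support:
  fixes f :: "'a::euclidean_space \<Rightarrow> 'b::{banach, second_countable_topology}"
  assumes "continuous_on UNIV f" and supp: "\<And>z. norm z > R \<Longrightarrow> f z = 0"
  shows "integrable lborel f"
proof -
  have "integrable lborel (\<lambda>x. indicator (cball 0 R) x *\<^sub>R f x)"
    by (rule borel_integrable_compact) (use assms in \<open>auto intro: continuous_on_subset\<close>)
  also have "(\<lambda>x. indicator (cball 0 R) x *\<^sub>R f x) = f"
    using supp by (auto simp: fun_eq_iff indicator_def)
  finally show ?thesis .
qed

lemma lborel_integral_compact_support:
  fixes f :: "real \<Rightarrow> complex"
  assumes cont: "continuous_on UNIV f" and supp: "\<And>s. \<bar>s\<bar> > c \<Longrightarrow> f s = 0"
  shows "(LINT s|lborel. f s) = integral {-c..c} f"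
proof -
  have "set_integrable lborel {-c..c} f"
    by (rule borel_integrable_atLeastAtMost') (use cont in \<open>auto intro: continuous_on_subset\<close>)
  then have "(LINT s:{-c..c}|lborel. f s) = integral {-c..c} f"
    by (rule set_borel_integral_eq_integral(2))
  moreover have "indicator {-c..c} s *\<^sub>R f s = f s" for s
    using supp[of s] by (auto simp: indicator_def abs_le_iff not_less)
  ultimately show ?thesis by (simp add: set_lebesgue_integral_def)
qed

lemma integral_derivative_compact_support:
  fixes f :: "real \<Rightarrow> complex"
  assumes der: "\<And>s. (f has_vector_derivative f' s) (at s)" and cont: "continuous_on UNIV f'"
    and supp: "\<And>s. \<bar>s\<bar> > c \<Longrightarrow> f s = 0"
  shows "(LINT s|lborel. f' s) = 0"
proof -
  define d where "d = \<bar>c\<bar> + 1"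
  have d: "d > 0" "d > c" by (auto simp: d_def)
  have "f' s = 0" if "\<bar>s\<bar> > d" for s
  proof (rule vector_derivative_unique_at[OF der])
    show "(f has_vector_derivative 0) (at s)"
    proof (rule has_vector_derivative_transform_within_open)
      show "((\<lambda>_. 0) has_vector_derivative 0) (at s)" by simp
      show "open {x. \<bar>x\<bar> > c}" by (intro open_Collect_less continuous_intros)
    qed (use that d supp in auto)
  qed
  then have "(LINT s|lborel. f' s) = integral {-d..d} f'"
    by (intro lborel_integral_compact_support cont)
  also have "\<dots> = f d - f (-d)"
    by (intro integral_unique fundamental_theorem_of_calculus)
       (use d der in \<open>auto intro: has_vector_derivative_at_within\<close>)
  also have "\<dots> = 0" using supp[of d] supp[of "-d"] d by simp
  finally show ?thesis .
qed

lemma integral_directional_derivative_eq_0: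
  fixes g :: "'b::euclidean_space \<Rightarrow> complex"
  assumes der: "\<And>z s. ((\<lambda>s. g (z + s *\<^sub>R e)) has_vector_derivative g' (z + s *\<^sub>R e)) (at s)"
    and cont: "continuous_on UNIV g'" and supp: "\<And>z. norm z > R \<Longrightarrow> g z = 0" "\<And>z. norm z > R \<Longrightarrow> g' z = 0"
    and e: "e \<noteq> 0"
  shows "(LINT z|lborel. g' z) = 0"
proof (rule integral_eq_0_if_line_integrals_eq_0)
  show "integrable lborel g'" by (rule integrable_compact_support[OF cont supp(2)])
  show "(e /\<^sub>R (e \<bullet> e)) \<bullet> e = 1" using e by simp
  fix p
  show "(LINT s|lborel. g' (p + s *\<^sub>R e)) = 0"
  proof (rule integral_derivative_compact_support[OF der])
    show "continuous_on UNIV (\<lambda>s. g' (p + s *\<^sub>R e))"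
      by (rule continuous_on_compose2[OF cont]) (auto intro!: continuous_intros)
    show "g (p + s *\<^sub>R e) = 0" if "\<bar>s\<bar> > (norm p + R) / norm e" for s
    proof (rule supp(1))
      have "\<bar>s\<bar> * norm e - norm p \<le> norm (p + s *\<^sub>R e)"
        using norm_triangle_ineq2[of "s *\<^sub>R e" "- p"] by (simp add: add.commute)
      then show "norm (p + s *\<^sub>R e) > R" using that e by (simp add: pos_divide_less_eq)
    qed
  qed
qed

section \<open>Completeness of exponentials and of polynomials\<close>

text \<open>By density the real and imaginary parts of \<open>G\<close> are admissible test functions, so the square norm of \<open>G\<close> is zero.\<close>

lemma orthogonal_to_dense_imp_eq_0:
  fixes G :: "'b::euclidean_space \<Rightarrow> complex"
  assumes cont: "continuous_on UNIV G" and supp: "\<And>z. norm z > R \<Longrightarrow> G z = 0"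
    and dense: "\<And>f e. continuous_on (cball 0 R) f \<Longrightarrow> 0 < e \<Longrightarrow> \<exists>g\<in>T. \<forall>z\<in>cball 0 R. \<bar>f z - g z\<bar> < e"
    and Tc: "\<And>g. g \<in> T \<Longrightarrow> continuous_on UNIV g"
    and orth: "\<And>g. g \<in> T \<Longrightarrow> (LINT z|lborel. of_real (g z) * G z) = 0"
  shows "G z = 0"
proof -
  have int: "integrable lborel (\<lambda>z. of_real (f z) * G z)" if "continuous_on UNIV f" for f :: "'b \<Rightarrow> real"
    by (rule integrable_compact_support[where R=R]) (use that cont supp in \<open>auto intro!: continuous_intros\<close>)
  have intG: "integrable lborel (\<lambda>z. norm (G z))"
    by (rule integrable_compact_support[where R=R]) (use cont supp in \<open>auto intro!: continuous_intros\<close>)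
  have orth': "(LINT z|lborel. of_real (f z) * G z) = 0" if f: "continuous_on UNIV f" for f
  proof -
    have "norm (LINT z|lborel. of_real (f z) * G z) \<le> 0 + e" if e: "e > 0" for e
    proof -
      define C where "C = (LINT z|lborel. norm (G z)) + 1"
      have "(LINT z|lborel. norm (G z)) \<ge> 0" by (rule Bochner_Integration.integral_nonneg) auto
      then have C: "C > 0" "(LINT z|lborel. norm (G z)) \<le> C" unfolding C_def by linarith+
      obtain g where g: "g \<in> T" "\<forall>z\<in>cball 0 R. \<bar>f z - g z\<bar> < e / C"
        using dense[of f "e / C"] f e C by (auto intro: continuous_on_subset)
      have "(LINT z|lborel. of_real (f z) * G z) = (LINT z|lborel. of_real (f z) * G z) - (LINT z|lborel. of_real (g z) * G z)"
        using orth[OF g(1)] by simp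
      also have "\<dots> = (LINT z|lborel. of_real (f z - g z) * G z)"
        using int[OF f] int[OF Tc[OF g(1)]] by (simp add: left_diff_distrib)
      also have "norm \<dots> \<le> (LINT z|lborel. norm (of_real (f z - g z) * G z))"
        by (rule integral_norm_bound)
      also have "\<dots> \<le> (LINT z|lborel. (e / C) * norm (G z))"
      proof (rule integral_mono)
        show "integrable lborel (\<lambda>z. norm (of_real (f z - g z) * G z))"
          using Tc[OF g(1)] f by (intro integrable_norm int continuous_intros)
        show "integrable lborel (\<lambda>z. (e / C) * norm (G z))" using intG by simp
        show "norm (of_real (f z - g z) * G z) \<le> (e / C) * norm (G z)" for z
        proof (cases "norm z \<le> R")
          case True
          then have "\<bar>f z - g z\<bar> \<le> e / C" using g(2) by (auto simp: less_imp_le)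
          then show ?thesis unfolding norm_mult norm_of_real by (rule mult_right_mono) auto
        qed (use supp in auto)
      qed
      also have "\<dots> = (e / C) * (LINT z|lborel. norm (G z))" by simp
      also have "\<dots> \<le> (e / C) * C" using C e by (intro mult_left_mono) auto
      also have "\<dots> = e" using C by simp
      finally show ?thesis by simp
    qed
    then have "norm (LINT z|lborel. of_real (f z) * G z) \<le> 0" by (rule field_le_epsilon)
    then show ?thesis by simp
  qed
  have Rec: "continuous_on UNIV (\<lambda>z. Re (G z))" "continuous_on UNIV (\<lambda>z. Im (G z))"
    using cont by (auto intro!: continuous_intros)
  have "(LINT z|lborel. (norm (G z))\<^sup>2) = (LINT z|lborel. Re (of_real (Re (G z)) * G z)) + (LINT z|lborel. Im (of_real (Im (G z)) * G z))"
  proof (subst Bochner_Integration.integral_add[symmetric])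
    show "integrable lborel (\<lambda>z. Re (of_real (Re (G z)) * G z))" "integrable lborel (\<lambda>z. Im (of_real (Im (G z)) * G z))"
      by (rule integrable_Re[OF int[OF Rec(1)]], rule integrable_Im[OF int[OF Rec(2)]])
    show "(LINT z|lborel. (norm (G z))\<^sup>2) = (LINT z|lborel. Re (of_real (Re (G z)) * G z) + Im (of_real (Im (G z)) * G z))"
      by (intro Bochner_Integration.integral_cong refl, simp only: cmod_power2) (simp add: power2_eq_square)
  qed
  also have "\<dots> = Re (LINT z|lborel. of_real (Re (G z)) * G z) + Im (LINT z|lborel. of_real (Im (G z)) * G z)"
    using integral_Re[OF int[OF Rec(1)]] integral_Im[OF int[OF Rec(2)]] by simp
  also have "\<dots> = 0" using orth'[OF Rec(1)] orth'[OF Rec(2)] by simp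
  finally have zero: "(LINT z|lborel. (norm (G z))\<^sup>2) = 0" .
  define c where "c = norm z + \<bar>R\<bar> + 1"
  define S where "S = cbox (- c *\<^sub>R One) (c *\<^sub>R One :: 'b)"
  have inS: "y \<in> S" if "norm y \<le> c" for y
  proof -
    have "\<bar>y \<bullet> b\<bar> \<le> c" if "b \<in> Basis" for b
      using Basis_le_norm[OF that, of y] \<open>norm y \<le> c\<close> by linarith
    then show ?thesis by (auto simp: S_def mem_box abs_le_iff minus_le_iff)
  qed
  have "continuous_on UNIV (\<lambda>z. (norm (G z))\<^sup>2)" using cont by (intro continuous_intros)
  note c2 = this
  have "integrable lborel (\<lambda>z. (norm (G z))\<^sup>2)"
    by (rule integrable_compact_support[OF c2, where R=R]) (use supp in auto)
  from has_integral_integral_lborel[OF this]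
  have "((\<lambda>z. (norm (G z))\<^sup>2) has_integral 0) UNIV" using zero by simp
  also have "(\<lambda>z. (norm (G z))\<^sup>2) = (\<lambda>z. if z \<in> S then (norm (G z))\<^sup>2 else 0)"
  proof
    fix y show "(norm (G y))\<^sup>2 = (if y \<in> S then (norm (G y))\<^sup>2 else 0)"
    proof (cases "norm y \<le> c")
      case False
      then have "norm y > R" using norm_ge_zero[of z] unfolding c_def by linarith
      then show ?thesis using supp by simp
    qed (use inS in simp)
  qed
  finally have "((\<lambda>z. (norm (G z))\<^sup>2) has_integral 0) S" by (simp add: has_integral_restrict_UNIV)
  then have "(norm (G z))\<^sup>2 = 0"
    unfolding S_def
  proof (rule has_integral_0_cbox_imp_0[rotated 2])
    show "continuous_on (cbox (- c *\<^sub>R One) (c *\<^sub>R One)) (\<lambda>z. (norm (G z))\<^sup>2)"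
      using c2 by (rule continuous_on_subset) auto
    have "c > 0" using norm_ge_zero[of z] unfolding c_def by linarith
    then show "box (- c *\<^sub>R One) (c *\<^sub>R One :: 'b) \<noteq> {}" by (auto simp: box_ne_empty)
    show "z \<in> cbox (- c *\<^sub>R One) (c *\<^sub>R One)" using inS[of z] by (simp add: S_def c_def)
  qed auto
  then show ?thesis by simp
qed

text \<open>
  The real trigonometric sums form an algebra by the product-to-sum formulas; an inductive definition by generators
  and sums lets each closure property be proved by rule induction.
\<close>

inductive_set trig_sums :: "('b::euclidean_space \<Rightarrow> real) set" where
  cos: "(\<lambda>z. c * cos (\<xi> \<bullet> z)) \<in> trig_sums"
| sin: "(\<lambda>z. c * sin (\<xi> \<bullet> z)) \<in> trig_sums"
| add: "f \<in> trig_sums \<Longrightarrow> g \<in> trig_sums \<Longrightarrow> (\<lambda>z. f z + g z) \<in> trig_sums"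

lemma trig_sums_mult_cos: "f \<in> trig_sums \<Longrightarrow> (\<lambda>z. f z * (d * cos (\<eta> \<bullet> z))) \<in> trig_sums"
proof (induction rule: trig_sums.induct)
  case (cos c \<xi>)
  have "(\<lambda>z. c * cos (\<xi> \<bullet> z) * (d * cos (\<eta> \<bullet> z))) =
     (\<lambda>z. (c * d / 2) * cos ((\<xi> - \<eta>) \<bullet> z) + (c * d / 2) * cos ((\<xi> + \<eta>) \<bullet> z))"
    by (simp add: fun_eq_iff inner_diff_left inner_add_left cos_add cos_diff algebra_simps)
  then show ?case by (simp only:) (intro trig_sums.intros)
next
  case (sin c \<xi>)
  have "(\<lambda>z. c * sin (\<xi> \<bullet> z) * (d * cos (\<eta> \<bullet> z))) =
     (\<lambda>z. (c * d / 2) * sin ((\<xi> - \<eta>) \<bullet> z) + (c * d / 2) * sin ((\<xi> + \<eta>) \<bullet> z))"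
    by (simp add: fun_eq_iff inner_diff_left inner_add_left sin_add sin_diff algebra_simps)
  then show ?case by (simp only:) (intro trig_sums.intros)
next
  case (add f g)
  then show ?case using trig_sums.add[OF add.IH] by (simp add: distrib_right)
qed

lemma trig_sums_mult_sin: "f \<in> trig_sums \<Longrightarrow> (\<lambda>z. f z * (d * sin (\<eta> \<bullet> z))) \<in> trig_sums"
proof (induction rule: trig_sums.induct)
  case (cos c \<xi>)
  have "(\<lambda>z. c * cos (\<xi> \<bullet> z) * (d * sin (\<eta> \<bullet> z))) =
     (\<lambda>z. (c * d / 2) * sin ((\<xi> + \<eta>) \<bullet> z) + (- c * d / 2) * sin ((\<xi> - \<eta>) \<bullet> z))"
    by (simp add: fun_eq_iff inner_diff_left inner_add_left sin_add sin_diff algebra_simps)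
  then show ?case by (simp only:) (intro trig_sums.intros)
next
  case (sin c \<xi>)
  have "(\<lambda>z. c * sin (\<xi> \<bullet> z) * (d * sin (\<eta> \<bullet> z))) =
     (\<lambda>z. (c * d / 2) * cos ((\<xi> - \<eta>) \<bullet> z) + (- c * d / 2) * cos ((\<xi> + \<eta>) \<bullet> z))"
    by (simp add: fun_eq_iff inner_diff_left inner_add_left cos_add cos_diff algebra_simps)
  then show ?case by (simp only:) (intro trig_sums.intros)
next
  case (add f g)
  then show ?case using trig_sums.add[OF add.IH] by (simp add: distrib_right)
qed

lemma trig_sums_mult:
  assumes "f \<in> trig_sums"
  shows "g \<in> trig_sums \<Longrightarrow> (\<lambda>z. f z * g z) \<in> trig_sums"
proof (induction rule: trig_sums.induct)
  case (add g h)
  then show ?case using trig_sums.add[OF add.IH] by (simp add: distrib_left)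
qed (use assms trig_sums_mult_cos trig_sums_mult_sin in auto)

lemma trig_sums_continuous: "f \<in> trig_sums \<Longrightarrow> continuous_on S f"
  by (induction rule: trig_sums.induct) (auto intro!: continuous_intros)

text \<open>Points \<open>x\<close> and \<open>y\<close> are separated by the frequency for which their phases differ by \<open>pi\<close>.\<close>

lemma trig_sums_function_ring: "function_ring_on trig_sums (cball (0::'b::euclidean_space) R)"
proof
  show "(\<lambda>_::'b. c) \<in> trig_sums" for c using trig_sums.cos[of c 0] by simp
  show "\<exists>f\<in>trig_sums. f x \<noteq> f y" if "x \<noteq> y" for x y :: 'b
  proof -
    define \<xi> where "\<xi> = (pi / ((x - y) \<bullet> (x - y))) *\<^sub>R (x - y)"
    have "\<xi> \<bullet> (x - y) = pi" using that by (simp add: \<xi>_def)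
    then have x: "\<xi> \<bullet> x = \<xi> \<bullet> y + pi" by (simp add: inner_diff_right)
    show ?thesis
    proof (cases "cos (\<xi> \<bullet> y) = 0")
      case False
      then show ?thesis using x by (intro bexI[OF _ trig_sums.cos[of 1 \<xi>]]) auto
    next
      case True
      then have "sin (\<xi> \<bullet> y) \<noteq> 0" using sin_cos_squared_add[of "\<xi> \<bullet> y"] by auto
      then show ?thesis using x by (intro bexI[OF _ trig_sums.sin[of 1 \<xi>]]) auto
    qed
  qed
qed (auto intro: trig_sums_continuous trig_sums.add trig_sums_mult)

lemma fourier_uniqueness:
  fixes G :: "'b::euclidean_space \<Rightarrow> complex"
  assumes cont: "continuous_on UNIV G" and supp: "\<And>z. norm z > R \<Longrightarrow> G z = 0"
    and four: "\<And>\<xi>. (LINT z|lborel. G z * exp (- \<i> * of_real (\<xi> \<bullet> z))) = 0"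
  shows "G z = 0"
proof (rule orthogonal_to_dense_imp_eq_0[OF cont supp])
  interpret function_ring_on trig_sums "cball (0::'b) R" by (rule trig_sums_function_ring)
  show "\<exists>g\<in>trig_sums. \<forall>z\<in>cball 0 R. \<bar>f z - g z\<bar> < e" if "continuous_on (cball 0 R) f" "0 < e" for f :: "'b \<Rightarrow> real" and e
    using Stone_Weierstrass_basic[OF that] .
  have int: "integrable lborel (\<lambda>z. G z * f z)" if "continuous_on UNIV f" for f :: "'b \<Rightarrow> complex"
    by (rule integrable_compact_support[where R=R]) (use that cont supp in \<open>auto intro!: continuous_intros\<close>)
  have ic: "integrable lborel (\<lambda>z. G z * exp (- \<i> * of_real (\<xi> \<bullet> z)))" for \<xi>
    by (intro int continuous_intros)
  have four': "(LINT z|lborel. G z * exp (\<i> * of_real (\<xi> \<bullet> z))) = 0"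
    "integrable lborel (\<lambda>z. G z * exp (\<i> * of_real (\<xi> \<bullet> z)))" for \<xi>
    using four[of "-\<xi>"] ic[of "-\<xi>"] by simp_all
  show "(LINT z|lborel. of_real (g z) * G z) = 0" if "g \<in> trig_sums" for g
    using that
  proof (induction rule: trig_sums.induct)
    case (cos c \<xi>)
    have "(LINT z|lborel. of_real (c * cos (\<xi> \<bullet> z)) * G z)
      = (LINT z|lborel. (of_real c / 2) * (G z * exp (\<i> * of_real (\<xi> \<bullet> z)) + G z * exp (- \<i> * of_real (\<xi> \<bullet> z))))"
      by (intro Bochner_Integration.integral_cong refl)
         (simp add: cos_of_real[symmetric] cos_exp_eq field_simps)
    also have "\<dots> = 0"
      unfolding integral_mult_right_zero using four four' ic by (subst Bochner_Integration.integral_add) auto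
    finally show ?case .
  next
    case (sin c \<xi>)
    have "(LINT z|lborel. of_real (c * sin (\<xi> \<bullet> z)) * G z)
      = (LINT z|lborel. (of_real c / (2 * \<i>)) * (G z * exp (\<i> * of_real (\<xi> \<bullet> z)) - G z * exp (- \<i> * of_real (\<xi> \<bullet> z))))"
      by (intro Bochner_Integration.integral_cong refl)
         (simp add: sin_of_real[symmetric] sin_exp_eq field_simps)
    also have "\<dots> = 0"
      unfolding integral_mult_right_zero using four four' ic by (subst Bochner_Integration.integral_diff) auto
    finally show ?case .
  next
    case (add f g)
    have "integrable lborel (\<lambda>z. of_real (f z) * G z)" "integrable lborel (\<lambda>z. of_real (g z) * G z)"
      using int[of "\<lambda>z. of_real (f z)"] int[of "\<lambda>z. of_real (g z)"] add.hyps
      by (auto intro!: continuous_intros trig_sums_continuous simp: mult.commute)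
    then show ?case using add.IH by (simp add: distrib_right)
  qed
qed (use supp in \<open>auto intro: trig_sums_continuous\<close>)

lemma moments_uniqueness:
  fixes f :: "real \<Rightarrow> complex"
  assumes cont: "continuous_on UNIV f" and supp: "\<And>s. \<bar>s\<bar> > c \<Longrightarrow> f s = 0"
    and mom: "\<And>k. (LINT s|lborel. of_real (s ^ k) * f s) = 0"
  shows "f s = 0"
proof (rule orthogonal_to_dense_imp_eq_0[OF cont, of c])
  show "\<exists>g\<in>Collect real_polynomial_function. \<forall>z\<in>cball 0 c. \<bar>h z - g z\<bar> < e"
    if h: "continuous_on (cball 0 c) h" "0 < e" for h :: "real \<Rightarrow> real" and e
    using Stone_Weierstrass_real_polynomial_function[OF compact_cball h] by (metis mem_Collect_eq)
  show "continuous_on UNIV g" if "g \<in> Collect real_polynomial_function" for g :: "real \<Rightarrow> real"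
    using that continuous_on_polymonial_function real_polynomial_function_eq by auto
  show "(LINT z|lborel. of_real (g z) * f z) = 0" if "g \<in> Collect real_polynomial_function" for g
  proof -
    obtain a n where g: "g = (\<lambda>x. \<Sum>i\<le>n. a i * x ^ i)"
      using \<open>g \<in> _\<close> by (auto simp: real_polynomial_function_iff_sum)
    have int: "integrable lborel (\<lambda>s. of_real (s ^ k) * f s)" for k
      by (rule integrable_compact_support[where R=c]) (use cont supp in \<open>auto intro!: continuous_intros\<close>)
    have "(LINT z|lborel. of_real (g z) * f z) = (LINT z|lborel. (\<Sum>i\<le>n. of_real (a i) * (of_real (z ^ i) * f z)))"
      by (simp add: g sum_distrib_right mult.assoc)
    also have "\<dots> = (\<Sum>i\<le>n. of_real (a i) * (LINT z|lborel. of_real (z ^ i) * f z))"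
      using int by (subst Bochner_Integration.integral_sum) auto
    finally show ?thesis using mom by simp
  qed
qed (use supp in auto)

section \<open>Smooth functions and directional derivatives\<close>

abbreviation ddir :: "('a::euclidean_space \<Rightarrow> complex) \<Rightarrow> 'a \<Rightarrow> 'a \<Rightarrow> complex" where
  "ddir f v p \<equiv> frechet_derivative f (at p) v"

lemma C_infinity_has_derivative: "C_infinity f \<Longrightarrow> (f has_derivative frechet_derivative f (at p)) (at p)"
  unfolding C_infinity_def using frechet_derivative_works by (metis C_k.simps(2))

lemma C_infinity_ddir: "C_infinity f \<Longrightarrow> C_infinity (ddir f v)"
  unfolding C_infinity_def using C_k.simps(2) by blast

lemma C_infinity_continuous: "C_infinity f \<Longrightarrow> continuous_on UNIV f"
  unfolding C_infinity_def using C_k.simps(1) by blast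

text \<open>One derivative suffices: all further derivatives are derivatives of the given smooth functions.\<close>

lemma C_infinityI:
  assumes der: "\<And>p. (f has_derivative f' p) (at p)" and smooth: "\<And>v. C_infinity (\<lambda>p. f' p v)"
  shows "C_infinity f"
  unfolding C_infinity_def
proof
  fix k
  have fr: "frechet_derivative f (at p) = f' p" for p
    using frechet_derivative_at[OF der] by simp
  show "C_k k f"
  proof (cases k)
    case 0
    then show ?thesis using has_derivative_continuous_on[of UNIV f f'] der by simp
  next
    case (Suc l)
    have "f differentiable (at p)" for p using der by (auto simp: differentiable_def)
    then show ?thesis using smooth unfolding Suc C_infinity_def by (simp add: fr)
  qed
qed

lemma C_k_add: "C_k k f \<Longrightarrow> C_k k g \<Longrightarrow> C_k k (\<lambda>p. f p + g p :: 'b::real_normed_vector)"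
proof (induction k arbitrary: f g)
  case (Suc k)
  have "((\<lambda>p. f p + g p) has_derivative (\<lambda>v. frechet_derivative f (at p) v + frechet_derivative g (at p) v)) (at p)" for p
    using Suc.prems by (intro has_derivative_add) (auto simp: frechet_derivative_works[symmetric])
  moreover from frechet_derivative_at[OF this]
  have "frechet_derivative (\<lambda>p. f p + g p) (at p) = (\<lambda>v. frechet_derivative f (at p) v + frechet_derivative g (at p) v)" for p
    by simp
  ultimately show ?case using Suc by (auto simp: differentiable_def)
qed (auto intro: continuous_on_add)

lemma C_k_mult_left: "C_k k f \<Longrightarrow> C_k k (\<lambda>p. c * f p :: complex)"
proof (induction k arbitrary: f)
  case (Suc k)
  have "((\<lambda>p. c * f p) has_derivative (\<lambda>v. c * frechet_derivative f (at p) v)) (at p)" for p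
    using Suc.prems by (intro has_derivative_mult_right) (auto simp: frechet_derivative_works[symmetric])
  moreover from frechet_derivative_at[OF this]
  have "frechet_derivative (\<lambda>p. c * f p) (at p) = (\<lambda>v. c * frechet_derivative f (at p) v)" for p
    by simp
  ultimately show ?case using Suc by (auto simp: differentiable_def)
qed (auto intro: continuous_on_mult_left)

lemma C_k_zero: "C_k k (\<lambda>p::'a::euclidean_space. 0 :: 'b::real_normed_vector)"
proof (induction k)
  case (Suc k)
  have "frechet_derivative (\<lambda>p::'a. 0::'b) (at p) = (\<lambda>v. 0)" for p
    using frechet_derivative_at[of "\<lambda>p::'a. 0::'b" "\<lambda>v. 0" p] by simp
  then show ?case using Suc by simp
qed simp

lemma C_infinity_add: "C_infinity f \<Longrightarrow> C_infinity g \<Longrightarrow> C_infinity (\<lambda>p. f p + g p)"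
  by (simp add: C_infinity_def C_k_add)

lemma C_infinity_mult_left: "C_infinity f \<Longrightarrow> C_infinity (\<lambda>p. c * f p :: complex)"
  by (simp add: C_infinity_def C_k_mult_left)

lemma C_infinity_diff: "C_infinity f \<Longrightarrow> C_infinity g \<Longrightarrow> C_infinity (\<lambda>p. f p - g p :: complex)"
  using C_infinity_add[of f "\<lambda>p. (-1) * g p"] C_infinity_mult_left[of g "-1"] by simp

lemma C_infinity_sum: "finite I \<Longrightarrow> (\<And>i. i \<in> I \<Longrightarrow> C_infinity (f i)) \<Longrightarrow> C_infinity (\<lambda>p. \<Sum>i\<in>I. f i p)"
proof (induction I rule: finite_induct)
  case empty
  then show ?case by (simp add: C_infinity_def C_k_zero)
qed (auto intro: C_infinity_add)

lemma has_vector_derivative_along_curve: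
  assumes f: "(f has_derivative f') (at (\<gamma> s))" and \<gamma>: "(\<gamma> has_vector_derivative \<gamma>') (at s within S)"
  shows "((\<lambda>s. f (\<gamma> s)) has_vector_derivative f' \<gamma>') (at s within S)"
proof -
  have "((\<lambda>s. f (\<gamma> s)) has_derivative (\<lambda>h. f' (h *\<^sub>R \<gamma>'))) (at s within S)"
    using has_derivative_in_compose[OF \<gamma>[unfolded has_vector_derivative_def] has_derivative_at_withinI[OF f]] .
  also have "(\<lambda>h. f' (h *\<^sub>R \<gamma>')) = (\<lambda>h. h *\<^sub>R f' \<gamma>')"
    using linear_scale[OF has_derivative_linear[OF f]] by auto
  finally show ?thesis by (simp add: has_vector_derivative_def)
qed

lemma ddir_along_curve:
  assumes "C_infinity f" "(\<gamma> has_vector_derivative \<gamma>') (at s within S)"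
  shows "((\<lambda>s. f (\<gamma> s)) has_vector_derivative ddir f \<gamma>' (\<gamma> s)) (at s within S)"
  by (rule has_vector_derivative_along_curve[OF C_infinity_has_derivative[OF assms(1)] assms(2)])

lemma ddir_linear: "C_infinity f \<Longrightarrow> linear (\<lambda>v. ddir f v p)"
  using has_derivative_linear[OF C_infinity_has_derivative] .

lemma ddir_eq_0_outside:
  fixes f :: "real \<times> 'b::euclidean_space \<Rightarrow> complex"
  assumes "\<And>t x. norm x > R \<Longrightarrow> f (t, x) = 0" and "norm x > R"
  shows "ddir f v (t, x) = 0"
proof -
  have "open {p::real \<times> 'b. norm (snd p) > R}"
    by (intro open_Collect_less continuous_intros)
  then have "(f has_derivative (\<lambda>v. 0)) (at (t, x))"
    using has_derivative_transform_within_open[of "\<lambda>_. 0" "\<lambda>_. 0" "(t, x)" UNIV "{p. norm (snd p) > R}" f] assms by auto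
  from frechet_derivative_at[OF this] show ?thesis by metis
qed

section \<open>Injectivity of the scalar light ray transform\<close>

lemma ray_leaves_ball:
  fixes x \<omega> :: "'b::euclidean_space"
  assumes "norm \<omega> = 1" "\<bar>s\<bar> > norm x + R"
  shows "norm (x + s *\<^sub>R \<omega>) > R"
  using norm_triangle_ineq2[of "s *\<^sub>R \<omega>" "- x"] assms by (simp add: add.commute)

text \<open>
  The only dependence of the ray integral on its direction is through \<open>y + s \<omega>\<close>, so turning \<open>\<omega>\<close> towards \<open>v\<close>
  differentiates the integrand in direction \<open>v\<close> and multiplies it by \<open>s\<close>: this raises the order of the moment by one.
\<close>

lemma ray_integral_moment_rotate:
  fixes B :: "real \<times> 'b::euclidean_space \<Rightarrow> complex"
  assumes sm: "C_infinity B" and supp: "\<And>t x. norm x > R \<Longrightarrow> B (t, x) = 0"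
    and v: "norm v = 1" "v \<bullet> \<omega> = 0" and \<omega>: "norm \<omega> = 1"
    and mom: "\<And>\<omega>. norm \<omega> = 1 \<Longrightarrow> (LINT s|lborel. of_real (s ^ k) * B (t + s, y + s *\<^sub>R \<omega>)) = 0"
    and c: "c \<ge> norm y + R"
  shows "integral {-c..c} (\<lambda>s. of_real (s ^ Suc k) * ddir B (0, v) (t + s, y + s *\<^sub>R \<omega>)) = 0"
proof -
  define W where "W = (\<lambda>\<epsilon>. cos \<epsilon> *\<^sub>R \<omega> + sin \<epsilon> *\<^sub>R v)"
  define F where "F = (\<lambda>\<epsilon> s. of_real (s ^ k) * B (t + s, y + s *\<^sub>R W \<epsilon>))"
  define F' where "F' = (\<lambda>\<epsilon> s. of_real (s ^ Suc k) *
      (of_real (- sin \<epsilon>) * ddir B (0, \<omega>) (t + s, y + s *\<^sub>R W \<epsilon>) + of_real (cos \<epsilon>) * ddir B (0, v) (t + s, y + s *\<^sub>R W \<epsilon>)))"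
  have Wn: "norm (W \<epsilon>) = 1" for \<epsilon>
  proof -
    have "W \<epsilon> \<bullet> W \<epsilon> = (cos \<epsilon>)\<^sup>2 * (\<omega> \<bullet> \<omega>) + (sin \<epsilon>)\<^sup>2 * (v \<bullet> v)"
      using v by (simp add: W_def inner_add_left inner_add_right inner_commute[of \<omega> v] power2_eq_square)
    also have "\<dots> = 1" using v(1) \<omega> by (simp add: dot_square_norm)
    finally show ?thesis by (simp add: norm_eq_sqrt_inner)
  qed
  have curve: "continuous_on UNIV (\<lambda>q::real \<times> real. (t + snd q, y + snd q *\<^sub>R W (fst q)))"
    unfolding W_def by (intro continuous_intros)
  have comp: "continuous_on UNIV (\<lambda>q::real \<times> real. f (t + snd q, y + snd q *\<^sub>R W (fst q)))" if "continuous_on UNIV f" for f :: "real \<times> 'b \<Rightarrow> complex"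
    by (rule continuous_on_compose2[OF that curve]) auto
  have "((\<lambda>\<epsilon>. integral (cbox (-c) c) (F \<epsilon>)) has_vector_derivative integral (cbox (-c) c) (F' 0)) (at 0 within UNIV)"
  proof (rule leibniz_rule_vector_derivative)
    fix \<epsilon> s :: real
    have "((\<lambda>\<epsilon>. (t + s, y + s *\<^sub>R W \<epsilon>)) has_vector_derivative (0, s *\<^sub>R (- sin \<epsilon> *\<^sub>R \<omega> + cos \<epsilon> *\<^sub>R v))) (at \<epsilon>)"
      unfolding W_def by (auto intro!: derivative_eq_intros has_vector_derivative_Pair)
    from ddir_along_curve[OF sm this]
    have "((\<lambda>\<epsilon>. B (t + s, y + s *\<^sub>R W \<epsilon>)) has_vector_derivative
       ddir B (0, s *\<^sub>R (- sin \<epsilon> *\<^sub>R \<omega> + cos \<epsilon> *\<^sub>R v)) (t + s, y + s *\<^sub>R W \<epsilon>)) (at \<epsilon>)" .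
    also have "(0::real, s *\<^sub>R (- sin \<epsilon> *\<^sub>R \<omega> + cos \<epsilon> *\<^sub>R v)) = s *\<^sub>R ((- sin \<epsilon>) *\<^sub>R (0, \<omega>) + cos \<epsilon> *\<^sub>R (0, v))"
      by simp
    also have "ddir B (s *\<^sub>R ((- sin \<epsilon>) *\<^sub>R (0, \<omega>) + cos \<epsilon> *\<^sub>R (0, v))) (t + s, y + s *\<^sub>R W \<epsilon>)
      = s *\<^sub>R ((- sin \<epsilon>) *\<^sub>R ddir B (0, \<omega>) (t + s, y + s *\<^sub>R W \<epsilon>) + cos \<epsilon> *\<^sub>R ddir B (0, v) (t + s, y + s *\<^sub>R W \<epsilon>))"
      using ddir_linear[OF sm] by (simp only: linear_scale linear_add)
    finally have "((\<lambda>\<epsilon>. of_real (s ^ k) * B (t + s, y + s *\<^sub>R W \<epsilon>)) has_vector_derivative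
       of_real (s ^ k) * (s *\<^sub>R ((- sin \<epsilon>) *\<^sub>R ddir B (0, \<omega>) (t + s, y + s *\<^sub>R W \<epsilon>) + cos \<epsilon> *\<^sub>R ddir B (0, v) (t + s, y + s *\<^sub>R W \<epsilon>)))) (at \<epsilon>)"
      by (rule has_vector_derivative_mult_right)
    then show "((\<lambda>\<epsilon>. F \<epsilon> s) has_vector_derivative F' \<epsilon> s) (at \<epsilon> within UNIV)"
      by (simp add: F_def F'_def scaleR_conv_of_real mult_ac)
  next
    show "F \<epsilon> integrable_on cbox (-c) c" for \<epsilon>
      unfolding F_def
      by (intro integrable_continuous continuous_intros continuous_on_compose2[OF C_infinity_continuous[OF sm]]) auto
    show "continuous_on (UNIV \<times> cbox (-c) c) (\<lambda>(\<epsilon>, s). F' \<epsilon> s)"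
      unfolding F'_def case_prod_unfold
      by (intro continuous_intros continuous_on_subset[OF comp] C_infinity_continuous C_infinity_ddir sm) auto
  qed auto
  moreover have "integral (cbox (-c) c) (F \<epsilon>) = 0" for \<epsilon>
  proof -
    have "(LINT s|lborel. F \<epsilon> s) = integral {-c..c} (F \<epsilon>)"
    proof (rule lborel_integral_compact_support)
      show "continuous_on UNIV (F \<epsilon>)"
        unfolding F_def
        by (intro continuous_intros continuous_on_compose2[OF C_infinity_continuous[OF sm]]) auto
      show "F \<epsilon> s = 0" if "\<bar>s\<bar> > c" for s
        using supp[OF ray_leaves_ball[OF Wn]] that c by (simp add: F_def)
    qed
    then show ?thesis using mom[OF Wn] by (simp add: F_def)
  qed
  ultimately have "((\<lambda>\<epsilon>::real. 0) has_vector_derivative integral (cbox (-c) c) (F' 0)) (at 0)" by simp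
  then have "integral (cbox (-c) c) (F' 0) = 0"
    using vector_derivative_unique_at has_vector_derivative_const by blast
  then show ?thesis by (simp add: F'_def W_def)
qed

text \<open>
  By the previous lemma the next moment, as a function of the base point \<open>x\<close>, has derivative zero in the direction
  \<open>v\<close> orthogonal to the ray. It vanishes when the base point has been moved so far along \<open>v\<close> that the ray misses the
  support, so it vanishes everywhere.
\<close>

lemma ray_moments_vanish:
  fixes B :: "real \<times> 'b::euclidean_space \<Rightarrow> complex"
  assumes dim: "DIM('b) \<ge> 2" and sm: "C_infinity B" and supp: "\<And>t x. norm x > R \<Longrightarrow> B (t, x) = 0" and R: "R \<ge> 0"
    and ray: "\<And>t x \<omega>. norm \<omega> = 1 \<Longrightarrow> (LINT s|lborel. B (t + s, x + s *\<^sub>R \<omega>)) = 0"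
    and \<omega>: "norm \<omega> = 1"
  shows "(LINT s|lborel. of_real (s ^ k) * B (t + s, x + s *\<^sub>R \<omega>)) = 0"
  using \<omega>
proof (induction k arbitrary: t x \<omega>)
  case 0
  then show ?case using ray by simp
next
  case (Suc k)
  note \<omega> = Suc.prems
  obtain v0 where v0: "v0 \<noteq> 0" "orthogonal \<omega> v0"
    using orthogonal_to_vector_exists[OF dim] by blast
  define v where "v = v0 /\<^sub>R norm v0"
  have v: "norm v = 1" "v \<bullet> \<omega> = 0" using v0 by (auto simp: v_def orthogonal_def inner_commute)
  \<comment> \<open>At distance \<open>r1\<close> along \<open>v\<close> the ray has left the support; the window \<open>[-c, c]\<close> contains the support of all
    rays met on the way.\<close>
  define r1 where "r1 = norm x + R + 1"
  define c where "c = norm x + r1 + R"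
  define m where "m = (\<lambda>r s. of_real (s ^ Suc k) * B (t + s, x + r *\<^sub>R v + s *\<^sub>R \<omega>))"
  define m' where "m' = (\<lambda>r s. of_real (s ^ Suc k) * ddir B (0, v) (t + s, x + r *\<^sub>R v + s *\<^sub>R \<omega>))"
  have r1: "r1 > 0" using R by (simp add: r1_def add_nonneg_pos)
  have cont: "continuous_on UNIV B" "continuous_on UNIV (ddir B (0, v))"
    by (intro C_infinity_continuous C_infinity_ddir sm)+
  have der: "((\<lambda>r. integral (cbox (-c) c) (m r)) has_vector_derivative 0) (at r within {0..r1})" if r: "r \<in> {0..r1}" for r
  proof -
    have "((\<lambda>r. integral (cbox (-c) c) (m r)) has_vector_derivative integral (cbox (-c) c) (m' r)) (at r within {0..r1})"
    proof (rule leibniz_rule_vector_derivative)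
      fix r s
      have "((\<lambda>r. (t + s, x + r *\<^sub>R v + s *\<^sub>R \<omega>)) has_vector_derivative (0, v)) (at r within {0..r1})"
        by (auto intro!: derivative_eq_intros has_vector_derivative_Pair)
      from has_vector_derivative_mult_right[OF ddir_along_curve[OF sm this]]
      show "((\<lambda>r. m r s) has_vector_derivative m' r s) (at r within {0..r1})" by (simp add: m_def m'_def)
    next
      show "m r integrable_on cbox (-c) c" for r
        unfolding m_def by (intro integrable_continuous continuous_intros continuous_on_compose2[OF cont(1)]) auto
      show "continuous_on ({0..r1} \<times> cbox (-c) c) (\<lambda>(r, s). m' r s)"
        unfolding m'_def case_prod_unfold by (intro continuous_intros continuous_on_compose2[OF cont(2)]) auto
    qed (use r in auto)
    moreover have "integral (cbox (-c) c) (m' r) = 0"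
    proof -
      have "norm (x + r *\<^sub>R v) \<le> norm x + r1" using norm_triangle_ineq[of x "r *\<^sub>R v"] v r by simp
      then have "c \<ge> norm (x + r *\<^sub>R v) + R" by (simp add: c_def)
      from ray_integral_moment_rotate[OF sm supp v \<omega> Suc.IH this] show ?thesis by (simp add: m'_def)
    qed
    ultimately show ?thesis by simp
  qed
  have "\<exists>d. \<forall>r\<in>{0..r1}. integral (cbox (-c) c) (m r) = d"
    using has_vector_derivative_zero_constant[of "{0..r1}" "\<lambda>r. integral (cbox (-c) c) (m r)"] der by (metis convex_real_interval(5))
  then have "integral (cbox (-c) c) (m 0) = integral (cbox (-c) c) (m r1)" using r1 by auto
  also have "m r1 = (\<lambda>s. 0)"
  proof
    fix s
    have "norm (x + r1 *\<^sub>R v + s *\<^sub>R \<omega>) \<ge> (x + r1 *\<^sub>R v + s *\<^sub>R \<omega>) \<bullet> v"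
      using norm_cauchy_schwarz[of "x + r1 *\<^sub>R v + s *\<^sub>R \<omega>" v] v by simp
    also have "(x + r1 *\<^sub>R v + s *\<^sub>R \<omega>) \<bullet> v = x \<bullet> v + r1"
      using v by (simp add: inner_add_left inner_commute[of \<omega> v] dot_square_norm)
    finally have "norm (x + r1 *\<^sub>R v + s *\<^sub>R \<omega>) > R"
      using Cauchy_Schwarz_ineq2[of x v] v by (simp add: r1_def)
    then show "m r1 s = 0" using supp by (simp add: m_def)
  qed
  finally have "integral {-c..c} (m 0) = 0" by simp
  moreover have "(LINT s|lborel. m 0 s) = integral {-c..c} (m 0)"
  proof (rule lborel_integral_compact_support)
    show "continuous_on UNIV (m 0)"
      unfolding m_def by (intro continuous_intros continuous_on_compose2[OF cont(1)]) auto
    show "m 0 s = 0" if "\<bar>s\<bar> > c" for s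
      using supp[OF ray_leaves_ball[OF \<omega>]] that r1 by (simp add: m_def c_def)
  qed
  ultimately show ?case by (simp add: m_def)
qed

lemma scalar_ray_transform_injective:
  fixes B :: "real \<times> 'b::euclidean_space \<Rightarrow> complex"
  assumes dim: "DIM('b) \<ge> 2" and sm: "C_infinity B" and supp: "\<And>t x. norm x > R \<Longrightarrow> B (t, x) = 0" and R: "R \<ge> 0"
    and ray: "\<And>t x \<omega>. norm \<omega> = 1 \<Longrightarrow> (LINT s|lborel. B (t + s, x + s *\<^sub>R \<omega>)) = 0"
  shows "B (t, x) = 0"
proof -
  obtain \<omega> :: 'b where \<omega>: "norm \<omega> = 1" using vector_choose_size[of 1] by auto
  have "B (t + 0, x + 0 *\<^sub>R \<omega>) = 0"
  proof (rule moments_uniqueness)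
    show "continuous_on UNIV (\<lambda>s. B (t + s, x + s *\<^sub>R \<omega>))"
      by (intro continuous_intros continuous_on_compose2[OF C_infinity_continuous[OF sm]]) auto
    show "B (t + s, x + s *\<^sub>R \<omega>) = 0" if "\<bar>s\<bar> > norm x + R" for s
      using supp[OF ray_leaves_ball[OF \<omega> that]] .
    show "(LINT s|lborel. of_real (s ^ k) * B (t + s, x + s *\<^sub>R \<omega>)) = 0" for k
      by (rule ray_moments_vanish[OF dim sm supp R ray \<omega>])
  qed
  then show ?thesis by simp
qed

section \<open>The Poincare lemma\<close>

text \<open>
  The radial potential. Differentiating under the integral and using closedness, the integrand of the derivative in
  direction \<open>v\<close> becomes \<open>\<alpha> v (r p) + r d/dr (\<alpha> v (r p))\<close>, which is the derivative in \<open>r\<close> of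
  \<open>r \<alpha> v (r p)\<close>.
\<close>

lemma poincare:
  fixes \<alpha> :: "'e::euclidean_space \<Rightarrow> 'e \<Rightarrow> complex"
  assumes lin: "\<And>p. linear (\<lambda>v. \<alpha> v p)" and sm: "\<And>v. C_infinity (\<alpha> v)"
    and closed: "\<And>u v p. ddir (\<alpha> u) v p = ddir (\<alpha> v) u p"
  shows "((\<lambda>p. integral {0..1} (\<lambda>r. \<alpha> p (r *\<^sub>R p))) has_derivative (\<lambda>v. \<alpha> v p)) (at p)"
proof -
  have expand: "\<alpha> v q = (\<Sum>b\<in>Basis. (v \<bullet> b) *\<^sub>R \<alpha> b q)" for v q
  proof -
    have "\<alpha> v q = \<alpha> (\<Sum>b\<in>Basis. (v \<bullet> b) *\<^sub>R b) q" by (simp add: euclidean_representation)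
    also have "\<dots> = (\<Sum>b\<in>Basis. (v \<bullet> b) *\<^sub>R \<alpha> b q)"
      by (simp only: linear_sum[OF lin] linear_scale[OF lin])
    finally show ?thesis .
  qed
  have ddir_expand: "ddir (\<alpha> v) u q = (\<Sum>b\<in>Basis. (v \<bullet> b) *\<^sub>R ddir (\<alpha> b) u q)" for v u q
  proof -
    have "((\<lambda>q. \<Sum>b\<in>Basis. (v \<bullet> b) *\<^sub>R \<alpha> b q) has_derivative (\<lambda>u. \<Sum>b\<in>Basis. (v \<bullet> b) *\<^sub>R ddir (\<alpha> b) u q)) (at q)"
      by (intro has_derivative_sum has_derivative_scaleR_right C_infinity_has_derivative sm)
    then have "(\<alpha> v has_derivative (\<lambda>u. \<Sum>b\<in>Basis. (v \<bullet> b) *\<^sub>R ddir (\<alpha> b) u q)) (at q)"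
      by (simp add: expand[of v, symmetric])
    from frechet_derivative_at[OF this] show ?thesis by metis
  qed
  have ca: "continuous_on UNIV (\<alpha> b)" "continuous_on UNIV (ddir (\<alpha> b) c)" for b c
    by (intro C_infinity_continuous C_infinity_ddir sm)+
  define G where "G = (\<lambda>p r. Blinfun (\<lambda>v. \<alpha> v (r *\<^sub>R p) + r *\<^sub>R ddir (\<alpha> v) p (r *\<^sub>R p)))"
  have blG: "bounded_linear (\<lambda>v. \<alpha> v (r *\<^sub>R p) + r *\<^sub>R ddir (\<alpha> v) p (r *\<^sub>R p))" for r :: real and p
    unfolding linear_conv_bounded_linear[symmetric]
  proof (intro linear_compose_add linear_compose_scale_right lin)
    show "linear (\<lambda>v. ddir (\<alpha> v) p (r *\<^sub>R p))"
      unfolding closed[where v=p] by (rule ddir_linear[OF sm])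
  qed
  have G: "blinfun_apply (G p r) v = \<alpha> v (r *\<^sub>R p) + r *\<^sub>R ddir (\<alpha> v) p (r *\<^sub>R p)" for p r v
    unfolding G_def by (simp add: bounded_linear_Blinfun_apply[OF blG])
  have Gcont: "continuous_on (UNIV \<times> cbox 0 1) (\<lambda>(p, r). G p r)"
  proof (rule continuous_on_blinfun_componentwise)
    fix i :: 'e
    have "continuous_on (UNIV \<times> cbox 0 1) (\<lambda>q. \<alpha> i (snd q *\<^sub>R fst q) + snd q *\<^sub>R (\<Sum>b\<in>Basis. (fst q \<bullet> b) *\<^sub>R ddir (\<alpha> b) i (snd q *\<^sub>R fst q)))"
      by (intro continuous_intros continuous_on_compose2[OF ca(1)] continuous_on_compose2[OF ca(2)]) auto
    then show "continuous_on (UNIV \<times> cbox 0 1) (\<lambda>q. blinfun_apply (case q of (p, r) \<Rightarrow> G p r) i)"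
      by (simp add: case_prod_unfold G closed[where u=i] ddir_expand[symmetric])
  qed
  have "((\<lambda>p. integral (cbox 0 1) (\<lambda>r. \<alpha> p (r *\<^sub>R p))) has_derivative integral (cbox 0 1) (G p)) (at p within UNIV)"
  proof (rule leibniz_rule)
    fix p :: 'e and r :: real
    have "((\<lambda>p. \<Sum>b\<in>Basis. (p \<bullet> b) *\<^sub>R \<alpha> b (r *\<^sub>R p)) has_derivative
       (\<lambda>v. \<Sum>b\<in>Basis. (p \<bullet> b) *\<^sub>R ddir (\<alpha> b) (r *\<^sub>R v) (r *\<^sub>R p) + (v \<bullet> b) *\<^sub>R \<alpha> b (r *\<^sub>R p))) (at p)"
    proof (rule has_derivative_sum, rule has_derivative_scaleR)
      fix b
      show "((\<lambda>p. p \<bullet> b) has_derivative (\<lambda>v. v \<bullet> b)) (at p)" by (auto intro!: derivative_eq_intros)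
      have "((\<lambda>p. r *\<^sub>R p) has_derivative (\<lambda>v. r *\<^sub>R v)) (at p)" by (auto intro!: derivative_eq_intros)
      from has_derivative_compose[OF this C_infinity_has_derivative[OF sm]]
      show "((\<lambda>p. \<alpha> b (r *\<^sub>R p)) has_derivative (\<lambda>v. ddir (\<alpha> b) (r *\<^sub>R v) (r *\<^sub>R p))) (at p)" .
    qed
    also have "(\<lambda>v. \<Sum>b\<in>Basis. (p \<bullet> b) *\<^sub>R ddir (\<alpha> b) (r *\<^sub>R v) (r *\<^sub>R p) + (v \<bullet> b) *\<^sub>R \<alpha> b (r *\<^sub>R p)) = blinfun_apply (G p r)"
    proof
      fix v
      have "(\<Sum>b\<in>Basis. (p \<bullet> b) *\<^sub>R ddir (\<alpha> b) (r *\<^sub>R v) (r *\<^sub>R p)) = ddir (\<alpha> p) (r *\<^sub>R v) (r *\<^sub>R p)"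
        by (rule ddir_expand[symmetric])
      also have "\<dots> = r *\<^sub>R ddir (\<alpha> v) p (r *\<^sub>R p)"
        using linear_scale[OF ddir_linear[OF sm]] closed[where u=p and v=v] by simp
      finally show "(\<Sum>b\<in>Basis. (p \<bullet> b) *\<^sub>R ddir (\<alpha> b) (r *\<^sub>R v) (r *\<^sub>R p) + (v \<bullet> b) *\<^sub>R \<alpha> b (r *\<^sub>R p)) = blinfun_apply (G p r) v"
        by (simp add: sum.distrib G expand[of v, symmetric])
    qed
    finally show "((\<lambda>p. \<alpha> p (r *\<^sub>R p)) has_derivative blinfun_apply (G p r)) (at p within UNIV)"
      by (simp add: expand[symmetric])
  next
    fix p :: 'e
    have "continuous_on (cbox 0 1) (\<lambda>r. \<alpha> p (r *\<^sub>R p))"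
      by (intro continuous_intros continuous_on_compose2[OF ca(1)]) auto
    then show "(\<lambda>r. \<alpha> p (r *\<^sub>R p)) integrable_on cbox 0 1" by (rule integrable_continuous)
  qed (use Gcont in auto)
  moreover have val: "blinfun_apply (integral (cbox 0 1) (G p)) v = \<alpha> v p" for v
  proof -
    have "continuous_on (cbox 0 1) (\<lambda>r. case (p, r) of (p, r) \<Rightarrow> G p r)"
      by (rule continuous_on_compose2[OF Gcont]) (auto intro!: continuous_intros)
    then have "continuous_on (cbox 0 1) (G p)" by simp
    then have "blinfun_apply (integral (cbox 0 1) (G p)) v = integral (cbox 0 1) (\<lambda>r. blinfun_apply (G p r) v)"
      by (intro blinfun_apply_integral integrable_continuous)
    also have "\<dots> = integral {0..1} (\<lambda>r. \<alpha> v (r *\<^sub>R p) + r *\<^sub>R ddir (\<alpha> v) p (r *\<^sub>R p))"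
      by (simp add: G)
    also have "\<dots> = 1 *\<^sub>R \<alpha> v (1 *\<^sub>R p) - 0 *\<^sub>R \<alpha> v (0 *\<^sub>R p)"
    proof (rule integral_unique, rule fundamental_theorem_of_calculus)
      fix r :: real
      have "((\<lambda>r. r *\<^sub>R p) has_vector_derivative p) (at r within {0..1})"
        by (auto intro!: derivative_eq_intros)
      from has_vector_derivative_scaleR[OF DERIV_ident ddir_along_curve[OF sm this]]
      show "((\<lambda>r. r *\<^sub>R \<alpha> v (r *\<^sub>R p)) has_vector_derivative \<alpha> v (r *\<^sub>R p) + r *\<^sub>R ddir (\<alpha> v) p (r *\<^sub>R p)) (at r within {0..1})"
        by (simp add: add.commute)
    qed simp
    finally show ?thesis by simp
  qed
  then have "blinfun_apply (integral (cbox 0 1) (G p)) = (\<lambda>v. \<alpha> v p)" by auto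
  ultimately show ?thesis by simp
qed

section \<open>Forms with vanishing light ray integrals\<close>

lemma ray_integral_ddir:
  fixes f :: "real \<times> 'b::euclidean_space \<Rightarrow> complex"
  assumes sm: "C_infinity f" and supp: "\<And>t x. norm x > R \<Longrightarrow> f (t, x) = 0" and \<omega>: "norm \<omega> = 1"
    and ray: "\<And>t x. (LINT s|lborel. f (t + s, x + s *\<^sub>R \<omega>)) = 0"
  shows "(LINT s|lborel. ddir f (0, v) (t + s, x + s *\<^sub>R \<omega>)) = 0"
proof -
  define c where "c = norm x + norm v + R"
  have cont: "continuous_on UNIV f" "continuous_on UNIV (ddir f (0, v))"
    by (intro C_infinity_continuous C_infinity_ddir sm)+
  define F where "F = (\<lambda>r s. f (t + s, x + r *\<^sub>R v + s *\<^sub>R \<omega>))"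
  define F' where "F' = (\<lambda>r s. ddir f (0, v) (t + s, x + r *\<^sub>R v + s *\<^sub>R \<omega>))"
  have "((\<lambda>r. integral (cbox (-c) c) (F r)) has_vector_derivative integral (cbox (-c) c) (F' 0)) (at 0 within UNIV)"
  proof (rule leibniz_rule_vector_derivative)
    fix r s
    have "((\<lambda>r. (t + s, x + r *\<^sub>R v + s *\<^sub>R \<omega>)) has_vector_derivative (0, v)) (at r)"
      by (auto intro!: derivative_eq_intros has_vector_derivative_Pair)
    from ddir_along_curve[OF sm this]
    show "((\<lambda>r. F r s) has_vector_derivative F' r s) (at r within UNIV)" by (simp add: F_def F'_def)
  next
    show "F r integrable_on cbox (-c) c" for r
      unfolding F_def by (intro integrable_continuous continuous_intros continuous_on_compose2[OF cont(1)]) auto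
    show "continuous_on (UNIV \<times> cbox (-c) c) (\<lambda>(r, s). F' r s)"
      unfolding F'_def case_prod_unfold by (intro continuous_intros continuous_on_compose2[OF cont(2)]) auto
  qed auto
  then have d: "((\<lambda>r. integral {-c..c} (\<lambda>s. f (t + s, x + r *\<^sub>R v + s *\<^sub>R \<omega>))) has_vector_derivative
     integral {-c..c} (\<lambda>s. ddir f (0, v) (t + s, x + s *\<^sub>R \<omega>))) (at 0)"
    by (simp add: F_def F'_def)
  have z: "integral {-c..c} (\<lambda>s. f (t + s, x + r *\<^sub>R v + s *\<^sub>R \<omega>)) = 0" if r: "r \<in> {-1<..<1}" for r
  proof -
    have "norm (x + r *\<^sub>R v) \<le> norm x + \<bar>r\<bar> * norm v" using norm_triangle_ineq[of x "r *\<^sub>R v"] by simp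
    also have "\<dots> \<le> norm x + norm v" using r mult_right_mono[of "\<bar>r\<bar>" 1 "norm v"] by auto
    finally have c: "norm (x + r *\<^sub>R v) + R \<le> c" by (simp add: c_def)
    have "(LINT s|lborel. f (t + s, x + r *\<^sub>R v + s *\<^sub>R \<omega>)) = integral {-c..c} (\<lambda>s. f (t + s, x + r *\<^sub>R v + s *\<^sub>R \<omega>))"
    proof (rule lborel_integral_compact_support)
      show "continuous_on UNIV (\<lambda>s. f (t + s, x + r *\<^sub>R v + s *\<^sub>R \<omega>))"
        by (intro continuous_intros continuous_on_compose2[OF cont(1)]) auto
      show "f (t + s, x + r *\<^sub>R v + s *\<^sub>R \<omega>) = 0" if "\<bar>s\<bar> > c" for s
        using supp[OF ray_leaves_ball[OF \<omega>]] that c by simp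
    qed
    then show ?thesis using ray by simp
  qed
  have "((\<lambda>r. integral {-c..c} (\<lambda>s. f (t + s, x + r *\<^sub>R v + s *\<^sub>R \<omega>))) has_vector_derivative 0) (at 0)"
  proof (rule has_vector_derivative_transform_within_open)
    show "((\<lambda>_. 0) has_vector_derivative 0) (at (0::real))" by simp
    show "open {-1<..<1::real}" by simp
  qed (use z in auto)
  from vector_derivative_unique_at[OF d this]
  have "integral {-c..c} (\<lambda>s. ddir f (0, v) (t + s, x + s *\<^sub>R \<omega>)) = 0" .
  moreover have "(LINT s|lborel. ddir f (0, v) (t + s, x + s *\<^sub>R \<omega>)) = integral {-c..c} (\<lambda>s. ddir f (0, v) (t + s, x + s *\<^sub>R \<omega>))"
  proof (rule lborel_integral_compact_support)
    show "continuous_on UNIV (\<lambda>s. ddir f (0, v) (t + s, x + s *\<^sub>R \<omega>))"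
      by (intro continuous_intros continuous_on_compose2[OF cont(2)]) auto
    show "ddir f (0, v) (t + s, x + s *\<^sub>R \<omega>) = 0" if "\<bar>s\<bar> > c" for s
    proof (rule ddir_eq_0_outside[where R=R and f=f])
      have "\<bar>s\<bar> > norm x + R" using that norm_ge_zero[of v] unfolding c_def by linarith
      then show "norm (x + s *\<^sub>R \<omega>) > R" by (rule ray_leaves_ball[OF \<omega>])
    qed (rule supp)
  qed
  ultimately show ?thesis by simp
qed

text \<open>The hypotheses of the theorem, with the growth condition brought to a form that holds for all times and has an
  integral exponent.\<close>

locale ray_trivial_form =
  fixes A0 :: "real \<times> (real ^ 'n) \<Rightarrow> complex" and A :: "'n \<Rightarrow> real \<times> (real ^ 'n) \<Rightarrow> complex"
    and R K :: real and m :: nat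
  assumes dim: "CARD('n) \<ge> 2" and R: "R > 0"
    and smooth0: "C_infinity A0" and smooth: "C_infinity (A j)"
    and bounded0: "poly_bounded R m K A0" and bounded: "poly_bounded R m K (A j)"
    and null: "\<omega> \<in> sphere 0 1 \<Longrightarrow> (LBINT s. A0 (t + s, x + s *\<^sub>R \<omega>)
              + (\<Sum>j\<in>UNIV. complex_of_real (\<omega> $ j) * A j (t + s, x + s *\<^sub>R \<omega>))) = 0"
begin

text \<open>The value of the form \<open>A0 dt + \<Sum> A j dx\<^sub>j\<close> at the point \<open>p\<close> on the vector \<open>v\<close>. The vector is the
  first argument, so that \<open>form v\<close> is a function on space-time that can be differentiated.\<close>

definition form :: "real \<times> (real ^ 'n) \<Rightarrow> real \<times> (real ^ 'n) \<Rightarrow> complex" where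
  "form v p = of_real (fst v) * A0 p + (\<Sum>j\<in>UNIV. of_real (snd v $ j) * A j p)"

lemma form_smooth: "C_infinity (form v)"
  unfolding form_def
  by (intro C_infinity_add C_infinity_sum C_infinity_mult_left smooth0 smooth) simp

lemma form_linear: "linear (\<lambda>v. form v p)"
  unfolding form_def
  by (rule linearI) (simp_all add: distrib_left distrib_right sum.distrib sum_distrib_left scaleR_conv_of_real[where 'a=complex] mult_ac)

lemmas form_add = linear_add[OF form_linear] and form_scale = linear_scale[OF form_linear]

lemma form_supp: "norm x > R \<Longrightarrow> form v (t, x) = 0"
  using poly_boundedD(3)[OF bounded0] poly_boundedD(3)[OF bounded] by (simp add: form_def)

lemma ddir_form_supp: "norm x > R \<Longrightarrow> ddir (form u) v (t, x) = 0"
  by (rule ddir_eq_0_outside[where R=R and f="form u"]) (auto intro: form_supp)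

lemma ddir_form_linear: "linear (\<lambda>v. ddir (form v) u p)"
proof (rule linearI)
  show "ddir (form (v + w)) u p = ddir (form v) u p + ddir (form w) u p" for v w
  proof -
    have "(form (v + w) has_derivative (\<lambda>u. ddir (form v) u p + ddir (form w) u p)) (at p)"
      using has_derivative_add[OF C_infinity_has_derivative[OF form_smooth] C_infinity_has_derivative[OF form_smooth], of v w p]
      by (simp add: form_add[symmetric])
    from frechet_derivative_at[OF this] show ?thesis by metis
  qed
  show "ddir (form (c *\<^sub>R v)) u p = c *\<^sub>R ddir (form v) u p" for c v
  proof -
    have "(form (c *\<^sub>R v) has_derivative (\<lambda>u. c *\<^sub>R ddir (form v) u p)) (at p)"
      using has_derivative_scaleR_right[OF C_infinity_has_derivative[OF form_smooth], of c v p]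
      by (simp add: form_scale[symmetric])
    from frechet_derivative_at[OF this] show ?thesis by metis
  qed
qed

lemma form_null: "norm \<omega> = 1 \<Longrightarrow> (LINT s|lborel. form (1, \<omega>) (t + s, x + s *\<^sub>R \<omega>)) = 0"
  using null[of \<omega> t x] by (simp add: form_def)

lemma form_bounded:
  assumes "norm e \<le> 1"
  shows "poly_bounded R m ((1 + real CARD('n)) * K) (form (0, e))"
proof -
  have K: "K \<ge> 0" using poly_boundedD(5)[OF bounded0] .
  have "norm (form (0, e) (u, z)) \<le> (1 + real CARD('n)) * K * (1 + \<bar>u\<bar>) ^ m" for u z
  proof -
    have "norm (form (0, e) (u, z)) \<le> (\<Sum>j\<in>UNIV. norm (of_real (e $ j) * A j (u, z)))"
      unfolding form_def by (simp add: norm_sum)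
    also have "\<dots> \<le> (\<Sum>j\<in>(UNIV :: 'n set). 1 * (K * (1 + \<bar>u\<bar>) ^ m))"
    proof (intro sum_mono)
      fix j
      have "\<bar>e $ j\<bar> \<le> 1" using component_le_norm_cart[of e j] assms by linarith
      then show "norm (of_real (e $ j) * A j (u, z)) \<le> 1 * (K * (1 + \<bar>u\<bar>) ^ m)"
        unfolding norm_mult norm_of_real using poly_boundedD(2)[OF bounded] by (intro mult_mono) auto
    qed
    also have "\<dots> \<le> (1 + real CARD('n)) * K * (1 + \<bar>u\<bar>) ^ m"
      using K by (simp add: distrib_right)
    finally show ?thesis .
  qed
  then show ?thesis
    using form_supp C_infinity_continuous[OF form_smooth] by (simp add: poly_bounded_def)
qed

lemma form_time_bounded: "poly_bounded R m ((1 + real CARD('n)) * K) (form (1, 0))"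
proof -
  have K: "K \<ge> 0" using poly_boundedD(5)[OF bounded0] .
  have "form (1, 0) = A0" by (simp add: fun_eq_iff form_def)
  moreover have "norm (A0 (u, z)) \<le> (1 + real CARD('n)) * K * (1 + \<bar>u\<bar>) ^ m" for u z
  proof -
    have "0 \<le> real CARD('n) * K * (1 + \<bar>u\<bar>) ^ m" using K by simp
    then show ?thesis using poly_boundedD(2)[OF bounded0, of u z] by (simp add: distrib_right)
  qed
  ultimately show ?thesis
    using poly_boundedD(1,3)[OF bounded0] by (simp add: poly_bounded_def)
qed

lemma fourier_orthogonal_component:
  assumes w: "w \<bullet> \<xi> = 0"  and \<xi>: "\<xi> \<noteq> 0"
  shows "(LINT z|lborel. form (0, w) (t, z) * exp (- \<i> * of_real (\<xi> \<bullet> z))) = 0"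
proof (cases "w = 0")
  case True
  then show ?thesis by (simp add: form_def)
next
  case False
  define e1 where "e1 = \<xi> /\<^sub>R norm \<xi>"
  define e2 where "e2 = w /\<^sub>R norm w"
  have n: "norm e1 \<le> 1" "norm e2 \<le> 1" using False \<xi> by (auto simp: e1_def e2_def)
  have "(LINT z|lborel. form (0, e2) (t, z) * exp (- \<i> * of_real (norm \<xi> * (e1 \<bullet> z)))) = 0"
  proof (rule plane_fourier_vanishes[OF form_time_bounded form_bounded[OF n(1)] form_bounded[OF n(2)]])
    show e: "e1 \<bullet> e1 = 1" "e2 \<bullet> e2 = 1" "e1 \<bullet> e2 = 0"
      using False \<xi> w by (auto simp: e1_def e2_def inner_commute dot_square_norm power2_eq_square)
    fix \<theta> t x
    define \<omega> where "\<omega> = sin \<theta> *\<^sub>R e1 + cos \<theta> *\<^sub>R e2"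
    have "\<omega> \<bullet> \<omega> = 1"
      using e by (simp add: \<omega>_def inner_add_left inner_add_right inner_commute[of e2 e1] flip: power2_eq_square)
    then have \<omega>: "norm \<omega> = 1" by (simp add: norm_eq_sqrt_inner)
    have "form (1, \<omega>) p = form (1, 0) p + of_real (sin \<theta>) * form (0, e1) p + of_real (cos \<theta>) * form (0, e2) p" for p
    proof -
      have "(1::real, \<omega>) = (1, 0) + (sin \<theta> *\<^sub>R (0, e1) + cos \<theta> *\<^sub>R (0, e2))" by (simp add: \<omega>_def)
      then show ?thesis by (simp only: form_add form_scale scaleR_conv_of_real add.assoc)
    qed
    then show "(LINT s|lborel. (\<lambda>p. form (1, 0) p + of_real (sin \<theta>) * form (0, e1) p + of_real (cos \<theta>) * form (0, e2) p)
         (t + s, x + s *\<^sub>R (sin \<theta> *\<^sub>R e1 + cos \<theta> *\<^sub>R e2))) = 0"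
      using form_null[OF \<omega>, of t x] by (simp add: \<omega>_def)
  qed
  moreover have "norm \<xi> * (e1 \<bullet> z) = \<xi> \<bullet> z" for z using \<xi> by (simp add: e1_def)
  moreover have "form (0, w) p = of_real (norm w) * form (0, e2) p" for p
  proof -
    have "(0::real, w) = norm w *\<^sub>R (0, e2)" using False by (simp add: e2_def)
    then show ?thesis by (simp only: form_scale scaleR_conv_of_real)
  qed
  ultimately show ?thesis by (simp add: mult.assoc)
qed

text \<open>Integration by parts along \<open>b\<close>.\<close>

lemma fourier_ddir:
  "(LINT z|lborel. ddir (form (0, a)) (0, b) (t, z) * exp (- \<i> * of_real (\<xi> \<bullet> z)))
     = \<i> * of_real (\<xi> \<bullet> b) * (LINT z|lborel. form (0, a) (t, z) * exp (- \<i> * of_real (\<xi> \<bullet> z)))"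
  and integrable_form_fourier: "integrable lborel (\<lambda>z. form (0, a) (t, z) * exp (- \<i> * of_real (\<xi> \<bullet> z)))"
  and integrable_ddir_fourier: "integrable lborel (\<lambda>z. ddir (form (0, a)) (0, b) (t, z) * exp (- \<i> * of_real (\<xi> \<bullet> z)))"
proof -
  let ?E = "\<lambda>z. exp (- \<i> * of_real (\<xi> \<bullet> z))"
  have c: "continuous_on UNIV (\<lambda>z. form (0, a) (t, z) * ?E z)" "continuous_on UNIV (\<lambda>z. ddir (form (0, a)) (0, b) (t, z) * ?E z)"
    by (intro continuous_intros continuous_on_compose2[OF C_infinity_continuous[OF form_smooth]]
       continuous_on_compose2[OF C_infinity_continuous[OF C_infinity_ddir[OF form_smooth]]], auto)+
  have s: "norm z > R \<Longrightarrow> ddir (form (0, a)) (0, b) (t, z) = 0" for z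
    by (rule ddir_form_supp)
  show i1: "integrable lborel (\<lambda>z. form (0, a) (t, z) * ?E z)"
    by (rule integrable_compact_support[OF c(1), of R]) (simp add: form_supp)
  show i2: "integrable lborel (\<lambda>z. ddir (form (0, a)) (0, b) (t, z) * ?E z)"
    by (rule integrable_compact_support[OF c(2), of R]) (simp add: s)
  define g' where "g' = (\<lambda>z. ddir (form (0, a)) (0, b) (t, z) * ?E z - \<i> * of_real (\<xi> \<bullet> b) * (form (0, a) (t, z) * ?E z))"
  have "(LINT z|lborel. g' z) = 0"
  proof (cases "b = 0")
    case True
    have "ddir (form (0, a)) (0, 0) p = 0" for p
      using linear_0[OF ddir_linear[OF form_smooth]] by (simp add: zero_prod_def)
    then show ?thesis by (simp add: g'_def True)
  next
    case False
    show ?thesis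
    proof (rule integral_directional_derivative_eq_0[OF _ _ _ _ False])
      fix z s
      have "((\<lambda>s. (t, z + s *\<^sub>R b)) has_vector_derivative (0, b)) (at s)"
        by (auto intro!: derivative_eq_intros has_vector_derivative_Pair)
      from ddir_along_curve[OF form_smooth this]
      have 1: "((\<lambda>s. form (0, a) (t, z + s *\<^sub>R b)) has_vector_derivative ddir (form (0, a)) (0, b) (t, z + s *\<^sub>R b)) (at s)" .
      have "((\<lambda>s. - \<i> * of_real (\<xi> \<bullet> (z + s *\<^sub>R b))) has_vector_derivative - \<i> * of_real (\<xi> \<bullet> b)) (at s)"
        by (auto intro!: derivative_eq_intros simp: inner_add_right)
      from field_vector_diff_chain_at[OF this DERIV_exp]
      have 2: "((\<lambda>s. ?E (z + s *\<^sub>R b)) has_vector_derivative (- \<i> * of_real (\<xi> \<bullet> b)) * ?E (z + s *\<^sub>R b)) (at s)"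
        by (simp add: o_def)
      show "((\<lambda>s. form (0, a) (t, z + s *\<^sub>R b) * ?E (z + s *\<^sub>R b)) has_vector_derivative g' (z + s *\<^sub>R b)) (at s)"
        using has_vector_derivative_mult[OF 1 2] by (simp add: g'_def algebra_simps)
    next
      show "continuous_on UNIV g'" unfolding g'_def by (intro continuous_on_diff continuous_on_mult_left c)
      show "form (0, a) (t, z) * ?E z = 0" "g' z = 0" if "norm z > R" for z
        using s[OF that] form_supp[OF that] by (simp_all add: g'_def)
    qed
  qed
  then show "(LINT z|lborel. ddir (form (0, a)) (0, b) (t, z) * ?E z) = \<i> * of_real (\<xi> \<bullet> b) * (LINT z|lborel. form (0, a) (t, z) * ?E z)"
    unfolding g'_def using i1 i2 by simp
qed

text \<open>
  The Fourier transform of the curl on \<open>a\<close> and \<open>b\<close> is the transform of the component of the form along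
  \<open>w = (\<xi> \<bullet> b) a - (\<xi> \<bullet> a) b\<close>, which is orthogonal to \<open>\<xi>\<close>.
\<close>

lemma spatially_closed: "ddir (form (0, a)) (0, b) p = ddir (form (0, b)) (0, a) p"
proof -
  obtain t x where p: "p = (t, x)" by (cases p)
  define G where "G = (\<lambda>z. ddir (form (0, a)) (0, b) (t, z) - ddir (form (0, b)) (0, a) (t, z))"
  have "G x = 0"
  proof (rule fourier_uniqueness[where R=R and G=G])
    show "continuous_on UNIV G"
      unfolding G_def
      by (intro continuous_intros continuous_on_compose2[OF C_infinity_continuous[OF C_infinity_ddir[OF form_smooth]]]) auto
    show "G z = 0" if "norm z > R" for z
      using ddir_form_supp[OF that] by (simp add: G_def)
    fix \<xi>
    define E where "E = (\<lambda>z::real^'n. exp (- \<i> * of_real (\<xi> \<bullet> z)))"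
    define w where "w = (\<xi> \<bullet> b) *\<^sub>R a - (\<xi> \<bullet> a) *\<^sub>R b"
    have "(LINT z|lborel. G z * E z) = (LINT z|lborel. ddir (form (0, a)) (0, b) (t, z) * E z) - (LINT z|lborel. ddir (form (0, b)) (0, a) (t, z) * E z)"
      unfolding G_def E_def left_diff_distrib by (intro Bochner_Integration.integral_diff integrable_ddir_fourier)
    also have "\<dots> = \<i> * (of_real (\<xi> \<bullet> b) * (LINT z|lborel. form (0, a) (t, z) * E z) - of_real (\<xi> \<bullet> a) * (LINT z|lborel. form (0, b) (t, z) * E z))"
      unfolding E_def fourier_ddir by (simp add: right_diff_distrib mult.assoc)
    also have "\<dots> = \<i> * (LINT z|lborel. form (0, w) (t, z) * E z)"
    proof -
      have "(0::real, w) = (\<xi> \<bullet> b) *\<^sub>R (0, a) + (- (\<xi> \<bullet> a)) *\<^sub>R (0, b)" by (simp add: w_def)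
      then have "form (0, w) q = of_real (\<xi> \<bullet> b) * form (0, a) q - of_real (\<xi> \<bullet> a) * form (0, b) q" for q
        by (simp only: form_add form_scale scaleR_conv_of_real) simp
      then have "(LINT z|lborel. form (0, w) (t, z) * E z)
         = (LINT z|lborel. of_real (\<xi> \<bullet> b) * (form (0, a) (t, z) * E z) - of_real (\<xi> \<bullet> a) * (form (0, b) (t, z) * E z))"
        by (simp add: left_diff_distrib mult.assoc)
      also have "\<dots> = of_real (\<xi> \<bullet> b) * (LINT z|lborel. form (0, a) (t, z) * E z) - of_real (\<xi> \<bullet> a) * (LINT z|lborel. form (0, b) (t, z) * E z)"
        unfolding E_def
        by (subst Bochner_Integration.integral_diff)
           (intro integrable_mult_right integrable_form_fourier, intro integrable_mult_right integrable_form_fourier, simp)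
      finally show ?thesis by simp
    qed
    also have "\<dots> = 0"
    proof (cases "\<xi> = 0")
      case True
      then show ?thesis by (simp add: w_def form_def)
    next
      case False
      have "w \<bullet> \<xi> = 0" by (simp add: w_def inner_diff_left inner_commute[of a \<xi>] inner_commute[of b \<xi>])
      from fourier_orthogonal_component[OF this False] show ?thesis by (simp add: E_def)
    qed
    finally show "(LINT z|lborel. G z * exp (- \<i> * of_real (\<xi> \<bullet> z))) = 0" by (simp add: E_def)
  qed
  then show ?thesis by (simp add: G_def p)
qed

text \<open>
  Along a ray of direction \<open>(1, \<omega>)\<close> the mixed component of the exterior derivative equals, by spatial closedness,
  the derivative of \<open>form (0, v)\<close> along the ray minus the \<open>v\<close>-derivative of \<open>form (1, \<omega>)\<close>. The first
  integrates to zero by compact support, the second because the ray integrals of \<open>form (1, \<omega>)\<close> vanish identically.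
  So the scalar injectivity theorem applies.
\<close>

lemma time_closed: "ddir (form (0, v)) (1, 0) p = ddir (form (1, 0)) (0, v) p"
proof -
  obtain t x where p: "p = (t, x)" by (cases p)
  define B where "B = (\<lambda>p. ddir (form (0, v)) (1, 0) p - ddir (form (1, 0)) (0, v) p)"
  have "B (t, x) = 0"
  proof (rule scalar_ray_transform_injective[where R=R])
    show "DIM(real ^ 'n) \<ge> 2" using dim by simp
    show "C_infinity B" unfolding B_def by (intro C_infinity_diff C_infinity_ddir form_smooth)
    show "B (t, x) = 0" if "norm x > R" for t x
      using ddir_form_supp[OF that] by (simp add: B_def)
    show "0 \<le> R" using R by simp
    fix t x and \<omega> :: "real ^ 'n" assume \<omega>: "norm \<omega> = 1"
    have ddir_add: "ddir (form u) (1, \<omega>) q = ddir (form u) (1, 0) q + ddir (form u) (0, \<omega>) q" for u q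
      using linear_add[OF ddir_linear[OF form_smooth[of u], of q], of "(1, 0)" "(0, \<omega>)"] by simp
    have form_ddir_add: "ddir (form (1, \<omega>)) u q = ddir (form (1, 0)) u q + ddir (form (0, \<omega>)) u q" for u q
      using linear_add[OF ddir_form_linear[where u=u and p=q], of "(1, 0)" "(0, \<omega>)"] by simp
    have B: "B q = ddir (form (0, v)) (1, \<omega>) q - ddir (form (1, \<omega>)) (0, v) q" for q
      unfolding B_def ddir_add form_ddir_add spatially_closed[where a=v and b=\<omega>] by simp
    have cont: "continuous_on UNIV (\<lambda>s. ddir (form u) w (t + s, x + s *\<^sub>R \<omega>))" for u w
      by (intro continuous_intros continuous_on_compose2[OF C_infinity_continuous[OF C_infinity_ddir[OF form_smooth]]]) auto
    have int: "integrable lborel (\<lambda>s. ddir (form u) w (t + s, x + s *\<^sub>R \<omega>))" for u w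
    proof (rule integrable_compact_support[OF cont])
      show "ddir (form u) w (t + s, x + s *\<^sub>R \<omega>) = 0" if "norm s > norm x + R" for s
        using ddir_form_supp[OF ray_leaves_ball[OF \<omega>]] that by simp
    qed
    have "(LINT s|lborel. ddir (form (0, v)) (1, \<omega>) (t + s, x + s *\<^sub>R \<omega>)) = 0"
    proof (rule integral_derivative_compact_support)
      fix s
      have "((\<lambda>s. (t + s, x + s *\<^sub>R \<omega>)) has_vector_derivative (1, \<omega>)) (at s)"
        by (auto intro!: derivative_eq_intros has_vector_derivative_Pair)
      from ddir_along_curve[OF form_smooth this]
      show "((\<lambda>s. form (0, v) (t + s, x + s *\<^sub>R \<omega>)) has_vector_derivative ddir (form (0, v)) (1, \<omega>) (t + s, x + s *\<^sub>R \<omega>)) (at s)" .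
      show "form (0, v) (t + s, x + s *\<^sub>R \<omega>) = 0" if "\<bar>s\<bar> > norm x + R" for s
        using form_supp[OF ray_leaves_ball[OF \<omega> that]] .
    qed (rule cont)
    moreover have "(LINT s|lborel. ddir (form (1, \<omega>)) (0, v) (t + s, x + s *\<^sub>R \<omega>)) = 0"
      by (rule ray_integral_ddir[OF form_smooth form_supp \<omega> form_null[OF \<omega>]])
    ultimately show "(LINT s|lborel. B (t + s, x + s *\<^sub>R \<omega>)) = 0"
      unfolding B using int by simp
  qed
  then show ?thesis by (simp add: B_def p)
qed

lemma form_closed: "ddir (form u) v p = ddir (form v) u p"
proof -
  have decomp: "w = fst w *\<^sub>R (1, 0) + (0, snd w)" for w :: "real \<times> (real ^ 'n)"
    by (simp add: prod_eq_iff)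
  have expand: "ddir (form u) v p = (fst u * fst v) *\<^sub>R ddir (form (1, 0)) (1, 0) p + fst u *\<^sub>R ddir (form (1, 0)) (0, snd v) p
      + fst v *\<^sub>R ddir (form (0, snd u)) (1, 0) p + ddir (form (0, snd u)) (0, snd v) p" for u v
  proof -
    have "ddir (form u) v p = fst u *\<^sub>R ddir (form (1, 0)) v p + ddir (form (0, snd u)) v p"
      by (subst decomp[of u]) (simp only: linear_add[OF ddir_form_linear] linear_scale[OF ddir_form_linear])
    moreover have "ddir (form w) v p = fst v *\<^sub>R ddir (form w) (1, 0) p + ddir (form w) (0, snd v) p" for w
      by (subst decomp[of v]) (simp only: linear_add[OF ddir_linear[OF form_smooth]] linear_scale[OF ddir_linear[OF form_smooth]])
    ultimately show ?thesis by (simp add: scaleR_add_right)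
  qed
  show ?thesis
    unfolding expand[where u=u and v=v] expand[where u=v and v=u] time_closed spatially_closed[where a="snd u"] by (simp add: mult.commute)
qed

lemma potential:
  obtains \<phi> where "C_infinity \<phi>" "\<And>p. (\<phi> has_derivative (\<lambda>v. form v p)) (at p)"
    "supp \<phi> \<subseteq> UNIV \<times> {x. norm x \<le> R}"
proof -
  define \<phi>0 where "\<phi>0 = (\<lambda>p. integral {0..1} (\<lambda>r. form p (r *\<^sub>R p)))"
  have der0: "(\<phi>0 has_derivative (\<lambda>v. form v p)) (at p)" for p
    unfolding \<phi>0_def by (rule poincare[OF form_linear form_smooth form_closed])
  define U where "U = (UNIV :: real set) \<times> (- cball (0::real^'n) R)"
  have U: "open U" "connected U"
    unfolding U_def using dim
    by (auto intro!: open_Times connected_Times connected_complement_bounded_convex)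
  obtain y where y: "norm (y :: real ^ 'n) = R + 1" using vector_choose_size[of "R + 1"] R by auto
  define \<phi> where "\<phi> = (\<lambda>p. \<phi>0 p - \<phi>0 (0, y))"
  have der: "(\<phi> has_derivative (\<lambda>v. form v p)) (at p)" for p
    unfolding \<phi>_def using has_derivative_diff[OF der0 has_derivative_const] by simp
  have "\<phi> (t, x) = 0" if "norm x > R" for t x
  proof -
    have "\<phi>0 (t, x) = \<phi>0 (0, y)"
    proof (rule has_derivative_zero_unique_connected[OF U])
      show "(\<phi>0 has_derivative (\<lambda>v. 0)) (at p)" if "p \<in> U" for p
      proof -
        have "form v p = 0" for v using that form_supp[of "snd p" v "fst p"] by (auto simp: U_def)
        then show ?thesis using der0[of p] by simp
      qed
    qed (use that y in \<open>auto simp: U_def\<close>)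
    then show ?thesis by (simp add: \<phi>_def)
  qed
  then have "{p. \<phi> p \<noteq> 0} \<subseteq> UNIV \<times> {x. norm x \<le> R}" by (auto simp: not_less[symmetric])
  moreover have "closed ((UNIV :: real set) \<times> {x::real^'n. norm x \<le> R})"
    by (intro closed_Times closed_UNIV closed_Collect_le continuous_intros)
  ultimately have "supp \<phi> \<subseteq> UNIV \<times> {x. norm x \<le> R}" unfolding supp_def by (rule closure_minimal)
  moreover have "C_infinity \<phi>" by (rule C_infinityI[OF der form_smooth])
  ultimately show ?thesis using that der by blast
qed

end

text \<open>For \<open>\<bar>t\<bar> \<le> t0\<close> a continuous function with compact support in \<open>x\<close> is bounded. The conclusion holds for all
  large constants so that one of them serves finitely many components at once.\<close>

lemma poly_boundedI:
  fixes a :: "real \<times> 'b::euclidean_space \<Rightarrow> complex"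
  assumes cont: "continuous_on UNIV a" and R: "\<And>t x. norm x \<ge> R \<Longrightarrow> a (t, x) = 0"
    and bound: "\<And>t x. \<bar>t\<bar> \<ge> t0 \<Longrightarrow> norm (a (t, x)) \<le> C * (1 + \<bar>t\<bar>) powr M" and C: "C \<ge> 0"
  shows "\<exists>B\<ge>0. \<forall>K\<ge>B + C. poly_bounded R (nat \<lceil>M\<rceil>) K a"
proof -
  obtain B where B: "B \<ge> 0" "\<And>p. p \<in> {-t0..t0} \<times> cball 0 R \<Longrightarrow> norm (a p) \<le> B"
    by (rule compact_norm_bound[OF continuous_on_subset[OF cont subset_UNIV], of "{-t0..t0} \<times> cball 0 R"])
       (auto intro: compact_Times)
  have "poly_bounded R (nat \<lceil>M\<rceil>) K a" if K: "K \<ge> B + C" for K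
  proof -
    have "norm (a (u, z)) \<le> K * (1 + \<bar>u\<bar>) ^ nat \<lceil>M\<rceil>" for u z
    proof (cases "\<bar>u\<bar> \<ge> t0")
      case True
      have "(1 + \<bar>u\<bar>) powr M \<le> (1 + \<bar>u\<bar>) powr real (nat \<lceil>M\<rceil>)"
        by (intro powr_mono real_nat_ceiling_ge) auto
      also have "\<dots> = (1 + \<bar>u\<bar>) ^ nat \<lceil>M\<rceil>" by (simp add: powr_realpow)
      finally have "C * (1 + \<bar>u\<bar>) powr M \<le> K * (1 + \<bar>u\<bar>) ^ nat \<lceil>M\<rceil>"
        using C B(1) K by (intro mult_mono) auto
      then show ?thesis using bound[OF True, of z] by linarith
    next
      case False
      have "norm (a (u, z)) \<le> B"
      proof (cases "norm z \<le> R")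
        case True
        then show ?thesis using False by (intro B(2)) auto
      next
        case False
        then show ?thesis using R[of z u] B(1) by simp
      qed
      also have "\<dots> \<le> K * 1" using K C by simp
      also have "\<dots> \<le> K * (1 + \<bar>u\<bar>) ^ nat \<lceil>M\<rceil>" using K C B(1) by (intro mult_left_mono) auto
      finally show ?thesis .
    qed
    then show ?thesis using cont R by (simp add: poly_bounded_def)
  qed
  then show ?thesis using B(1) by blast
qed

theorem theorem6p3:
  fixes A0 :: "real \<times> (real ^ 'n) \<Rightarrow> complex"
    and A :: "'n \<Rightarrow> real \<times> (real ^ 'n) \<Rightarrow> complex"
    and C M t0 R :: real
  assumes "CARD('n) \<ge> 2"
    and "t0 > 0" and "R > 0" and "C > 0" and "M > 0"
    and "C_infinity A0" and "\<And>j. C_infinity (A j)"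
    and "\<And>t x. \<bar>t\<bar> \<ge> t0 \<Longrightarrow> norm (A0 (t, x)) \<le> C * (1 + \<bar>t\<bar>) powr M"
    and "\<And>j t x. \<bar>t\<bar> \<ge> t0 \<Longrightarrow> norm (A j (t, x)) \<le> C * (1 + \<bar>t\<bar>) powr M"
    and "locally_integrable (\<lambda>p. norm (A0 p))"
    and "\<And>j. locally_integrable (\<lambda>p. norm (A j p))"
    and "\<And>t x. norm x \<ge> R \<Longrightarrow> A0 (t, x) = 0"
    and "\<And>j t x. norm x \<ge> R \<Longrightarrow> A j (t, x) = 0"
    and "\<And>t x \<omega>. \<omega> \<in> sphere 0 1 \<Longrightarrow>
           (LBINT s. A0 (t + s, x + s *\<^sub>R \<omega>)
              + (\<Sum>j\<in>UNIV. complex_of_real (\<omega> $ j) * A j (t + s, x + s *\<^sub>R \<omega>))) = 0"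
  shows "\<exists>\<phi> :: real \<times> (real ^ 'n) \<Rightarrow> complex.
           C_infinity \<phi>
         \<and> (\<forall>t x. ((\<lambda>s. \<phi> (s, x)) has_vector_derivative A0 (t, x)) (at t))
         \<and> (\<forall>j t x. ((\<lambda>h. \<phi> (t, x + h *\<^sub>R axis j 1)) has_vector_derivative A j (t, x)) (at 0))
         \<and> supp \<phi> \<subseteq> UNIV \<times> {x. norm x \<le> R}"
proof -
  obtain B0 where B0: "B0 \<ge> 0" "\<And>K. K \<ge> B0 + C \<Longrightarrow> poly_bounded R (nat \<lceil>M\<rceil>) K A0"
    using poly_boundedI[of A0 R t0 C M, OF C_infinity_continuous[OF assms(6)] assms(12,8)] assms(4) by (auto simp: less_imp_le)
  have "\<exists>B\<ge>0. \<forall>K\<ge>B + C. poly_bounded R (nat \<lceil>M\<rceil>) K (A j)" for j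
    using poly_boundedI[of "A j" R t0 C M, OF C_infinity_continuous[OF assms(7)] assms(13,9)] assms(4) by (auto simp: less_imp_le)
  then obtain B where B: "\<And>j. B j \<ge> 0" "\<And>j K. K \<ge> B j + C \<Longrightarrow> poly_bounded R (nat \<lceil>M\<rceil>) K (A j)"
    by metis
  define K where "K = B0 + (\<Sum>j\<in>UNIV. B j) + C"
  have K0: "K \<ge> B0 + C" using B(1) by (simp add: K_def sum_nonneg)
  have Kj: "K \<ge> B j + C" for j
    using member_le_sum[of j UNIV B] B(1) B0(1) by (simp add: K_def)
  interpret ray_trivial_form A0 A R K "nat \<lceil>M\<rceil>"
    by unfold_locales (use assms(1,3,6,7,14) B0(2)[OF K0] B(2)[OF Kj] in auto)
  obtain \<phi> where \<phi>: "C_infinity \<phi>" "\<And>p. (\<phi> has_derivative (\<lambda>v. form v p)) (at p)"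
    "supp \<phi> \<subseteq> UNIV \<times> {x. norm x \<le> R}"
    by (rule potential) blast
  have "((\<lambda>s. \<phi> (s, x)) has_vector_derivative A0 (t, x)) (at t)" for t x
  proof -
    have "((\<lambda>s. (s, x)) has_vector_derivative (1, 0)) (at t)"
      by (auto intro!: derivative_eq_intros has_vector_derivative_Pair)
    from has_vector_derivative_along_curve[OF \<phi>(2) this] show ?thesis by (simp add: form_def)
  qed
  moreover have "((\<lambda>h. \<phi> (t, x + h *\<^sub>R axis j 1)) has_vector_derivative A j (t, x)) (at 0)" for j t x
  proof -
    have "((\<lambda>h. (t, x + h *\<^sub>R axis j 1)) has_vector_derivative (0, axis j 1)) (at (0::real))"
      by (auto intro!: derivative_eq_intros has_vector_derivative_Pair)
    from has_vector_derivative_along_curve[OF \<phi>(2) this]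
    have "((\<lambda>h. \<phi> (t, x + h *\<^sub>R axis j 1)) has_vector_derivative form (0, axis j 1) (t, x)) (at 0)" by simp
    moreover have "form (0, axis j 1) p = A j p" for p
    proof -
      have "form (0, axis j 1) p = (\<Sum>k\<in>UNIV. if k = j then A k p else 0)"
        unfolding form_def by (simp add: axis_def if_distrib[of of_real] if_distrib[of "\<lambda>c. c * _"] cong: if_cong)
      then show ?thesis by simp
    qed
    ultimately show ?thesis by simp
  qed
  ultimately show ?thesis using \<phi>(1,3) by blast
qed

end
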